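(* Let $s\ge2$. If $u_0,v_0\in E_{1,s+1}$, then there exists a positive time $T=T(u_0,v_0;s)$ such that for every $\delta\in(0,1)$, the Cauchy problem $$\begin{cases}u_t+\beta uu_x+(1-\partial_x^2)^{-1}\partial_x\left[-\alpha u+\frac{3-\beta}{2}u^2+\frac{\beta}{2}u_x^2+v+\frac12 v^2\right]=0,\\ v_t+u_x+(uv)_x=0,\\ u(0,x)=u_0(x),\\ v(0,x)=v_0(x)\end{cases}$$ has a unique solution which is a holomorphic function valued in $E_{\delta,s+1}\oplus E_{\delta,s+1}$ in the disk $D(0,T(1-\delta))$. Furthermore, the analytic lifespan $T$ satisfies $$T\approx\frac{\mathrm{const.}}{\|(u_0,v_0)\|_{(1,s+1)}}$$ for large initial values and $$T\approx\mathrm{const.}$$ for small initial values.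
   Context: $\alpha,\beta$ are the real constants appearing in the system (a generalized two-component Camassa-Holm system) and $D(0,a)=\{t\in\mathbb{C}:|t|<a\}$. The spaces $L^2(\mathbb{R})$, $\mathcal{C}^\infty(\mathbb{R})$ and their subspaces consist of real-valued functions on $\mathbb{R}$. $H^s=H^s(\mathbb{R})$ has norm $\|f\|_s=\|(1+\xi^2)^{s/2}\hat f(\xi)\|_{L^2}$. For $0<\delta\le1$ and $s\ge2$, $$\|f\|_{(\delta,s)}=\sup_{k\ge0}\frac{\delta^k(k+1)^2\|f^{(k)}\|_s}{k!},\qquad E_{\delta,s}=\{f\in\mathcal{C}^\infty(\mathbb{R}):\|f\|_{(\delta,s)}<\infty\},$$ which is a Banach space. For pairs, $\|(u,v)\|_{(\delta,s+1)}=\|u\|_{(\delta,s+1)}+\|v\|_{(\delta,s+1)}$.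
   Formalization: The solution takes values in the complexification of E_{δ,s+1}⊕E_{δ,s+1} (real-valued at real times, unique among complex-valued solutions), since a holomorphic function of complex t valued in real functions would be constant in t; the initial data stay real-valued. *)

theory Defs
  imports "HOL-Analysis.Analysis" "HOL-Library.Landau_Symbols"
begin

(* The function spaces are built from complex-valued functions on the real line, i.e. they are the
   complexifications of the spaces of real-valued functions: a function of complex time that is
   holomorphic can only take its values in a complex Banach space.  The real spaces are recovered
   through the embedding of_real (analytic_space_real below). *)

definition square_integrable :: "(real \<Rightarrow> complex) set" where
  "square_integrable =
     {f. f \<in> borel_measurable lborel \<and> integrable lborel (\<lambda>x. (cmod (f x))\<^sup>2)}"

definition L2_norm :: "(real \<Rightarrow> complex) \<Rightarrow> real" where
  "L2_norm f = sqrt (LINT x|lborel. (cmod (f x))\<^sup>2)"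

definition truncated_fourier :: "real \<Rightarrow> (real \<Rightarrow> complex) \<Rightarrow> real \<Rightarrow> complex" where
  "truncated_fourier R f \<xi> = (LINT x:{-R..R}|lborel. cis (- (x * \<xi>)) * f x)"

(* The Fourier transform on L^2 as the limit in the mean of the truncated integrals
   (Plancherel); it is determined up to null sets. *)
definition is_fourier_transform :: "(real \<Rightarrow> complex) \<Rightarrow> (real \<Rightarrow> complex) \<Rightarrow> bool" where
  "is_fourier_transform f g \<longleftrightarrow> g \<in> square_integrable \<and>
     ((\<lambda>R. \<integral>\<^sup>+\<xi>. ennreal ((cmod (truncated_fourier R f \<xi> - g \<xi>))\<^sup>2) \<partial>lborel) \<longlongrightarrow> 0) at_top"

definition fourier :: "(real \<Rightarrow> complex) \<Rightarrow> real \<Rightarrow> complex" where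
  "fourier f = (SOME g. is_fourier_transform f g)"

definition sobolev_weight :: "real \<Rightarrow> (real \<Rightarrow> complex) \<Rightarrow> real \<Rightarrow> complex" where
  "sobolev_weight s f \<xi> = of_real ((1 + \<xi>\<^sup>2) powr (s / 2)) * fourier f \<xi>"

definition sobolev :: "real \<Rightarrow> (real \<Rightarrow> complex) set" where
  "sobolev s = {f \<in> square_integrable. sobolev_weight s f \<in> square_integrable}"

definition sobolev_norm :: "real \<Rightarrow> (real \<Rightarrow> complex) \<Rightarrow> real" where
  "sobolev_norm s f = L2_norm (sobolev_weight s f)"

definition Dx :: "(real \<Rightarrow> complex) \<Rightarrow> real \<Rightarrow> complex" where
  "Dx f = (\<lambda>x. vector_derivative f (at x))"

definition smooth :: "(real \<Rightarrow> complex) set" where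
  "smooth = {f. \<forall>k x. (Dx ^^ k) f differentiable (at x)}"

definition analytic_term :: "real \<Rightarrow> real \<Rightarrow> (real \<Rightarrow> complex) \<Rightarrow> nat \<Rightarrow> real" where
  "analytic_term \<delta> s f k = \<delta> ^ k * (real k + 1)\<^sup>2 * sobolev_norm s ((Dx ^^ k) f) / fact k"

(* Finiteness of the supremum is expressed by its two ingredients: every term is the norm of an
   element of H^s, and the terms are bounded. *)
definition analytic_space :: "real \<Rightarrow> real \<Rightarrow> (real \<Rightarrow> complex) set" where
  "analytic_space \<delta> s =
     {f \<in> smooth. (\<forall>k. (Dx ^^ k) f \<in> sobolev s) \<and> bdd_above (range (analytic_term \<delta> s f))}"

(* Meaningful only for members of analytic_space \<delta> s. *)
definition analytic_norm :: "real \<Rightarrow> real \<Rightarrow> (real \<Rightarrow> complex) \<Rightarrow> real" where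
  "analytic_norm \<delta> s f = (SUP k. analytic_term \<delta> s f k)"

definition analytic_space_real :: "real \<Rightarrow> real \<Rightarrow> (real \<Rightarrow> real) set" where
  "analytic_space_real \<delta> s = {f. (\<lambda>x. of_real (f x)) \<in> analytic_space \<delta> s}"

definition pair_norm :: "real \<Rightarrow> real \<Rightarrow> (real \<Rightarrow> complex) \<Rightarrow> (real \<Rightarrow> complex) \<Rightarrow> real" where
  "pair_norm \<delta> s f g = analytic_norm \<delta> s f + analytic_norm \<delta> s g"

definition pair_norm_real :: "real \<Rightarrow> real \<Rightarrow> (real \<Rightarrow> real) \<times> (real \<Rightarrow> real) \<Rightarrow> real" where
  "pair_norm_real \<delta> s w =
     pair_norm \<delta> s (\<lambda>x. of_real (fst w x)) (\<lambda>x. of_real (snd w x))"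

(* Complex differentiability, in the norm of the direct sum of two copies of
   analytic_space \<delta> s, of t \<mapsto> (u t, v t) at every point of the open set D. *)
definition holomorphic_pair ::
    "real \<Rightarrow> real \<Rightarrow> complex set \<Rightarrow> (complex \<Rightarrow> real \<Rightarrow> complex) \<Rightarrow> (complex \<Rightarrow> real \<Rightarrow> complex) \<Rightarrow> bool"
  where
  "holomorphic_pair \<delta> s D u v \<longleftrightarrow>
     (\<forall>t\<in>D. u t \<in> analytic_space \<delta> s \<and> v t \<in> analytic_space \<delta> s) \<and>
     (\<forall>t\<in>D. \<exists>p\<in>analytic_space \<delta> s. \<exists>q\<in>analytic_space \<delta> s.
        ((\<lambda>h. pair_norm \<delta> s (\<lambda>x. (u (t + h) x - u t x) / h - p x)
                             (\<lambda>x. (v (t + h) x - v t x) / h - q x)) \<longlongrightarrow> 0) (at 0))"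

(* The inverse of 1 - d^2/dx^2.  On smooth functions in H^2 this operator is injective, because
   its classical kernel is spanned by exp x and exp (-x). *)
definition helmholtz_inv :: "(real \<Rightarrow> complex) \<Rightarrow> real \<Rightarrow> complex" where
  "helmholtz_inv = inv_into (smooth \<inter> sobolev 2) (\<lambda>w x. w x - (Dx ^^ 2) w x)"

definition CH_flux :: "real \<Rightarrow> real \<Rightarrow> (real \<Rightarrow> complex) \<Rightarrow> (real \<Rightarrow> complex) \<Rightarrow> real \<Rightarrow> complex" where
  "CH_flux \<alpha> \<beta> f g x =
     - of_real \<alpha> * f x + of_real ((3 - \<beta>) / 2) * (f x)\<^sup>2 + of_real (\<beta> / 2) * (Dx f x)\<^sup>2
     + g x + (g x)\<^sup>2 / 2"

definition solves_CH ::
    "real \<Rightarrow> real \<Rightarrow> complex set \<Rightarrow> (real \<Rightarrow> real) \<Rightarrow> (real \<Rightarrow> real)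
      \<Rightarrow> (complex \<Rightarrow> real \<Rightarrow> complex) \<Rightarrow> (complex \<Rightarrow> real \<Rightarrow> complex) \<Rightarrow> bool" where
  "solves_CH \<alpha> \<beta> D u0 v0 u v \<longleftrightarrow>
     (\<forall>x. u 0 x = of_real (u0 x) \<and> v 0 x = of_real (v0 x)) \<and>
     (\<forall>t\<in>D. \<forall>x. \<exists>ut vt.
        ((\<lambda>\<tau>. u \<tau> x) has_field_derivative ut) (at t) \<and>
        ((\<lambda>\<tau>. v \<tau> x) has_field_derivative vt) (at t) \<and>
        ut + of_real \<beta> * u t x * Dx (u t) x + helmholtz_inv (Dx (CH_flux \<alpha> \<beta> (u t) (v t))) x = 0 \<and>
        vt + Dx (u t) x + Dx (\<lambda>y. u t y * v t y) x = 0)"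

definition analytic_solution ::
    "real \<Rightarrow> real \<Rightarrow> real \<Rightarrow> real \<Rightarrow> complex set \<Rightarrow> (real \<Rightarrow> real) \<Rightarrow> (real \<Rightarrow> real)
      \<Rightarrow> (complex \<Rightarrow> real \<Rightarrow> complex) \<Rightarrow> (complex \<Rightarrow> real \<Rightarrow> complex) \<Rightarrow> bool" where
  "analytic_solution \<alpha> \<beta> \<delta> s D u0 v0 u v \<longleftrightarrow>
     holomorphic_pair \<delta> s D u v \<and> solves_CH \<alpha> \<beta> D u0 v0 u v"

definition initial_data :: "real \<Rightarrow> ((real \<Rightarrow> real) \<times> (real \<Rightarrow> real)) set" where
  "initial_data s = analytic_space_real 1 s \<times> analytic_space_real 1 s"

definition large_data :: "real \<Rightarrow> ((real \<Rightarrow> real) \<times> (real \<Rightarrow> real)) filter" where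
  "large_data s = inf (filtercomap (pair_norm_real 1 s) at_top) (principal (initial_data s))"

definition small_data :: "real \<Rightarrow> ((real \<Rightarrow> real) \<times> (real \<Rightarrow> real)) filter" where
  "small_data s = inf (filtercomap (pair_norm_real 1 s) (nhds 0)) (principal (initial_data s))"

end

theory Submission
  imports Defs "HOL-Probability.Probability" "HOL-Complex_Analysis.Complex_Analysis"
begin

text \<open>
  The system loses one derivative in \<open>x\<close>, and the scale of analytic spaces makes up for it. Instead of a
  fixed point in that scale the proof uses the power series in time
  \<open>u = (\<Sum>n. a n * t ^ n)\<close>, \<open>v = (\<Sum>n. b n * t ^ n)\<close>, whose coefficients are determined recursively by the
  system. With \<open>r = s + 1\<close> and \<open>N\<close> the norm of the initial data, an induction (\<open>dominated_coefficients\<close>)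
  shows that the norm of \<open>(Dx ^^ k) (a n) / fact k\<close> in the Sobolev space of order \<open>r\<close> is at most
  \<open>N * K ^ n * (n + k choose k) / (n + k + 1)\<^sup>2\<close>, the coefficient of \<open>t ^ n * y ^ k\<close> in a function of
  \<open>y + K * t\<close>. The weight \<open>(k + 1)\<^sup>2\<close> in the definition of the analytic norm is what makes this work: the
  coefficients \<open>1 / (m + 1)\<^sup>2\<close> reproduce themselves under products of power series up to a constant
  (\<open>majorant_convolution\<close>), and the derivative in \<open>x\<close> that is lost is compensated by the factor \<open>n + 1\<close> that
  the derivative in time gains (\<open>majorant_shift\<close>). The induction closes when \<open>K\<close> is a constant multiple of
  \<open>1 + N\<close>. Since \<open>(n + k choose k) * \<delta> ^ k \<le> (1 - \<delta>) powr (- n)\<close>, the series converges in the analytic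
  space of index \<open>\<delta>\<close> for \<open>cmod t < (1 - \<delta>) / K\<close>, which gives the disk with \<open>T = 1 / K\<close> and both
  asymptotic statements about \<open>T\<close>.

  Estimates of this kind need four facts about Sobolev spaces of real order: they are algebras under
  multiplication, they embed into the bounded functions, absolutely convergent series
  converge, and \<open>f \<mapsto> (1 - d\<^sup>2/dx\<^sup>2)\<^sup>-\<^sup>1 f'\<close> gains one order. All four are elementary for the Fourier transforms once
  functions are known to be the inverse transforms of their transforms. For the transform as a limit in
  the mean this rests on Bessel's inequality (\<open>Bessel_FT\<close>), on completeness of \<open>L\<^sup>2\<close> and on Levy's inversion
  formula, from which inversion follows in both directions (\<open>fourier_IFT\<close>, \<open>IFT_fourier\<close>).

  For uniqueness, the difference of two solutions is bounded near time zero together with all its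
  derivatives in \<open>x\<close>. If it vanishes there to order \<open>n\<close>, so does the difference of the right hand sides, and
  integration in time raises the order by one. A holomorphic function that vanishes to
  infinite order vanishes on the whole disk (\<open>CH_solution_unique\<close>). The nonlocal term is controlled
  in the maximum norm because bounded solutions of \<open>w - w'' = g\<close> are bounded by \<open>g\<close> (\<open>helmholtz_bound\<close>).
\<close>

section \<open>Square integrable functions\<close>

lemma square_integrableD:
  assumes "f \<in> square_integrable"
  shows "f \<in> borel_measurable borel"
    and "(\<integral>\<^sup>+x. ennreal ((cmod (f x))\<^sup>2) \<partial>lborel) = ennreal ((L2_norm f)\<^sup>2)"
proof -
  show "f \<in> borel_measurable borel"
    using assms by (simp add: square_integrable_def)
  have i: "integrable lborel (\<lambda>x. (cmod (f x))\<^sup>2)"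
    using assms by (simp add: square_integrable_def)
  have "(LINT x|lborel. (cmod (f x))\<^sup>2) \<ge> 0"
    by simp
  then show "(\<integral>\<^sup>+x. ennreal ((cmod (f x))\<^sup>2) \<partial>lborel) = ennreal ((L2_norm f)\<^sup>2)"
    by (subst nn_integral_eq_integral[OF i]) (auto simp: L2_norm_def)
qed

lemma L2_norm_nonneg [simp]: "L2_norm f \<ge> 0"
  by (simp add: L2_norm_def)

text \<open>Integrability and the bound of the norm come from a single estimate of a nonnegative integral; most
  estimates below are proved in this form.\<close>

lemma L2_normI:
  assumes [measurable]: "f \<in> borel_measurable borel" and c: "c \<ge> 0"
    and le: "(\<integral>\<^sup>+x. ennreal ((cmod (f x))\<^sup>2) \<partial>lborel) \<le> ennreal (c\<^sup>2)"
  shows "f \<in> square_integrable" and "L2_norm f \<le> c"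
proof -
  have i: "integrable lborel (\<lambda>x. (cmod (f x))\<^sup>2)"
    by (rule integrableI_bounded) (use le in \<open>auto simp: le_less_trans\<close>)
  then show s: "f \<in> square_integrable"
    by (simp add: square_integrable_def)
  have "ennreal ((L2_norm f)\<^sup>2) \<le> ennreal (c\<^sup>2)"
    using square_integrableD(2)[OF s] le by simp
  then show "L2_norm f \<le> c"
    using c by (simp add: power2_le_iff_abs_le)
qed

lemma L2_norm_mono_AE:
  assumes g: "g \<in> square_integrable" and [measurable]: "f \<in> borel_measurable borel"
    and le: "AE x in lborel. cmod (f x) \<le> cmod (g x)"
  shows "f \<in> square_integrable" and "L2_norm f \<le> L2_norm g"
proof -
  have "(\<integral>\<^sup>+x. ennreal ((cmod (f x))\<^sup>2) \<partial>lborel) \<le> (\<integral>\<^sup>+x. ennreal ((cmod (g x))\<^sup>2) \<partial>lborel)"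
    using le by (intro nn_integral_mono_AE) (auto intro!: ennreal_leI power_mono elim!: eventually_mono)
  also have "\<dots> = ennreal ((L2_norm g)\<^sup>2)"
    by (rule square_integrableD[OF g])
  finally have *: "(\<integral>\<^sup>+x. ennreal ((cmod (f x))\<^sup>2) \<partial>lborel) \<le> ennreal ((L2_norm g)\<^sup>2)" .
  show "f \<in> square_integrable" "L2_norm f \<le> L2_norm g"
    using L2_normI[OF _ _ *] by auto
qed

lemma L2_norm_cong_AE:
  assumes g: "g \<in> square_integrable" and [measurable]: "f \<in> borel_measurable borel"
    and eq: "AE x in lborel. f x = g x"
  shows "f \<in> square_integrable" and "L2_norm f = L2_norm g"
proof -
  have le: "AE x in lborel. cmod (f x) \<le> cmod (g x)" "AE x in lborel. cmod (g x) \<le> cmod (f x)"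
    using eq by auto
  show f: "f \<in> square_integrable" by (rule L2_norm_mono_AE[OF g _ le(1)]) simp
  show "L2_norm f = L2_norm g"
    using L2_norm_mono_AE(2)[OF g _ le(1)] L2_norm_mono_AE(2)[OF f _ le(2)]
      square_integrableD(1)[OF g] by (simp add: antisym)
qed

lemma L2_norm_eq_0:
  assumes "f \<in> square_integrable" "L2_norm f = 0"
  shows "AE x in lborel. f x = 0"
proof -
  note [measurable] = square_integrableD(1)[OF assms(1)]
  have "(\<integral>\<^sup>+x. ennreal ((cmod (f x))\<^sup>2) \<partial>lborel) = 0"
    using square_integrableD(2)[OF assms(1)] assms(2) by simp
  then show ?thesis
    by (subst (asm) nn_integral_0_iff_AE) auto
qed

lemma L2_cmult:
  assumes "f \<in> square_integrable"
  shows "(\<lambda>x. c * f x) \<in> square_integrable" and "L2_norm (\<lambda>x. c * f x) = cmod c * L2_norm f"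
  using assms by (auto simp: square_integrable_def L2_norm_def norm_mult power_mult_distrib
      real_sqrt_mult)

lemma L2_zero: "(\<lambda>x. 0) \<in> square_integrable" "L2_norm (\<lambda>x. 0) = 0"
  by (auto simp: square_integrable_def L2_norm_def)

text \<open>Minkowski's inequality by optimising the weight in
  \<open>\<bar>a + b\<bar>\<^sup>2 \<le> (1 + d / c) \<bar>a\<bar>\<^sup>2 + (1 + c / d) \<bar>b\<bar>\<^sup>2\<close>.\<close>

lemma L2_add:
  assumes f: "f \<in> square_integrable" and g: "g \<in> square_integrable"
  shows "(\<lambda>x. f x + g x) \<in> square_integrable" and "L2_norm (\<lambda>x. f x + g x) \<le> L2_norm f + L2_norm g"
proof -
  note [measurable] = square_integrableD(1)[OF f] square_integrableD(1)[OF g]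
  define I where "I = (\<integral>\<^sup>+x. ennreal ((cmod (f x + g x))\<^sup>2) \<partial>lborel)"
  have *: "I \<le> ennreal ((c + d)\<^sup>2)" if cd: "c > L2_norm f" "d > L2_norm g" for c d
  proof -
    have c0: "c > 0" and d0: "d > 0"
      using cd L2_norm_nonneg[of f] L2_norm_nonneg[of g] by linarith+
    have pt: "(cmod (a + b))\<^sup>2 \<le> (1 + d / c) * (cmod a)\<^sup>2 + (1 + c / d) * (cmod b)\<^sup>2" for a b
    proof -
      have "(cmod (a + b))\<^sup>2 \<le> (cmod a + cmod b)\<^sup>2"
        by (intro power_mono norm_triangle_ineq) auto
      also have "\<dots> = (1 + d / c) * (cmod a)\<^sup>2 + (1 + c / d) * (cmod b)\<^sup>2 - (d * cmod a - c * cmod b)\<^sup>2 / (c * d)"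
        using c0 d0 by (simp add: field_simps power2_eq_square)
      also have "\<dots> \<le> (1 + d / c) * (cmod a)\<^sup>2 + (1 + c / d) * (cmod b)\<^sup>2"
        using c0 d0 by simp
      finally show ?thesis .
    qed
    have "I \<le> (\<integral>\<^sup>+x. ennreal (1 + d / c) * ennreal ((cmod (f x))\<^sup>2) + ennreal (1 + c / d) * ennreal ((cmod (g x))\<^sup>2) \<partial>lborel)"
      unfolding I_def using c0 d0 pt
      by (intro nn_integral_mono) (simp add: ennreal_plus[symmetric] ennreal_mult[symmetric] del: ennreal_plus)
    also have "\<dots> = ennreal (1 + d / c) * ennreal ((L2_norm f)\<^sup>2) + ennreal (1 + c / d) * ennreal ((L2_norm g)\<^sup>2)"
      by (subst nn_integral_add) (auto simp: nn_integral_cmult square_integrableD(2)[OF f] square_integrableD(2)[OF g])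
    also have "\<dots> = ennreal ((1 + d / c) * (L2_norm f)\<^sup>2 + (1 + c / d) * (L2_norm g)\<^sup>2)"
      using c0 d0 by (simp add: ennreal_plus[symmetric] ennreal_mult[symmetric] del: ennreal_plus)
    also have "\<dots> \<le> ennreal ((1 + d / c) * c\<^sup>2 + (1 + c / d) * d\<^sup>2)"
      using c0 d0 cd by (intro ennreal_leI add_mono mult_left_mono power_mono) auto
    also have "(1 + d / c) * c\<^sup>2 + (1 + c / d) * d\<^sup>2 = (c + d)\<^sup>2"
      using c0 d0 by (simp add: field_simps power2_eq_square)
    finally show ?thesis .
  qed
  have lim: "((\<lambda>e. ennreal ((L2_norm f + e + (L2_norm g + e))\<^sup>2)) \<longlongrightarrow> ennreal ((L2_norm f + 0 + (L2_norm g + 0))\<^sup>2)) (at_right (0::real))"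
    by (intro tendsto_intros)
  have "eventually (\<lambda>e. I \<le> ennreal ((L2_norm f + e + (L2_norm g + e))\<^sup>2)) (at_right (0::real))"
    by (rule eventually_at_rightI[of 0 1]) (use *[of "L2_norm f + e" "L2_norm g + e" for e] in auto)
  then have "I \<le> ennreal ((L2_norm f + 0 + (L2_norm g + 0))\<^sup>2)"
    by (intro tendsto_lowerbound[OF lim]) auto
  then have le: "I \<le> ennreal ((L2_norm f + L2_norm g)\<^sup>2)" by simp
  show "(\<lambda>x. f x + g x) \<in> square_integrable" "L2_norm (\<lambda>x. f x + g x) \<le> L2_norm f + L2_norm g"
    using L2_normI[of "\<lambda>x. f x + g x", OF _ _ le[unfolded I_def]] by auto
qed

lemma L2_diff:
  assumes f: "f \<in> square_integrable" and g: "g \<in> square_integrable"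
  shows "(\<lambda>x. f x - g x) \<in> square_integrable" and "L2_norm (\<lambda>x. f x - g x) \<le> L2_norm f + L2_norm g"
  using L2_add[OF f L2_cmult(1)[OF g, of "-1"]] L2_cmult(2)[OF g, of "-1"] by auto

lemma L2_norm_of_real_cmod:
  assumes "f \<in> square_integrable"
  shows "(\<lambda>x. of_real (cmod (f x))) \<in> square_integrable" "L2_norm (\<lambda>x. of_real (cmod (f x))) = L2_norm f"
  using assms by (auto simp: square_integrable_def L2_norm_def)

lemma L2_sum:
  assumes "\<And>i. i \<in> A \<Longrightarrow> f i \<in> square_integrable"
  shows "(\<lambda>x. \<Sum>i\<in>A. f i x) \<in> square_integrable \<and> L2_norm (\<lambda>x. \<Sum>i\<in>A. f i x) \<le> (\<Sum>i\<in>A. L2_norm (f i))"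
  using assms
proof (induction A rule: infinite_finite_induct)
  case (insert a A)
  then show ?case
    using L2_add[of "f a" "\<lambda>x. \<Sum>i\<in>A. f i x"] by (auto intro: order_trans)
qed (auto simp: L2_zero)

lemma Cauchy_Schwarz_L2:
  assumes f: "f \<in> square_integrable" and g: "g \<in> square_integrable"
  shows "integrable lborel (\<lambda>x. f x * g x)"
    and "(LINT x|lborel. cmod (f x * g x)) \<le> L2_norm f * L2_norm g"
proof -
  note [measurable] = square_integrableD(1)[OF f] square_integrableD(1)[OF g]
  let ?I = "\<integral>\<^sup>+x. ennreal (cmod (f x * g x)) \<partial>lborel"
  have "?I\<^sup>2 = (\<integral>\<^sup>+x. ennreal (cmod (f x)) * ennreal (cmod (g x)) \<partial>lborel)\<^sup>2"
    by (simp add: norm_mult ennreal_mult)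
  also have "\<dots> \<le> (\<integral>\<^sup>+x. (ennreal (cmod (f x)))\<^sup>2 \<partial>lborel) * (\<integral>\<^sup>+x. (ennreal (cmod (g x)))\<^sup>2 \<partial>lborel)"
    by (rule Cauchy_Schwarz_nn_integral) auto
  also have "\<dots> = ennreal ((L2_norm f)\<^sup>2) * ennreal ((L2_norm g)\<^sup>2)"
    using square_integrableD(2)[OF f] square_integrableD(2)[OF g] by (simp add: ennreal_power)
  also have "\<dots> = (ennreal (L2_norm f * L2_norm g))\<^sup>2"
    by (simp add: ennreal_power ennreal_mult[symmetric] power_mult_distrib)
  finally have sq: "?I\<^sup>2 \<le> (ennreal (L2_norm f * L2_norm g))\<^sup>2" .
  have le: "?I \<le> ennreal (L2_norm f * L2_norm g)"
  proof (cases ?I rule: ennreal_cases)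
    case (real r)
    then show ?thesis
      using sq by (simp add: ennreal_power power2_le_iff_abs_le)
  next
    case top
    then show ?thesis
      using sq by (simp add: power2_eq_square top_unique ennreal_mult[symmetric] del: ennreal_mult_eq_top_iff)
  qed
  show i: "integrable lborel (\<lambda>x. f x * g x)"
    by (rule integrableI_bounded) (use le in \<open>auto simp: le_less_trans\<close>)
  show "(LINT x|lborel. cmod (f x * g x)) \<le> L2_norm f * L2_norm g"
    using le nn_integral_eq_integral[OF integrable_norm[OF i]] by simp
qed

text \<open>The partial sums of \<open>\<Sum>n. \<bar>f n x\<bar>\<close> stay bounded in the mean square, so by monotone
  convergence the series converges absolutely almost everywhere.\<close>

lemma L2_suminf:
  assumes f: "\<And>n. f n \<in> square_integrable" and sm: "summable (\<lambda>n. L2_norm (f n))"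
  shows "AE x in lborel. summable (\<lambda>n. cmod (f n x))"
    and "(\<lambda>x. \<Sum>n. f n x) \<in> square_integrable"
    and "L2_norm (\<lambda>x. \<Sum>n. f n x) \<le> (\<Sum>n. L2_norm (f n))"
proof -
  note [measurable] = square_integrableD(1)[OF f]
  define c where "c = (\<Sum>n. L2_norm (f n))"
  have c0: "c \<ge> 0"
    unfolding c_def by (intro suminf_nonneg sm) simp
  define G where "G x = (\<Sum>n. ennreal (cmod (f n x)))" for x
  have [measurable]: "G \<in> borel_measurable borel"
    unfolding G_def by measurable
  let ?S = "\<lambda>N x. (\<Sum>n<N. cmod (f n x))"
  have S: "(\<integral>\<^sup>+x. ennreal ((?S N x)\<^sup>2) \<partial>lborel) \<le> ennreal (c\<^sup>2)" for N
  proof -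
    let ?F = "\<lambda>x. \<Sum>n<N. complex_of_real (cmod (f n x))"
    have F: "?F \<in> square_integrable" "L2_norm ?F \<le> (\<Sum>n<N. L2_norm (f n))"
      using L2_sum[of "{..<N}" "\<lambda>n x. of_real (cmod (f n x))"]
      by (auto simp: L2_norm_of_real_cmod f)
    have "(\<Sum>n<N. L2_norm (f n)) \<le> c"
      unfolding c_def by (intro sum_le_suminf sm) auto
    then have "(L2_norm ?F)\<^sup>2 \<le> c\<^sup>2"
      using F(2) by (intro power_mono) auto
    moreover have "cmod (?F x) = ?S N x" for x
      unfolding of_real_sum[symmetric] norm_of_real by (simp add: sum_nonneg)
    ultimately show ?thesis
      using square_integrableD(2)[OF F(1)] by (simp add: ennreal_leI)
  qed
  have G_eq: "G x = (SUP N. ennreal (?S N x))" for x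
    unfolding G_def by (subst suminf_eq_SUP) (auto simp: sum_ennreal)
  have G2: "(G x)\<^sup>2 = (SUP N. ennreal ((?S N x)\<^sup>2))" for x
  proof -
    have "incseq (\<lambda>N. ennreal (?S N x))"
      by (intro monoI ennreal_leI sum_mono2) auto
    then have l: "(\<lambda>N. ennreal (?S N x)) \<longlonglongrightarrow> G x"
      unfolding G_eq by (rule LIMSEQ_SUP)
    have *: "(\<lambda>N. (ennreal (?S N x))\<^sup>2) \<longlonglongrightarrow> (G x)\<^sup>2"
      unfolding power2_eq_square
    proof (cases "G x = 0")
      case True
      then have "ennreal (?S N x) = 0" for N
        using SUP_upper[of N UNIV "\<lambda>N. ennreal (?S N x)"] unfolding G_eq by simp
      then show "(\<lambda>N. ennreal (?S N x) * ennreal (?S N x)) \<longlonglongrightarrow> G x * G x"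
        using True by simp
    next
      case False
      then show "(\<lambda>N. ennreal (?S N x) * ennreal (?S N x)) \<longlonglongrightarrow> G x * G x"
        using l by (intro tendsto_mult_ennreal) auto
    qed
    have "incseq (\<lambda>N. ennreal ((?S N x)\<^sup>2))"
      by (intro monoI ennreal_leI power_mono sum_mono2 sum_nonneg) auto
    then have "(\<lambda>N. ennreal ((?S N x)\<^sup>2)) \<longlonglongrightarrow> (SUP N. ennreal ((?S N x)\<^sup>2))"
      by (rule LIMSEQ_SUP)
    moreover have "(\<lambda>N. ennreal ((?S N x)\<^sup>2)) \<longlonglongrightarrow> (G x)\<^sup>2"
      using * by (simp add: ennreal_power sum_nonneg)
    ultimately show ?thesis
      by (intro LIMSEQ_unique)
  qed
  have IG: "(\<integral>\<^sup>+x. (G x)\<^sup>2 \<partial>lborel) \<le> ennreal (c\<^sup>2)"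
  proof -
    have "(\<integral>\<^sup>+x. (G x)\<^sup>2 \<partial>lborel) = (SUP N. \<integral>\<^sup>+x. ennreal ((?S N x)\<^sup>2) \<partial>lborel)"
      unfolding G2
      by (intro nn_integral_monotone_convergence_SUP monoI le_funI ennreal_leI power_mono sum_mono2 sum_nonneg) auto
    also have "\<dots> \<le> ennreal (c\<^sup>2)"
      by (intro SUP_least S)
    finally show ?thesis .
  qed
  have "AE x in lborel. (G x)\<^sup>2 \<noteq> \<infinity>"
    using IG by (intro nn_integral_PInf_AE) (auto simp: top_unique)
  then have fin: "AE x in lborel. G x < \<infinity>"
    by eventually_elim (auto simp: power2_eq_square less_top ennreal_mult_less_top)
  show sAE: "AE x in lborel. summable (\<lambda>n. cmod (f n x))"
    using fin
  proof eventually_elim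
    case (elim x)
    then show ?case
      unfolding G_def by (intro summable_suminf_not_top) auto
  qed
  have [measurable]: "(\<lambda>x. \<Sum>n. f n x) \<in> borel_measurable borel"
    by measurable
  have le: "AE x in lborel. ennreal ((cmod (\<Sum>n. f n x))\<^sup>2) \<le> (G x)\<^sup>2"
    using sAE
  proof eventually_elim
    case (elim x)
    have "ennreal (cmod (\<Sum>n. f n x)) \<le> ennreal (\<Sum>n. cmod (f n x))"
      by (intro ennreal_leI summable_norm elim)
    also have "\<dots> = G x"
      unfolding G_def using elim by (intro suminf_ennreal2[symmetric]) auto
    finally have "(ennreal (cmod (\<Sum>n. f n x)))\<^sup>2 \<le> (G x)\<^sup>2"
      by (intro power_mono) auto
    then show ?case by (simp add: ennreal_power)
  qed
  have "(\<integral>\<^sup>+x. ennreal ((cmod (\<Sum>n. f n x))\<^sup>2) \<partial>lborel) \<le> (\<integral>\<^sup>+x. (G x)\<^sup>2 \<partial>lborel)"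
    using le by (rule nn_integral_mono_AE)
  also note IG
  finally have "(\<integral>\<^sup>+x. ennreal ((cmod (\<Sum>n. f n x))\<^sup>2) \<partial>lborel) \<le> ennreal (c\<^sup>2)" .
  from L2_normI[OF _ c0 this]
  show "(\<lambda>x. \<Sum>n. f n x) \<in> square_integrable" "L2_norm (\<lambda>x. \<Sum>n. f n x) \<le> (\<Sum>n. L2_norm (f n))"
    by (auto simp: c_def)
qed

text \<open>Riesz--Fischer: along a subsequence with distances \<open>(1/2) ^ k\<close> the increments form an absolutely
  convergent series, and its sum is the limit.\<close>

lemma L2_complete:
  assumes f: "\<And>n::nat. f n \<in> square_integrable"
    and cauchy: "\<And>e. e > 0 \<Longrightarrow> \<exists>M. \<forall>m\<ge>M. \<forall>n\<ge>M. L2_norm (\<lambda>x. f m x - f n x) < e"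
  obtains g where "g \<in> square_integrable" "(\<lambda>n. L2_norm (\<lambda>x. f n x - g x)) \<longlonglongrightarrow> 0"
proof -
  have "\<forall>k. \<exists>M. \<forall>m\<ge>M. \<forall>n\<ge>M. L2_norm (\<lambda>x. f m x - f n x) < (1/2) ^ k"
    by (intro allI cauchy) simp
  from choice[OF this] obtain M
    where M: "\<And>k m n. m \<ge> M k \<Longrightarrow> n \<ge> M k \<Longrightarrow> L2_norm (\<lambda>x. f m x - f n x) < (1/2) ^ k"
    by blast
  define r where "r k = (\<Sum>i\<le>k. M i)" for k
  have rM: "r k \<ge> M k" for k
    unfolding r_def by (rule member_le_sum) auto
  have r_mono: "r k \<le> r l" if "k \<le> l" for k l
    unfolding r_def using that by (intro sum_mono2) auto
  \<comment> \<open>the increments along the subsequence\<close>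
  define d where "d k = (\<lambda>x. f (r (Suc k)) x - f (r k) x)" for k
  have d: "d k \<in> square_integrable" for k
    unfolding d_def by (intro L2_diff f)
  have dn: "L2_norm (d k) \<le> (1/2) ^ k" for k
    unfolding d_def using M[of k "r (Suc k)" "r k"] rM[of k] r_mono[of k "Suc k"] by simp
  have sd: "summable (\<lambda>k. L2_norm (d k))"
    by (rule summable_comparison_test'[of "\<lambda>k. (1/2) ^ k" 0]) (use dn in auto)
  note sum_d = L2_suminf[OF d sd]
  define g where "g x = f (r 0) x + (\<Sum>k. d k x)" for x
  have g: "g \<in> square_integrable"
    unfolding g_def by (intro L2_add f sum_d)
  \<comment> \<open>the tail of the telescoping series is the distance to the limit\<close>
  have tail: "L2_norm (\<lambda>x. f (r k) x - g x) \<le> 2 * (1/2) ^ k" for k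
  proof -
    have sdk: "summable (\<lambda>i. L2_norm (d (i + k)))"
      using sd by (rule summable_ignore_initial_segment)
    note tl = L2_suminf[of "\<lambda>i. d (i + k)", OF d sdk]
    have "AE x in lborel. f (r k) x - g x = - 1 * (\<Sum>i. d (i + k) x)"
      using sum_d(1)
    proof eventually_elim
      case (elim x)
      then have s: "summable (\<lambda>k. d k x)"
        by (rule summable_norm_cancel)
      have "(\<Sum>i<k. d i x) = f (r k) x - f (r 0) x"
        unfolding d_def by (rule sum_lessThan_telescope)
      then show ?case
        using suminf_split_initial_segment[OF s, of k] by (simp add: g_def)
    qed
    moreover have "(\<lambda>x. f (r k) x - g x) \<in> borel_measurable borel"
      using square_integrableD(1)[OF L2_diff(1)[OF f g]] .
    ultimately have "L2_norm (\<lambda>x. f (r k) x - g x) = L2_norm (\<lambda>x. - 1 * (\<Sum>i. d (i + k) x))"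
      using L2_norm_cong_AE(2)[OF L2_cmult(1)[OF tl(2), of "-1"]] by blast
    also have "\<dots> \<le> (\<Sum>i. L2_norm (d (i + k)))"
      using tl(3) L2_cmult(2)[OF tl(2), of "-1"] by simp
    also have "\<dots> \<le> (\<Sum>i. (1/2) ^ k * (1/2) ^ i)"
      by (intro suminf_le sdk summable_mult summable_geometric)
        (use dn[of "i + k" for i] in \<open>simp_all add: power_add mult.commute\<close>)
    also have "\<dots> = 2 * (1/2) ^ k"
      by (subst suminf_mult) (auto simp: suminf_geometric)
    finally show ?thesis .
  qed
  have lim: "(\<lambda>n. L2_norm (\<lambda>x. f n x - g x)) \<longlonglongrightarrow> 0"
  proof (rule LIMSEQ_I)
    fix e :: real assume e: "e > 0"
    obtain k where k: "(1/2::real) ^ k < e / 3"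
      using real_arch_pow_inv[of "e / 3" "1/2"] e by auto
    have "L2_norm (\<lambda>x. f n x - g x) < e" if n: "n \<ge> r k" for n
    proof -
      have "L2_norm (\<lambda>x. (f n x - f (r k) x) + (f (r k) x - g x))
          \<le> L2_norm (\<lambda>x. f n x - f (r k) x) + L2_norm (\<lambda>x. f (r k) x - g x)"
        by (intro L2_add L2_diff f g)
      also have "\<dots> < (1/2) ^ k + 2 * (1/2) ^ k"
        using M[of k n "r k"] tail[of k] n rM[of k] by simp
      also have "\<dots> < e" using k by simp
      finally show ?thesis by simp
    qed
    then show "\<exists>no. \<forall>n\<ge>no. norm (L2_norm (\<lambda>x. f n x - g x) - 0) < e"
      by auto
  qed
  from g lim show ?thesis by (rule that)
qed

section \<open>Fourier integrals, Bessel's inequality and Levy inversion\<close>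

definition FT :: "(real \<Rightarrow> complex) \<Rightarrow> real \<Rightarrow> complex" where
  "FT f \<xi> = (LINT x|lborel. cis (- (x * \<xi>)) * f x)"

definition IFT :: "(real \<Rightarrow> complex) \<Rightarrow> real \<Rightarrow> complex" where
  "IFT g x = (LINT \<xi>|lborel. cis (x * \<xi>) * g \<xi>) / of_real (2 * pi)"

lemma borel_measurable_cis [measurable]: "cis \<in> borel_measurable borel"
  by (intro borel_measurable_continuous_onI continuous_intros)

lemma borel_measurable_cnj [measurable]:
  "f \<in> borel_measurable M \<Longrightarrow> (\<lambda>x. cnj (f x)) \<in> borel_measurable M"
  by (rule measurable_compose[where N = borel])
    (auto intro!: borel_measurable_continuous_onI continuous_intros)

lemma cis_eq_iexp: "cis x = iexp x"
  by (simp add: cis_conv_exp)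

lemma borel_measurable_FT [measurable]:
  assumes [measurable]: "f \<in> borel_measurable borel"
  shows "FT f \<in> borel_measurable borel"
  unfolding FT_def by measurable

lemma borel_measurable_IFT [measurable]:
  assumes [measurable]: "f \<in> borel_measurable borel"
  shows "IFT f \<in> borel_measurable borel"
  unfolding IFT_def by measurable

lemma integrable_bounded_mult:
  fixes K f :: "real \<Rightarrow> complex"
  assumes f: "integrable lborel f" and [measurable]: "K \<in> borel_measurable borel"
    and B: "\<And>x. cmod (K x) \<le> B"
  shows "integrable lborel (\<lambda>x. K x * f x)"
proof (rule Bochner_Integration.integrable_bound)
  show "integrable lborel (\<lambda>x. of_real B * f x)"
    using f by simp
  show "AE x in lborel. cmod (K x * f x) \<le> cmod (of_real B * f x)"
    using B by (auto simp: norm_mult intro!: mult_right_mono order_trans[OF B])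
qed (use f in measurable)

lemma integrable_cis_mult:
  assumes "integrable lborel f"
  shows "integrable lborel (\<lambda>x. cis (x * \<xi>) * f x)" "integrable lborel (\<lambda>x. cis (\<xi> * x) * f x)"
    "integrable lborel (\<lambda>x. cis (- (x * \<xi>)) * f x)"
  by (intro integrable_bounded_mult[where B=1] assms; simp)+

lemma cmod_FT_le:
  assumes "integrable lborel f"
  shows "cmod (FT f \<xi>) \<le> (LINT x|lborel. cmod (f x))"
  unfolding FT_def
  by (rule order_trans[OF integral_norm_bound]) (simp add: norm_mult)

text \<open>The kernels to which this applies are characters of the line, bounded but not integrable.\<close>

lemma Fubini_kernel:
  fixes f g :: "real \<Rightarrow> complex"
  assumes f: "integrable lborel f" and g: "integrable lborel g"
    and [measurable]: "case_prod K \<in> borel_measurable (borel \<Otimes>\<^sub>M borel)"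
    and B: "\<And>x y. cmod (K x y) \<le> B"
  shows "(LINT x|lborel. LINT y|lborel. K x y * (f x * g y)) =
         (LINT y|lborel. LINT x|lborel. K x y * (f x * g y))"
proof -
  have [measurable]: "f \<in> borel_measurable borel" "g \<in> borel_measurable borel"
    using f g by auto
  have B0: "B \<ge> 0" using B[of 0 0] norm_ge_zero order_trans by blast
  have "integrable (lborel \<Otimes>\<^sub>M lborel) (\<lambda>(x, y). K x y * (f x * g y))"
  proof (rule integrableI_bounded)
    have "(\<integral>\<^sup>+p. ennreal (norm (case p of (x, y) \<Rightarrow> K x y * (f x * g y))) \<partial>(lborel \<Otimes>\<^sub>M lborel)) =
        (\<integral>\<^sup>+x. \<integral>\<^sup>+y. ennreal (cmod (K x y * (f x * g y))) \<partial>lborel \<partial>lborel)"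
      by (subst lborel.nn_integral_fst[symmetric]) auto
    also have "\<dots> \<le> (\<integral>\<^sup>+x. \<integral>\<^sup>+y. ennreal B * (ennreal (cmod (f x)) * ennreal (cmod (g y))) \<partial>lborel \<partial>lborel)"
      using B B0 by (intro nn_integral_mono)
        (simp add: norm_mult ennreal_mult[symmetric] mult_right_mono ennreal_leI)
    also have "\<dots> = ennreal B * ((\<integral>\<^sup>+x. ennreal (cmod (f x)) \<partial>lborel) * (\<integral>\<^sup>+y. ennreal (cmod (g y)) \<partial>lborel))"
      by (simp add: nn_integral_cmult nn_integral_multc)
    also have "\<dots> < \<infinity>"
      using f g by (auto simp: integrable_iff_bounded ennreal_mult_less_top)
    finally show "(\<integral>\<^sup>+p. ennreal (norm (case p of (x, y) \<Rightarrow> K x y * (f x * g y))) \<partial>(lborel \<Otimes>\<^sub>M lborel)) < \<infinity>" .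
  qed simp
  then show ?thesis
    by (intro lborel_pair.Fubini_integral[symmetric])
qed

text \<open>The characteristic function of the normal distribution, rescaled: the transform of a wide Gaussian
  is \<open>2 \<pi>\<close> times a narrow normal density.\<close>

lemma FT_gaussian:
  assumes \<sigma>: "\<sigma> > 0"
  shows "(LINT \<xi>|lborel. cis (\<xi> * z) * of_real (exp (- (\<xi> / \<sigma>)\<^sup>2 / 2))) =
      of_real (2 * pi * normal_density 0 (1 / \<sigma>) z)"
    and "integrable lborel (\<lambda>\<xi>. complex_of_real (exp (- (\<xi> / \<sigma>)\<^sup>2 / 2)))"
proof -
  have g: "exp (- (\<xi> / \<sigma>)\<^sup>2 / 2) = sqrt (2 * pi) * std_normal_density (\<xi> / \<sigma>)" for \<xi>
    by (simp add: std_normal_density_def)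
  have "complex_of_real (exp (- (t^2) / 2)) = (LINT x|lborel. std_normal_density x *\<^sub>R iexp (t * x))" for t
  proof -
    have "complex_of_real (exp (- (t^2) / 2)) = char std_normal_distribution t"
      by (simp add: char_std_normal_distribution)
    also have "\<dots> = (LINT x|lborel. std_normal_density x *\<^sub>R iexp (t * x))"
      unfolding char_def by (subst integral_density) auto
    finally show ?thesis .
  qed
  note char = this
  have "(LINT \<xi>|lborel. cis (\<xi> * z) * of_real (exp (- (\<xi> / \<sigma>)\<^sup>2 / 2))) =
      of_real (sqrt (2 * pi)) * (LINT \<xi>|lborel. std_normal_density (\<xi> / \<sigma>) *\<^sub>R iexp ((\<sigma> * z) * (\<xi> / \<sigma>)))"
    unfolding g cis_eq_iexp using \<sigma>
    by (subst integral_mult_right_zero[symmetric])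
      (intro Bochner_Integration.integral_cong, auto simp: scaleR_conv_of_real mult_ac)
  also have "(LINT \<xi>|lborel. std_normal_density (\<xi> / \<sigma>) *\<^sub>R iexp ((\<sigma> * z) * (\<xi> / \<sigma>))) =
      of_real \<sigma> * of_real (exp (- ((\<sigma> * z)\<^sup>2) / 2))"
    unfolding char
    by (subst (2) lborel_integral_real_affine[of "1 / \<sigma>" _ 0]) (use \<sigma> in \<open>auto simp: scaleR_conv_of_real\<close>)
  also have "of_real (sqrt (2 * pi)) * (of_real \<sigma> * of_real (exp (- ((\<sigma> * z)\<^sup>2) / 2))) =
      complex_of_real (2 * pi * normal_density 0 (1 / \<sigma>) z)"
  proof -
    have "sqrt (2 * pi) * \<sigma> * exp (- ((\<sigma> * z)\<^sup>2) / 2) = 2 * pi * normal_density 0 (1 / \<sigma>) z"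
    proof -
      have e: "sqrt (2 * pi * (1 / \<sigma>)\<^sup>2) = sqrt (2 * pi) / \<sigma>"
        using \<sigma> by (simp add: real_sqrt_mult real_sqrt_divide power_divide)
      have "(z - 0)\<^sup>2 / (2 * (1 / \<sigma>)\<^sup>2) = (\<sigma> * z)\<^sup>2 / 2"
        using \<sigma> by (simp add: field_simps power_mult_distrib)
      then have n: "normal_density 0 (1 / \<sigma>) z = \<sigma> / sqrt (2 * pi) * exp (- (\<sigma> * z)\<^sup>2 / 2)"
        unfolding normal_density_def e by simp
      have "sqrt (2 * pi) * sqrt (2 * pi) = 2 * pi"
        by simp
      then show ?thesis
        unfolding n by (simp add: field_simps del: real_sqrt_mult_self)
    qed
    then show ?thesis
      by (metis (no_types, lifting) mult.assoc of_real_mult)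
  qed
  finally show "(LINT \<xi>|lborel. cis (\<xi> * z) * of_real (exp (- (\<xi> / \<sigma>)\<^sup>2 / 2))) =
      of_real (2 * pi * normal_density 0 (1 / \<sigma>) z)" .
  have "integrable lborel (\<lambda>\<xi>. std_normal_density (0 + (1 / \<sigma>) * \<xi>))"
    using \<sigma> by (intro lborel_integrable_real_affine) auto
  then have "integrable lborel (\<lambda>\<xi>. exp (- (\<xi> / \<sigma>)\<^sup>2 / 2))"
    unfolding g by simp
  then show "integrable lborel (\<lambda>\<xi>. complex_of_real (exp (- (\<xi> / \<sigma>)\<^sup>2 / 2)))"
    by (rule integrable_of_real)
qed

lemma norm_integral_le_nn_integral:
  fixes f :: "_ \<Rightarrow> _::{banach, second_countable_topology}"
  shows "ennreal (norm (integral\<^sup>L M f)) \<le> (\<integral>\<^sup>+x. ennreal (norm (f x)) \<partial>M)"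
  by (cases "integrable M f") (auto simp: integral_norm_bound_ennreal not_integrable_integral_eq)

text \<open>Half of Plancherel's theorem.  Against a Gaussian weight the mean square of the transform is
  \<open>2 \<pi>\<close> times the integral of \<open>f (x) * cnj (f y)\<close> against a probability density in \<open>y - x\<close>,
  which the inequality \<open>a b \<le> (a\<^sup>2 + b\<^sup>2) / 2\<close> bounds by the mean square of \<open>f\<close>.\<close>

lemma Bessel_FT:
  assumes f: "integrable lborel f" and f2: "f \<in> square_integrable"
  shows "FT f \<in> square_integrable" and "L2_norm (FT f) \<le> sqrt (2 * pi) * L2_norm f"
proof -
  have [measurable]: "f \<in> borel_measurable borel"
    using f by auto
  define \<gamma> where "\<gamma> \<sigma> \<xi> = exp (- (\<xi> / \<sigma>)\<^sup>2 / 2)" for \<sigma> \<xi> :: real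
  have [measurable]: "\<gamma> \<sigma> \<in> borel_measurable borel" for \<sigma>
    unfolding \<gamma>_def by measurable
  let ?B = "LINT x|lborel. cmod (f x)"
  have weighted: "(\<integral>\<^sup>+\<xi>. ennreal (\<gamma> \<sigma> \<xi> * (cmod (FT f \<xi>))\<^sup>2) \<partial>lborel) \<le> ennreal (2 * pi * (L2_norm f)\<^sup>2)"
    if \<sigma>: "\<sigma> > 0" for \<sigma>
  proof -
    let ?k = "normal_density 0 (1 / \<sigma>)"
    let ?g = "\<lambda>\<xi>. complex_of_real (\<gamma> \<sigma> \<xi>)"
    have ig: "integrable lborel ?g"
      unfolding \<gamma>_def by (rule FT_gaussian(2)[OF \<sigma>])
    have igF: "integrable lborel (\<lambda>\<xi>. FT f \<xi> * ?g \<xi>)"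
      by (rule integrable_bounded_mult[OF ig _ cmod_FT_le[OF f]]) simp
    have igF2: "integrable lborel (\<lambda>\<xi>. cnj (FT f \<xi>) * (FT f \<xi> * ?g \<xi>))"
      by (rule integrable_bounded_mult[OF igF, where B="?B"]) (simp_all add: cmod_FT_le[OF f])
    have icf: "integrable lborel (\<lambda>y. cnj (f y))"
      using f by simp
    have cnjFT: "cnj (FT f \<xi>) = (LINT y|lborel. cis (y * \<xi>) * cnj (f y))" for \<xi>
      unfolding FT_def by (subst Bochner_Integration.integral_cnj[symmetric]) (simp add: cis_cnj)
    have re: "\<gamma> \<sigma> \<xi> * (cmod (FT f \<xi>))\<^sup>2 = Re (cnj (FT f \<xi>) * (FT f \<xi> * ?g \<xi>))" for \<xi>
    proof -
      have "cnj (FT f \<xi>) * (FT f \<xi> * ?g \<xi>) = of_real ((cmod (FT f \<xi>))\<^sup>2 * \<gamma> \<sigma> \<xi>)"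
        unfolding of_real_mult complex_norm_square by (simp add: mult_ac)
      then show ?thesis by (simp only: Re_complex_of_real mult.commute)
    qed
    have h: "(LINT \<xi>|lborel. cis (y * \<xi>) * (FT f \<xi> * ?g \<xi>)) = (LINT x|lborel. f x * of_real (2 * pi * ?k (y - x)))" for y
    proof -
      have "(LINT \<xi>|lborel. cis (y * \<xi>) * (FT f \<xi> * ?g \<xi>)) =
          (LINT \<xi>|lborel. LINT x|lborel. cis (y * \<xi> - x * \<xi>) * (?g \<xi> * f x))"
      proof (intro Bochner_Integration.integral_cong refl)
        fix \<xi>
        have c: "cis (y * \<xi>) * ?g \<xi> * (cis (- (x * \<xi>)) * f x) = cis (y * \<xi> - x * \<xi>) * (?g \<xi> * f x)" for x
          using cis_mult[of "y * \<xi>" "- (x * \<xi>)"] by simp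
        have "cis (y * \<xi>) * (FT f \<xi> * ?g \<xi>) = (cis (y * \<xi>) * ?g \<xi>) * (LINT x|lborel. cis (- (x * \<xi>)) * f x)"
          unfolding FT_def by simp
        also have "\<dots> = (LINT x|lborel. cis (y * \<xi>) * ?g \<xi> * (cis (- (x * \<xi>)) * f x))"
          by (rule integral_mult_right_zero[symmetric])
        finally show "cis (y * \<xi>) * (FT f \<xi> * ?g \<xi>) = (LINT x|lborel. cis (y * \<xi> - x * \<xi>) * (?g \<xi> * f x))"
          unfolding c .
      qed
      also have "\<dots> = (LINT x|lborel. LINT \<xi>|lborel. cis (y * \<xi> - x * \<xi>) * (?g \<xi> * f x))"
        by (rule Fubini_kernel[OF ig f, where B=1]) auto
      also have "\<dots> = (LINT x|lborel. f x * (LINT \<xi>|lborel. cis (\<xi> * (y - x)) * ?g \<xi>))"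
      proof (intro Bochner_Integration.integral_cong refl)
        fix x
        have "(LINT \<xi>|lborel. cis (y * \<xi> - x * \<xi>) * (?g \<xi> * f x)) = (LINT \<xi>|lborel. f x * (cis (\<xi> * (y - x)) * ?g \<xi>))"
          by (intro Bochner_Integration.integral_cong refl) (simp add: algebra_simps)
        then show "(LINT \<xi>|lborel. cis (y * \<xi> - x * \<xi>) * (?g \<xi> * f x)) = f x * (LINT \<xi>|lborel. cis (\<xi> * (y - x)) * ?g \<xi>)"
          by simp
      qed
      finally show ?thesis
        unfolding \<gamma>_def FT_gaussian(1)[OF \<sigma>] .
    qed
    have Ik: "(\<integral>\<^sup>+z. ennreal (?k z) \<partial>lborel) = 1"
      using \<sigma> by (subst nn_integral_eq_integral) auto
    have Ik1: "(\<integral>\<^sup>+x. ennreal (?k (y - x)) \<partial>lborel) = 1" for y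
      using nn_integral_real_affine[of "\<lambda>z. ennreal (?k z)" "-1" y] Ik by simp
    have Ik2: "(\<integral>\<^sup>+y. ennreal (?k (y - x)) \<partial>lborel) = 1" for x
      using nn_integral_real_affine[of "\<lambda>z. ennreal (?k z)" "1" "-x"] Ik by simp
    have "ennreal (LINT \<xi>|lborel. \<gamma> \<sigma> \<xi> * (cmod (FT f \<xi>))\<^sup>2) \<le>
        ennreal (cmod (LINT \<xi>|lborel. cnj (FT f \<xi>) * (FT f \<xi> * ?g \<xi>)))"
      unfolding re integral_Re[OF igF2] by (intro ennreal_leI complex_Re_le_cmod)
    also have "(LINT \<xi>|lborel. cnj (FT f \<xi>) * (FT f \<xi> * ?g \<xi>)) =
        (LINT \<xi>|lborel. LINT y|lborel. cis (y * \<xi>) * ((FT f \<xi> * ?g \<xi>) * cnj (f y)))"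
    proof (intro Bochner_Integration.integral_cong refl)
      fix \<xi>
      have "cnj (FT f \<xi>) * (FT f \<xi> * ?g \<xi>) = (FT f \<xi> * ?g \<xi>) * (LINT y|lborel. cis (y * \<xi>) * cnj (f y))"
        unfolding cnjFT[of \<xi>] by (simp only: mult.commute)
      also have "\<dots> = (LINT y|lborel. (FT f \<xi> * ?g \<xi>) * (cis (y * \<xi>) * cnj (f y)))"
        by (rule integral_mult_right_zero[symmetric])
      finally show "cnj (FT f \<xi>) * (FT f \<xi> * ?g \<xi>) = (LINT y|lborel. cis (y * \<xi>) * ((FT f \<xi> * ?g \<xi>) * cnj (f y)))"
        by (simp only: mult.left_commute)
    qed
    also have "\<dots> = (LINT y|lborel. LINT \<xi>|lborel. cis (y * \<xi>) * ((FT f \<xi> * ?g \<xi>) * cnj (f y)))"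
      by (rule Fubini_kernel[OF igF icf, where B=1]) auto
    also have "\<dots> = (LINT y|lborel. cnj (f y) * (LINT x|lborel. f x * of_real (2 * pi * ?k (y - x))))"
    proof (intro Bochner_Integration.integral_cong refl)
      fix y
      have "(LINT \<xi>|lborel. cis (y * \<xi>) * ((FT f \<xi> * ?g \<xi>) * cnj (f y))) = (LINT \<xi>|lborel. cnj (f y) * (cis (y * \<xi>) * (FT f \<xi> * ?g \<xi>)))"
        by (intro Bochner_Integration.integral_cong refl) (simp only: mult_ac)
      also have "\<dots> = cnj (f y) * (LINT \<xi>|lborel. cis (y * \<xi>) * (FT f \<xi> * ?g \<xi>))"
        by (rule integral_mult_right_zero)
      finally show "(LINT \<xi>|lborel. cis (y * \<xi>) * ((FT f \<xi> * ?g \<xi>) * cnj (f y))) = cnj (f y) * (LINT x|lborel. f x * of_real (2 * pi * ?k (y - x)))"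
        unfolding h .
    qed
    also have "ennreal (cmod \<dots>) \<le> (\<integral>\<^sup>+y. ennreal (cmod (cnj (f y) * (LINT x|lborel. f x * of_real (2 * pi * ?k (y - x))))) \<partial>lborel)"
      by (rule norm_integral_le_nn_integral)
    also have "\<dots> \<le> (\<integral>\<^sup>+y. ennreal (cmod (f y)) * (\<integral>\<^sup>+x. ennreal (cmod (f x * of_real (2 * pi * ?k (y - x)))) \<partial>lborel) \<partial>lborel)"
    proof (intro nn_integral_mono)
      fix y
      show "ennreal (cmod (cnj (f y) * (LINT x|lborel. f x * of_real (2 * pi * ?k (y - x)))))
        \<le> ennreal (cmod (f y)) * (\<integral>\<^sup>+x. ennreal (cmod (f x * of_real (2 * pi * ?k (y - x)))) \<partial>lborel)"
        unfolding norm_mult[of "cnj (f y)"] complex_mod_cnj ennreal_mult[OF norm_ge_zero norm_ge_zero]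
        by (rule mult_left_mono[OF norm_integral_le_nn_integral]) simp
    qed
    also have "\<dots> = (\<integral>\<^sup>+y. \<integral>\<^sup>+x. ennreal (2 * pi * (cmod (f y) * cmod (f x)) * ?k (y - x)) \<partial>lborel \<partial>lborel)"
      by (subst nn_integral_cmult[symmetric])
        (auto simp: norm_mult ennreal_mult[symmetric] mult_ac abs_mult)
    also have "\<dots> \<le> (\<integral>\<^sup>+y. \<integral>\<^sup>+x. ennreal (pi * (cmod (f y))\<^sup>2) * ennreal (?k (y - x)) + ennreal (pi * (cmod (f x))\<^sup>2) * ennreal (?k (y - x)) \<partial>lborel \<partial>lborel)"
    proof (intro nn_integral_mono)
      fix y x
      have "2 * (cmod (f y) * cmod (f x)) \<le> (cmod (f y))\<^sup>2 + (cmod (f x))\<^sup>2"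
        using sum_squares_bound[of "cmod (f y)" "cmod (f x)"] by simp
      then have "pi * (2 * (cmod (f y) * cmod (f x))) * ?k (y - x) \<le> pi * ((cmod (f y))\<^sup>2 + (cmod (f x))\<^sup>2) * ?k (y - x)"
        by (intro mult_right_mono mult_left_mono) auto
      then show "ennreal (2 * pi * (cmod (f y) * cmod (f x)) * ?k (y - x)) \<le>
        ennreal (pi * (cmod (f y))\<^sup>2) * ennreal (?k (y - x)) + ennreal (pi * (cmod (f x))\<^sup>2) * ennreal (?k (y - x))"
        by (simp add: ennreal_mult[symmetric] ennreal_plus[symmetric] distrib_left distrib_right mult_ac
            del: ennreal_plus)
    qed
    also have "\<dots> = (\<integral>\<^sup>+y. ennreal (pi * (cmod (f y))\<^sup>2) \<partial>lborel) + (\<integral>\<^sup>+y. \<integral>\<^sup>+x. ennreal (pi * (cmod (f x))\<^sup>2) * ennreal (?k (y - x)) \<partial>lborel \<partial>lborel)"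
      by (subst nn_integral_add, measurable) (subst nn_integral_add, measurable, simp add: nn_integral_cmult Ik1)
    also have "(\<integral>\<^sup>+y. \<integral>\<^sup>+x. ennreal (pi * (cmod (f x))\<^sup>2) * ennreal (?k (y - x)) \<partial>lborel \<partial>lborel) =
      (\<integral>\<^sup>+x. \<integral>\<^sup>+y. ennreal (pi * (cmod (f x))\<^sup>2) * ennreal (?k (y - x)) \<partial>lborel \<partial>lborel)"
      by (rule lborel_pair.Fubini') measurable
    also have "\<dots> = (\<integral>\<^sup>+x. ennreal (pi * (cmod (f x))\<^sup>2) \<partial>lborel)"
      by (simp add: nn_integral_cmult Ik2)
    also have "(\<integral>\<^sup>+x. ennreal (pi * (cmod (f x))\<^sup>2) \<partial>lborel) = ennreal (pi * (L2_norm f)\<^sup>2)"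
      by (simp add: ennreal_mult nn_integral_cmult square_integrableD(2)[OF f2])
    finally have "ennreal (LINT \<xi>|lborel. \<gamma> \<sigma> \<xi> * (cmod (FT f \<xi>))\<^sup>2) \<le> ennreal (2 * pi * (L2_norm f)\<^sup>2)"
      by (simp add: ennreal_plus[symmetric] del: ennreal_plus)
    moreover have "integrable lborel (\<lambda>\<xi>. \<gamma> \<sigma> \<xi> * (cmod (FT f \<xi>))\<^sup>2)"
      unfolding re by (rule integrable_Re[OF igF2])
    ultimately show ?thesis
      by (subst nn_integral_eq_integral) (auto simp: \<gamma>_def)
  qed
  have "(\<integral>\<^sup>+\<xi>. ennreal ((cmod (FT f \<xi>))\<^sup>2) \<partial>lborel) =
      (\<integral>\<^sup>+\<xi>. liminf (\<lambda>n. ennreal (\<gamma> (real (Suc n)) \<xi> * (cmod (FT f \<xi>))\<^sup>2)) \<partial>lborel)"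
  proof (intro nn_integral_cong)
    fix \<xi>
    have inv: "(\<lambda>n. inverse (real (Suc n)) * \<xi>) \<longlonglongrightarrow> 0 * \<xi>"
      by (intro tendsto_mult_right LIMSEQ_inverse_real_of_nat)
    have "(\<lambda>n. exp (- (inverse (real (Suc n)) * \<xi>)\<^sup>2 / 2) * (cmod (FT f \<xi>))\<^sup>2) \<longlonglongrightarrow> exp (- (0 * \<xi>)\<^sup>2 / 2) * (cmod (FT f \<xi>))\<^sup>2"
      by (intro tendsto_mult tendsto_exp tendsto_divide tendsto_minus tendsto_power inv tendsto_const) auto
    then have "(\<lambda>n. \<gamma> (real (Suc n)) \<xi> * (cmod (FT f \<xi>))\<^sup>2) \<longlonglongrightarrow> (cmod (FT f \<xi>))\<^sup>2"
      unfolding \<gamma>_def divide_inverse[of \<xi>] mult.commute[of \<xi>] by simp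
    then have "(\<lambda>n. ennreal (\<gamma> (real (Suc n)) \<xi> * (cmod (FT f \<xi>))\<^sup>2)) \<longlonglongrightarrow> ennreal ((cmod (FT f \<xi>))\<^sup>2)"
      by (rule tendsto_ennrealI)
    then show "ennreal ((cmod (FT f \<xi>))\<^sup>2) = liminf (\<lambda>n. ennreal (\<gamma> (real (Suc n)) \<xi> * (cmod (FT f \<xi>))\<^sup>2))"
      by (rule lim_imp_Liminf[symmetric, rotated]) simp
  qed
  also have "\<dots> \<le> liminf (\<lambda>n. \<integral>\<^sup>+\<xi>. ennreal (\<gamma> (real (Suc n)) \<xi> * (cmod (FT f \<xi>))\<^sup>2) \<partial>lborel)"
    by (rule nn_integral_liminf) measurable
  also have "\<dots> \<le> liminf (\<lambda>n. ennreal (2 * pi * (L2_norm f)\<^sup>2))"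
    by (intro Liminf_mono always_eventually allI weighted) simp
  also have "\<dots> = ennreal ((sqrt (2 * pi) * L2_norm f)\<^sup>2)"
    by (simp add: Liminf_const power_mult_distrib)
  finally have le: "(\<integral>\<^sup>+\<xi>. ennreal ((cmod (FT f \<xi>))\<^sup>2) \<partial>lborel) \<le> ennreal ((sqrt (2 * pi) * L2_norm f)\<^sup>2)" .
  show "FT f \<in> square_integrable" and "L2_norm (FT f) \<le> sqrt (2 * pi) * L2_norm f"
    using L2_normI[OF _ _ le] by auto
qed

text \<open>For \<open>t \<noteq> 0\<close> the integral of \<open>cis (- (t * x))\<close> over \<open>x\<close> from \<open>a\<close> to \<open>b\<close>; the value \<open>0\<close> at the origin
  differs from it on a null set only.\<close>

definition inversion_kernel :: "real \<Rightarrow> real \<Rightarrow> real \<Rightarrow> complex" where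
  "inversion_kernel a b t = (cis (- (t * a)) - cis (- (t * b))) / (\<i> * of_real t)"

lemma borel_measurable_inversion_kernel [measurable]: "inversion_kernel a b \<in> borel_measurable borel"
  unfolding inversion_kernel_def by measurable

lemma cmod_inversion_kernel_le:
  assumes "a \<le> b"
  shows "cmod (inversion_kernel a b t) \<le> b - a"
proof (cases "t = 0")
  case False
  have "cmod (inversion_kernel a b t) = cmod ((iexp (t * (-a)) - iexp (t * (-b))) / (\<i> * of_real t))"
    by (simp add: inversion_kernel_def cis_eq_iexp)
  also have "\<dots> \<le> - a - - b"
    using False assms by (intro Levy_Inversion_aux2) auto
  finally show ?thesis by simp
qed (use assms in \<open>simp add: inversion_kernel_def\<close>)

text \<open>A nonnegative integrable function is a multiple of a probability density, so that Levy's theorem on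
  characteristic functions applies.\<close>

lemma Levy_inversion_nonneg:
  fixes p :: "real \<Rightarrow> real"
  assumes p: "integrable lborel p" and p0: "\<And>x. p x \<ge> 0" and ab: "a \<le> b"
  shows "(\<lambda>n::nat. LINT t:{-real n<..<real n}|lborel. inversion_kernel a b t * (LINT x|lborel. cis (x * t) * of_real (p x)))
     \<longlonglongrightarrow> of_real (2 * pi) * (LINT x:{a<..b}|lborel. of_real (p x))"
proof (cases "(LINT x|lborel. p x) = 0")
  case True
  then have ae: "AE x in lborel. p x = 0"
    using p p0 by (subst (asm) integral_nonneg_eq_0_iff_AE) auto
  have 1: "(LINT x|lborel. cis (x * t) * complex_of_real (p x)) = 0" for t
    by (rule integral_eq_zero_AE) (use ae in auto)
  have 2: "(LINT x:{a<..b}|lborel. complex_of_real (p x)) = 0"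
    unfolding set_lebesgue_integral_def by (rule integral_eq_zero_AE) (use ae in auto)
  show ?thesis unfolding 1 2 by simp
next
  case False
  define I where "I = (LINT x|lborel. p x)"
  have I: "I > 0"
    using False p0 unfolding I_def by (simp add: order_less_le)
  have [measurable]: "p \<in> borel_measurable borel"
    using p by auto
  define M where "M = density lborel (\<lambda>x. ennreal (p x / I))"
  have ip: "integrable lborel (\<lambda>x. p x / I)"
    using p by simp
  have "prob_space M"
  proof
    have "emeasure M (space M) = (\<integral>\<^sup>+x. ennreal (p x / I) \<partial>lborel)"
      by (simp add: M_def emeasure_density)
    also have "\<dots> = ennreal (LINT x|lborel. p x / I)"
      by (rule nn_integral_eq_integral[OF ip]) (use p0 I in auto)
    also have "(LINT x|lborel. p x / I) = 1"
      using I by (simp add: I_def)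
    finally show "emeasure M (space M) = 1" by simp
  qed
  then interpret real_distribution M
    by (auto simp: real_distribution_def real_distribution_axioms_def M_def)
  have ch: "char M t = (LINT x|lborel. cis (x * t) * of_real (p x)) / of_real I" for t
  proof -
    have "char M t = (LINT x|lborel. (p x / I) *\<^sub>R iexp (t * x))"
      unfolding char_def M_def using p0 I by (subst integral_density) auto
    also have "\<dots> = (LINT x|lborel. (cis (x * t) * of_real (p x)) / of_real I)"
      by (intro Bochner_Integration.integral_cong refl) (simp add: cis_eq_iexp scaleR_conv_of_real mult_ac)
    finally show ?thesis by simp
  qed
  have meas: "measure M A = (LINT x:A|lborel. p x) / I" if [measurable]: "A \<in> sets borel" for A
  proof -
    have "measure M A = (LINT x|M. indicator A x)"
      by (simp add: M_def)
    also have "\<dots> = (LINT x|lborel. (p x / I) *\<^sub>R indicator A x)"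
      unfolding M_def using p0 I by (subst integral_density) auto
    also have "\<dots> = (LINT x|lborel. indicator A x *\<^sub>R p x / I)"
      by (intro Bochner_Integration.integral_cong refl) auto
    finally show ?thesis
      unfolding set_lebesgue_integral_def by simp
  qed
  have null: "measure M {c} = 0" for c
  proof -
    have "(LINT x:{c}|lborel. p x) = 0"
      unfolding set_lebesgue_integral_def
      by (rule integral_eq_zero_AE, use AE_lborel_singleton[of c] in eventually_elim) auto
    then show ?thesis by (simp add: meas)
  qed
  have "(\<lambda>n::nat. 1 / (2 * pi) * (CLBINT t=-real n..real n. (iexp (-(t * a)) - iexp (-(t * b))) / (\<i> * t) * char M t))
      \<longlonglongrightarrow> of_real (measure M {a<..b})"
    using Levy_Inversion[OF ab null null] by simp
  then have "(\<lambda>n::nat. of_real (2 * pi * I) * (1 / (2 * pi) * (CLBINT t=-real n..real n. (iexp (-(t * a)) - iexp (-(t * b))) / (\<i> * t) * char M t)))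
      \<longlonglongrightarrow> of_real (2 * pi * I) * of_real (measure M {a<..b})"
    by (intro tendsto_mult tendsto_const)
  moreover have "of_real (2 * pi * I) * of_real (measure M {a<..b}) = of_real (2 * pi) * (LINT x:{a<..b}|lborel. complex_of_real (p x))"
    using I by (simp add: meas set_integral_complex_of_real)
  moreover have "of_real (2 * pi * I) * (1 / (2 * pi) * (CLBINT t=-real n..real n. (iexp (-(t * a)) - iexp (-(t * b))) / (\<i> * t) * char M t))
      = (LINT t:{-real n<..<real n}|lborel. inversion_kernel a b t * (LINT x|lborel. cis (x * t) * of_real (p x)))" for n :: nat
  proof -
    have "(CLBINT t=-real n..real n. (iexp (-(t * a)) - iexp (-(t * b))) / (\<i> * t) * char M t) =
       (LINT t:{-real n<..<real n}|lborel. inversion_kernel a b t * (LINT x|lborel. cis (x * t) * of_real (p x)) / of_real I)"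
      unfolding ch inversion_kernel_def
      by (simp add: interval_lebesgue_integral_def cis_eq_iexp)
    also have "\<dots> = (LINT t:{-real n<..<real n}|lborel. inversion_kernel a b t * (LINT x|lborel. cis (x * t) * of_real (p x))) / of_real I"
      by simp
    finally show ?thesis
      using I by simp
  qed
  ultimately show ?thesis by (simp only:)
qed

text \<open>The four nonnegative parts of a complex function reduce the inversion formula to that for
  probability densities.\<close>

lemma Levy_inversion_L1:
  fixes h :: "real \<Rightarrow> complex"
  assumes h: "integrable lborel h" and ab: "a \<le> b"
  shows "(\<lambda>n::nat. LINT t:{-real n<..<real n}|lborel. inversion_kernel a b t * (LINT x|lborel. cis (x * t) * h x))
     \<longlonglongrightarrow> of_real (2 * pi) * (LINT x:{a<..b}|lborel. h x)"
proof -
  define F where "F h t = inversion_kernel a b t * (LINT x|lborel. cis (x * t) * h x)" for h t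
  define P where "P h \<longleftrightarrow> integrable lborel h \<and> (\<lambda>n::nat. LINT t:{-real n<..<real n}|lborel. F h t)
     \<longlonglongrightarrow> of_real (2 * pi) * (LINT x:{a<..b}|lborel. h x)" for h
  have si: "set_integrable lborel {-real n<..<real n} (F h)" if h: "integrable lborel h" for h n
  proof -
    note [measurable] = borel_measurable_integrable[OF h]
    have "cmod (F h t) \<le> (b - a) * (LINT x|lborel. cmod (h x))" for t
      unfolding F_def norm_mult
      by (intro mult_mono cmod_inversion_kernel_le ab order_trans[OF integral_norm_bound])
        (use ab in \<open>auto simp: norm_mult\<close>)
    moreover have "F h \<in> borel_measurable borel"
      unfolding F_def by measurable
    ultimately show ?thesis
      unfolding set_integrable_def
      by (intro integrableI_bounded_set_indicator[where B = "(b - a) * (LINT x|lborel. cmod (h x))"]) auto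
  qed
  have si': "set_integrable lborel {a<..b} h" if "integrable lborel h" for h :: "real \<Rightarrow> complex"
    unfolding set_integrable_def using that by (intro integrable_mult_indicator) auto
  have add: "P (\<lambda>x. g x + h x)" if g: "P g" and h: "P h" for g h
  proof -
    have i: "integrable lborel g" "integrable lborel h"
      using g h by (auto simp: P_def)
    have F: "F (\<lambda>x. g x + h x) t = F g t + F h t" for t
      unfolding F_def using integrable_cis_mult(1)[OF i(1)] integrable_cis_mult(1)[OF i(2)]
      by (simp add: distrib_left Bochner_Integration.integral_add)
    show ?thesis
      unfolding P_def F set_integral_add(2)[OF si[OF i(1)] si[OF i(2)]] set_integral_add(2)[OF si'[OF i(1)] si'[OF i(2)]]
        distrib_left
      using g h i by (auto simp: P_def intro!: tendsto_add)
  qed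
  have scale: "P (\<lambda>x. c * h x)" if h: "P h" for h c
  proof -
    have F: "F (\<lambda>x. c * h x) t = c * F h t" for t
    proof -
      have "(LINT x|lborel. cis (x * t) * (c * h x)) = (LINT x|lborel. c * (cis (x * t) * h x))"
        by (intro Bochner_Integration.integral_cong refl) (simp only: mult_ac)
      also have "\<dots> = c * (LINT x|lborel. cis (x * t) * h x)"
        by (rule integral_mult_right_zero)
      finally show ?thesis unfolding F_def by (simp only: mult_ac)
    qed
    have "(\<lambda>n::nat. c * (LINT t:{-real n<..<real n}|lborel. F h t)) \<longlonglongrightarrow> c * (of_real (2 * pi) * (LINT x:{a<..b}|lborel. h x))"
      using h by (intro tendsto_mult tendsto_const) (auto simp: P_def)
    then show ?thesis
      unfolding P_def F using h by (auto simp: P_def mult_ac)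
  qed
  have nonneg: "P (\<lambda>x. of_real (p x))" if "integrable lborel p" "\<And>x. p x \<ge> 0" for p
    using Levy_inversion_nonneg[OF that ab] that by (auto simp: P_def F_def)
  have re: "P (\<lambda>x. of_real (p x))" if p: "integrable lborel p" for p :: "real \<Rightarrow> real"
  proof -
    have "P (\<lambda>x. of_real (max (p x) 0) + (-1) * of_real (max (- p x) 0))"
      using p by (intro add scale nonneg) auto
    also have "(\<lambda>x. of_real (max (p x) 0) + (-1) * of_real (max (- p x) 0)) = (\<lambda>x. complex_of_real (p x))"
      by (auto simp: max_def)
    finally show ?thesis .
  qed
  have "P (\<lambda>x. of_real (Re (h x)) + \<i> * of_real (Im (h x)))"
    using h by (intro add scale re) auto
  then have "P h" by (simp add: complex_eq[symmetric])
  then show ?thesis by (simp add: P_def F_def)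
qed

section \<open>The Fourier transform of square integrable functions\<close>

text \<open>The positive and the negative part of \<open>r\<close> are densities of two finite measures with the same
  distribution function.\<close>

lemma AE_zero_of_Iic_integrals:
  fixes r :: "real \<Rightarrow> real"
  assumes r: "integrable lborel r" and z: "\<And>x. (LINT y:{..x}|lborel. r y) = 0"
  shows "AE x in lborel. r x = 0"
proof -
  note [measurable] = borel_measurable_integrable[OF r]
  define M where "M q = density lborel (\<lambda>x. ennreal (max (q x) 0))" for q :: "real \<Rightarrow> real"
  have fin: "finite_borel_measure (M q)" if q: "integrable lborel q" for q
  proof -
    note [measurable] = borel_measurable_integrable[OF q]
    have "emeasure (M q) (space (M q)) = (\<integral>\<^sup>+x. ennreal (max (q x) 0) \<partial>lborel)"
      by (simp add: M_def emeasure_density)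
    also have "\<dots> < \<infinity>"
      using integrable_max[OF q integrable_zero] by (auto simp: integrable_iff_bounded)
    finally have "finite_measure (M q)"
      by (intro finite_measureI) auto
    then show ?thesis
      by (simp add: finite_borel_measure_def finite_borel_measure_axioms_def M_def)
  qed
  have cdf: "cdf (M q) x = (LINT y:{..x}|lborel. max (q y) 0)" if q: "integrable lborel q" for q x
  proof -
    note [measurable] = borel_measurable_integrable[OF q]
    interpret finite_borel_measure "M q" by (rule fin[OF q])
    have "cdf (M q) x = (LINT y|M q. indicator {..x} y)"
      by (simp add: cdf_def M_def)
    also have "\<dots> = (LINT y|lborel. max (q y) 0 *\<^sub>R indicator {..x} y)"
      unfolding M_def by (subst integral_density) auto
    finally show ?thesis
      by (simp add: set_lebesgue_integral_def mult.commute)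
  qed
  have m: "integrable lborel (\<lambda>x. - r x)" using r by simp
  have "cdf (M r) x = cdf (M (\<lambda>x. - r x)) x" for x
  proof -
    have i: "set_integrable lborel {..x} (\<lambda>y. max (q y) 0)" if "integrable lborel q" for q :: "real \<Rightarrow> real"
      unfolding set_integrable_def using that by (intro integrable_mult_indicator) auto
    have "cdf (M r) x - cdf (M (\<lambda>x. - r x)) x = (LINT y:{..x}|lborel. max (r y) 0 - max (- r y) 0)"
      unfolding cdf[OF r] cdf[OF m] by (intro set_integral_diff(2)[symmetric] i r m)
    also have "(\<lambda>y. max (r y) 0 - max (- r y) 0) = r"
      by (auto simp: max_def)
    finally show ?thesis using z[of x] by simp
  qed
  then have "M r = M (\<lambda>x. - r x)"
    by (intro cdf_unique' fin r m ext)
  then have "AE x in lborel. ennreal (max (r x) 0) = ennreal (max (- r x) 0)"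
    unfolding M_def by (intro sigma_finite_measure.density_unique[OF sigma_finite_lborel]) auto
  then show ?thesis
    by eventually_elim (auto simp: max_def split: if_splits)
qed

lemma AE_zero_of_Iic_integrals_complex:
  fixes q :: "real \<Rightarrow> complex"
  assumes q: "integrable lborel q" and z: "\<And>x. (LINT y:{..x}|lborel. q y) = 0"
  shows "AE x in lborel. q x = 0"
proof -
  have i: "integrable lborel (\<lambda>y. indicator {..x} y *\<^sub>R q y)" for x
    using q by (intro integrable_mult_indicator) auto
  have "AE x in lborel. Re (q x) = 0"
  proof (rule AE_zero_of_Iic_integrals)
    show "(LINT y:{..x}|lborel. Re (q y)) = 0" for x
      using integral_Re[OF i[of x]] z[of x] by (simp add: set_lebesgue_integral_def)
  qed (use q in auto)
  moreover have "AE x in lborel. Im (q x) = 0"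
  proof (rule AE_zero_of_Iic_integrals)
    show "(LINT y:{..x}|lborel. Im (q y)) = 0" for x
      using integral_Im[OF i[of x]] z[of x] by (simp add: set_lebesgue_integral_def)
  qed (use q in auto)
  ultimately show ?thesis
    by eventually_elim (simp add: complex_eq_iff)
qed

lemma AE_zero_of_Ioc_integrals:
  fixes d :: "real \<Rightarrow> complex"
  assumes d: "\<And>n::nat. set_integrable lborel {-real n<..real n} d"
    and z: "\<And>a b. a \<le> b \<Longrightarrow> (LINT x:{a<..b}|lborel. d x) = 0"
  shows "AE x in lborel. d x = 0"
proof -
  have "AE x in lborel. indicator {-real n<..real n} x *\<^sub>R d x = 0" for n
  proof -
    let ?d = "\<lambda>x. indicator {-real n<..real n} x *\<^sub>R d x"
    have i: "integrable lborel ?d"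
      using d[of n] by (simp add: set_integrable_def)
    have *: "(LINT y:{..x}|lborel. ?d y) = 0" for x
    proof -
      have "(LINT y:{..x}|lborel. ?d y) = (LINT y:{-real n<..max (-real n) (min x (real n))}|lborel. d y)"
        unfolding set_lebesgue_integral_def
        by (intro Bochner_Integration.integral_cong refl) (auto split: split_indicator)
      then show ?thesis by (simp add: z)
    qed
    show ?thesis
      by (rule AE_zero_of_Iic_integrals_complex[OF i *])
  qed
  then have "AE x in lborel. \<forall>n. indicator {-real n<..real n} x *\<^sub>R d x = 0"
    unfolding AE_all_countable by blast
  then show ?thesis
  proof eventually_elim
    case (elim x)
    obtain n :: nat where "\<bar>x\<bar> < real n"
      using reals_Archimedean2 by blast
    then have "x \<in> {-real n<..real n}" by auto
    then show ?case using elim[rule_format, of n] by simp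
  qed
qed

lemma continuous_AE_eq:
  fixes f g :: "real \<Rightarrow> complex"
  assumes f: "continuous_on UNIV f" and g: "continuous_on UNIV g" and eq: "AE x in lborel. f x = g x"
  shows "f = g"
proof (rule ccontr)
  assume "f \<noteq> g"
  then have ne: "{x. f x \<noteq> g x} \<noteq> {}" by auto
  have o: "open {x. f x \<noteq> g x}"
    by (rule open_Collect_neq[OF f g])
  have "{x. f x \<noteq> g x} \<in> null_sets lborel"
  proof (subst AE_iff_null_sets)
    show "AE x in lborel. x \<notin> {x. f x \<noteq> g x}"
      using eq by simp
  qed (use o in simp)
  then have "negligible {x. f x \<noteq> g x}"
    by (simp add: negligible_iff_null_sets null_sets_completionI)
  with open_not_negligible[OF o ne] show False by simp
qed

lemma integrable_inverse_1_plus_sq: "integrable lborel (\<lambda>x::real. inverse (1 + x\<^sup>2))"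
proof -
  have "einterval (-\<infinity>) \<infinity> = UNIV"
    by (auto simp: einterval_def)
  then show ?thesis
    using integrable_inverse_1_plus_square by (simp add: set_integrable_def)
qed

text \<open>The kernel is bounded near the origin and decays like \<open>1 / t\<close>.\<close>

lemma inversion_kernel_L2:
  assumes "a \<le> b"
  shows "(\<lambda>t. inversion_kernel a b (- t)) \<in> square_integrable"
proof -
  have bd: "(cmod (inversion_kernel a b t))\<^sup>2 \<le> ((b - a)\<^sup>2 + 4) * inverse (1 + t\<^sup>2)" for t
  proof -
    have 1: "(cmod (inversion_kernel a b t))\<^sup>2 \<le> (b - a)\<^sup>2"
      by (intro power_mono cmod_inversion_kernel_le assms) simp
    have "cmod (inversion_kernel a b t) * \<bar>t\<bar> \<le> 2"
    proof (cases "t = 0")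
      case False
      then have "cmod (inversion_kernel a b t) * \<bar>t\<bar> = cmod (cis (- (t * a)) - cis (- (t * b)))"
        by (simp add: inversion_kernel_def norm_divide norm_mult)
      also have "\<dots> \<le> 1 + 1"
        by (rule order_trans[OF norm_triangle_ineq4]) simp
      finally show ?thesis by simp
    qed simp
    then have "(cmod (inversion_kernel a b t) * \<bar>t\<bar>)\<^sup>2 \<le> 2\<^sup>2"
      by (intro power_mono) auto
    then have 2: "(cmod (inversion_kernel a b t))\<^sup>2 * t\<^sup>2 \<le> 4"
      by (simp add: power_mult_distrib)
    have "(cmod (inversion_kernel a b t))\<^sup>2 * (1 + t\<^sup>2) \<le> (b - a)\<^sup>2 + 4"
      using 1 2 by (simp add: distrib_left)
    moreover have "1 + t\<^sup>2 > 0" by (simp add: add_pos_nonneg)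
    ultimately show ?thesis
      by (simp add: field_simps)
  qed
  have "integrable lborel (\<lambda>t. (cmod (inversion_kernel a b (- t)))\<^sup>2)"
  proof (rule Bochner_Integration.integrable_bound)
    show "integrable lborel (\<lambda>x. ((b - a)\<^sup>2 + 4) * inverse (1 + x\<^sup>2))"
      using integrable_inverse_1_plus_sq by simp
    show "AE x in lborel. norm ((cmod (inversion_kernel a b (- x)))\<^sup>2) \<le> norm (((b - a)\<^sup>2 + 4) * inverse (1 + x\<^sup>2))"
      using bd[of "- x" for x] by (intro always_eventually) (auto intro: order_trans[OF _ abs_ge_self])
  qed measurable
  then show ?thesis
    by (simp add: square_integrable_def)
qed

lemma L2_reflect:
  assumes "f \<in> square_integrable"
  shows "(\<lambda>x. f (- x)) \<in> square_integrable" "L2_norm (\<lambda>x. f (- x)) = L2_norm f"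
proof -
  note [measurable] = square_integrableD(1)[OF assms]
  have i: "integrable lborel (\<lambda>x. (cmod (f x))\<^sup>2)"
    using assms by (simp add: square_integrable_def)
  show "(\<lambda>x. f (- x)) \<in> square_integrable"
    using lborel_integrable_real_affine[OF i, of "-1" 0] by (simp add: square_integrable_def)
  show "L2_norm (\<lambda>x. f (- x)) = L2_norm f"
    unfolding L2_norm_def using lborel_integral_real_affine[of "-1" "\<lambda>x. (cmod (f x))\<^sup>2" 0] by simp
qed

lemma IFT_eq_FT: "IFT g x = FT g (- x) / of_real (2 * pi)"
  by (simp add: IFT_def FT_def mult.commute)

lemma IFT_L2:
  assumes "integrable lborel g" "g \<in> square_integrable"
  shows "IFT g \<in> square_integrable"
proof -
  have "IFT g = (\<lambda>x. (1 / of_real (2 * pi)) * FT g (- x))"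
    by (auto simp: IFT_eq_FT)
  then show ?thesis
    using L2_cmult(1)[OF L2_reflect(1)[OF Bessel_FT(1)[OF assms]]] by metis
qed

lemma emeasure_lborel_Ioc_finite: "emeasure lborel {a<..b::real} < \<top>"
  by (cases "a \<le> b") auto

lemma L2_indicator:
  assumes "f \<in> square_integrable" and [measurable]: "A \<in> sets borel"
  shows "(\<lambda>x. indicator A x *\<^sub>R f x) \<in> square_integrable"
    and "L2_norm (\<lambda>x. indicator A x *\<^sub>R f x) \<le> L2_norm f"
proof -
  note [measurable] = square_integrableD(1)[OF assms(1)]
  have "AE x in lborel. cmod (indicator A x *\<^sub>R f x) \<le> cmod (f x)"
    by (auto split: split_indicator)
  from L2_norm_mono_AE[OF assms(1) _ this]
  show "(\<lambda>x. indicator A x *\<^sub>R f x) \<in> square_integrable"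
    "L2_norm (\<lambda>x. indicator A x *\<^sub>R f x) \<le> L2_norm f" by auto
qed

lemma L2_imp_set_integrable:
  assumes f: "f \<in> square_integrable" and [measurable]: "A \<in> sets borel" and A: "emeasure lborel A < \<infinity>"
  shows "set_integrable lborel A f"
    and "cmod (LINT x:A|lborel. f x) \<le> sqrt (measure lborel A) * L2_norm f"
proof -
  have i: "integrable lborel (\<lambda>x. indicator A x :: real)"
    using A by (simp add: integrable_indicator_iff)
  have p: "(cmod (indicator A x))\<^sup>2 = indicator A x" for x :: real
    by (auto split: split_indicator)
  have A2: "(\<lambda>x. indicator A x) \<in> square_integrable" "L2_norm (\<lambda>x. indicator A x) = sqrt (measure lborel A)"
    using i by (simp_all add: square_integrable_def L2_norm_def p)
  note cs = Cauchy_Schwarz_L2[OF A2(1) f]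
  have e: "indicator A x * f x = indicator A x *\<^sub>R f x" for x
    by (auto split: split_indicator)
  show "set_integrable lborel A f"
    using cs(1) unfolding e by (simp add: set_integrable_def)
  have "cmod (LINT x:A|lborel. f x) \<le> (LINT x|lborel. cmod (indicator A x * f x))"
    unfolding set_lebesgue_integral_def e by (rule integral_norm_bound)
  also note cs(2)
  finally show "cmod (LINT x:A|lborel. f x) \<le> sqrt (measure lborel A) * L2_norm f"
    unfolding A2(2) .
qed

lemma tendsto_L2_norm_outside:
  assumes f: "f \<in> square_integrable"
  shows "((\<lambda>R. L2_norm (\<lambda>x. indicator (- {-R..R}) x *\<^sub>R f x)) \<longlongrightarrow> 0) at_top"
proof -
  note [measurable] = square_integrableD(1)[OF f]
  have "((\<lambda>R. LINT x|lborel. (cmod (indicator (- {-R..R}) x *\<^sub>R f x))\<^sup>2) \<longlongrightarrow> (LINT x::real|lborel. 0 :: real)) at_top"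
  proof (rule integral_dominated_convergence_at_top)
    show "integrable lborel (\<lambda>x. (cmod (f x))\<^sup>2)"
      using f by (simp add: square_integrable_def)
    show "\<forall>\<^sub>F R in at_top. AE x in lborel. norm ((cmod (indicator (- {-R..R}) x *\<^sub>R f x))\<^sup>2) \<le> (cmod (f x))\<^sup>2"
      by (auto split: split_indicator)
    show "AE x in lborel. ((\<lambda>R. (cmod (indicator (- {-R..R}) x *\<^sub>R f x))\<^sup>2) \<longlongrightarrow> 0) at_top"
    proof (intro AE_I2)
      fix x
      have "\<forall>\<^sub>F R in at_top. (cmod (indicator (- {-R..R}) x *\<^sub>R f x))\<^sup>2 = 0"
        using eventually_ge_at_top[of "\<bar>x\<bar>"] by eventually_elim (auto split: split_indicator)
      then show "((\<lambda>R. (cmod (indicator (- {-R..R}) x *\<^sub>R f x))\<^sup>2) \<longlongrightarrow> 0) at_top"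
        by (rule tendsto_eventually)
    qed
  qed measurable
  then have "((\<lambda>R. sqrt (LINT x|lborel. (cmod (indicator (- {-R..R}) x *\<^sub>R f x))\<^sup>2)) \<longlongrightarrow> sqrt 0) at_top"
    by (intro tendsto_real_sqrt) simp
  then show ?thesis by (simp add: L2_norm_def)
qed

definition cut :: "real \<Rightarrow> (real \<Rightarrow> complex) \<Rightarrow> real \<Rightarrow> complex" where
  "cut R f x = indicator {-R..R} x *\<^sub>R f x"

lemma truncated_fourier_eq_FT: "truncated_fourier R f = FT (cut R f)"
  unfolding truncated_fourier_def FT_def cut_def set_lebesgue_integral_def
  by (intro ext Bochner_Integration.integral_cong refl) simp

lemma cut_L2:
  assumes "f \<in> square_integrable"
  shows "cut R f \<in> square_integrable" "integrable lborel (cut R f)"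
  using L2_indicator(1)[OF assms, of "{-R..R}"] L2_imp_set_integrable(1)[OF assms, of "{-R..R}"]
  unfolding cut_def[abs_def] set_integrable_def by (auto simp: emeasure_lborel_Icc_eq)

lemma borel_measurable_FT_cut [measurable]:
  assumes "f \<in> square_integrable"
  shows "FT (cut R f) \<in> borel_measurable borel"
  by (rule square_integrableD(1)[OF Bessel_FT(1)[OF cut_L2(2,1)[OF assms]]])

lemma FT_diff:
  assumes "integrable lborel f" "integrable lborel g"
  shows "FT (\<lambda>x. f x - g x) \<xi> = FT f \<xi> - FT g \<xi>"
  unfolding FT_def using integrable_cis_mult(3)[OF assms(1)] integrable_cis_mult(3)[OF assms(2)]
  by (simp add: right_diff_distrib)

lemma FT_cut_diff_le:
  assumes f: "f \<in> square_integrable" and R: "R \<le> S"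
  shows "L2_norm (\<lambda>\<xi>. FT (cut S f) \<xi> - FT (cut R f) \<xi>) \<le>
    sqrt (2 * pi) * L2_norm (\<lambda>x. indicator (- {-R..R}) x *\<^sub>R f x)"
proof -
  note [measurable] = square_integrableD(1)[OF f]
  let ?h = "\<lambda>x. cut S f x - cut R f x"
  have h: "integrable lborel ?h" "?h \<in> square_integrable"
    using cut_L2[OF f] by (auto intro: L2_diff)
  have "(\<lambda>\<xi>. FT (cut S f) \<xi> - FT (cut R f) \<xi>) = FT ?h"
    using FT_diff[OF cut_L2(2)[OF f] cut_L2(2)[OF f]] by auto
  then have "L2_norm (\<lambda>\<xi>. FT (cut S f) \<xi> - FT (cut R f) \<xi>) \<le> sqrt (2 * pi) * L2_norm ?h"
    using Bessel_FT(2)[OF h] by simp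
  also have "L2_norm ?h \<le> L2_norm (\<lambda>x. indicator (- {-R..R}) x *\<^sub>R f x)"
    using R by (intro L2_norm_mono_AE(2) L2_indicator f)
      (auto simp: cut_def intro!: borel_measurable_diff square_integrableD(1)[OF cut_L2(1)[OF f]] split: split_indicator)
  finally show ?thesis by simp
qed

lemma is_fourier_transform_iff:
  assumes f: "f \<in> square_integrable"
  shows "is_fourier_transform f g \<longleftrightarrow> g \<in> square_integrable \<and>
     ((\<lambda>R. L2_norm (\<lambda>\<xi>. FT (cut R f) \<xi> - g \<xi>)) \<longlongrightarrow> 0) at_top"
proof (cases "g \<in> square_integrable")
  case True
  have d: "(\<lambda>\<xi>. FT (cut R f) \<xi> - g \<xi>) \<in> square_integrable" for R
    by (intro L2_diff(1) True Bessel_FT(1) cut_L2 f)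
  have eq: "(\<integral>\<^sup>+\<xi>. ennreal ((cmod (truncated_fourier R f \<xi> - g \<xi>))\<^sup>2) \<partial>lborel) = ennreal ((L2_norm (\<lambda>\<xi>. FT (cut R f) \<xi> - g \<xi>))\<^sup>2)" for R
    unfolding truncated_fourier_eq_FT by (rule square_integrableD(2)[OF d])
  have "((\<lambda>R. ennreal ((L2_norm (\<lambda>\<xi>. FT (cut R f) \<xi> - g \<xi>))\<^sup>2)) \<longlongrightarrow> ennreal 0) at_top \<longleftrightarrow>
      ((\<lambda>R. (L2_norm (\<lambda>\<xi>. FT (cut R f) \<xi> - g \<xi>))\<^sup>2) \<longlongrightarrow> 0) at_top"
    by (rule tendsto_ennreal_iff) auto
  moreover have "((\<lambda>R. (L2_norm (\<lambda>\<xi>. FT (cut R f) \<xi> - g \<xi>))\<^sup>2) \<longlongrightarrow> 0) at_top \<longleftrightarrow>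
      ((\<lambda>R. L2_norm (\<lambda>\<xi>. FT (cut R f) \<xi> - g \<xi>)) \<longlongrightarrow> 0) at_top"
    using tendsto_power[of "\<lambda>R. L2_norm (\<lambda>\<xi>. FT (cut R f) \<xi> - g \<xi>)" 0 at_top 2]
      tendsto_real_sqrt[of "\<lambda>R. (L2_norm (\<lambda>\<xi>. FT (cut R f) \<xi> - g \<xi>))\<^sup>2" 0 at_top] by auto
  ultimately show ?thesis
    unfolding is_fourier_transform_def eq using True by simp
qed (simp add: is_fourier_transform_def)

text \<open>The transforms of the truncations form a Cauchy family, which is where completeness of
  \<open>L\<^sup>2\<close> enters.\<close>

lemma is_fourier_transform_exists:
  assumes f: "f \<in> square_integrable"
  shows "\<exists>g. is_fourier_transform f g"
proof -
  define \<tau> where "\<tau> R = sqrt (2 * pi) * L2_norm (\<lambda>x. indicator (- {-R..R}) x *\<^sub>R f x)" for R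
  have \<tau>: "(\<tau> \<longlongrightarrow> 0) at_top"
    unfolding \<tau>_def[abs_def] by (intro tendsto_mult_right_zero tendsto_L2_norm_outside f)
  have S: "FT (cut R f) \<in> square_integrable" for R
    by (intro Bessel_FT(1) cut_L2 f)
  have sym: "L2_norm (\<lambda>x. h x - k x) = L2_norm (\<lambda>x. k x - h x)" for h k :: "real \<Rightarrow> complex"
    by (simp add: L2_norm_def norm_minus_commute)
  have le: "L2_norm (\<lambda>\<xi>. FT (cut S f) \<xi> - FT (cut R f) \<xi>) \<le> \<tau> R" if "R \<le> S" for R S
    unfolding \<tau>_def by (rule FT_cut_diff_le[OF f that])
  obtain g where g: "g \<in> square_integrable" and
    lim: "(\<lambda>n. L2_norm (\<lambda>\<xi>. FT (cut (real n) f) \<xi> - g \<xi>)) \<longlonglongrightarrow> 0"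
  proof (rule L2_complete[of "\<lambda>n. FT (cut (real n) f)"])
    fix e :: real assume e: "e > 0"
    have "eventually (\<lambda>n. \<tau> (real n) < e / 2) sequentially"
      using order_tendstoD(2)[OF filterlim_compose[OF \<tau> filterlim_real_sequentially], of "e / 2"] e by auto
    then obtain M where M: "\<tau> (real M) < e / 2"
      by (auto simp: eventually_sequentially)
    have "L2_norm (\<lambda>x. FT (cut (real m) f) x - FT (cut (real n) f) x) < e" if "m \<ge> M" "n \<ge> M" for m n
    proof -
      have "L2_norm (\<lambda>x. (FT (cut (real m) f) x - FT (cut (real M) f) x) - (FT (cut (real n) f) x - FT (cut (real M) f) x))
        \<le> L2_norm (\<lambda>x. FT (cut (real m) f) x - FT (cut (real M) f) x) + L2_norm (\<lambda>x. FT (cut (real n) f) x - FT (cut (real M) f) x)"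
        by (intro L2_diff S)
      also have "\<dots> \<le> \<tau> (real M) + \<tau> (real M)"
        using that by (intro add_mono le) auto
      finally show ?thesis using M by simp
    qed
    then show "\<exists>M. \<forall>m\<ge>M. \<forall>n\<ge>M. L2_norm (\<lambda>x. FT (cut (real m) f) x - FT (cut (real n) f) x) < e"
      by blast
  qed (use S in auto)
  have bd: "L2_norm (\<lambda>\<xi>. FT (cut R f) \<xi> - g \<xi>) \<le> \<tau> R" for R
  proof (rule field_le_epsilon)
    fix e :: real assume e: "e > 0"
    have "eventually (\<lambda>n. L2_norm (\<lambda>\<xi>. FT (cut (real n) f) \<xi> - g \<xi>) < e \<and> R \<le> real n) sequentially"
      using order_tendstoD(2)[OF lim e] eventually_ge_at_top[of "nat \<lceil>R\<rceil>"]
      by eventually_elim linarith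
    then obtain n where n: "L2_norm (\<lambda>\<xi>. FT (cut (real n) f) \<xi> - g \<xi>) < e" "R \<le> real n"
      by (auto simp: eventually_sequentially)
    have "L2_norm (\<lambda>\<xi>. (FT (cut (real n) f) \<xi> - g \<xi>) - (FT (cut (real n) f) \<xi> - FT (cut R f) \<xi>))
        \<le> L2_norm (\<lambda>\<xi>. FT (cut (real n) f) \<xi> - g \<xi>) + L2_norm (\<lambda>\<xi>. FT (cut (real n) f) \<xi> - FT (cut R f) \<xi>)"
      by (intro L2_diff S g)
    then show "L2_norm (\<lambda>\<xi>. FT (cut R f) \<xi> - g \<xi>) \<le> \<tau> R + e"
      using le[OF n(2)] n(1) by simp
  qed
  have "((\<lambda>R. L2_norm (\<lambda>\<xi>. FT (cut R f) \<xi> - g \<xi>)) \<longlongrightarrow> 0) at_top"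
    by (rule tendsto_sandwich[OF _ _ tendsto_const \<tau>]) (auto simp: bd)
  then show ?thesis
    using is_fourier_transform_iff[OF f] g by blast
qed

lemma is_fourier_transform_fourier:
  assumes "f \<in> square_integrable"
  shows "is_fourier_transform f (fourier f)"
  unfolding fourier_def using is_fourier_transform_exists[OF assms] by (rule someI_ex)

lemma is_fourier_transform_unique:
  assumes f: "f \<in> square_integrable" and g: "is_fourier_transform f g" and h: "is_fourier_transform f h"
  shows "AE \<xi> in lborel. g \<xi> = h \<xi>"
proof -
  have gh: "g \<in> square_integrable" "h \<in> square_integrable"
    using g h by (auto simp: is_fourier_transform_def)
  have S: "FT (cut R f) \<in> square_integrable" for R
    by (intro Bessel_FT(1) cut_L2 f)
  have "((\<lambda>R. L2_norm (\<lambda>\<xi>. FT (cut R f) \<xi> - h \<xi>) + L2_norm (\<lambda>\<xi>. FT (cut R f) \<xi> - g \<xi>)) \<longlongrightarrow> 0 + 0) at_top"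
    using g h unfolding is_fourier_transform_iff[OF f] by (intro tendsto_add) auto
  moreover have "L2_norm (\<lambda>\<xi>. g \<xi> - h \<xi>) \<le> L2_norm (\<lambda>\<xi>. FT (cut R f) \<xi> - h \<xi>) + L2_norm (\<lambda>\<xi>. FT (cut R f) \<xi> - g \<xi>)" for R
    using L2_diff(2)[OF L2_diff(1)[OF S gh(2)] L2_diff(1)[OF S gh(1)], of R R] by simp
  ultimately have "L2_norm (\<lambda>\<xi>. g \<xi> - h \<xi>) \<le> 0 + 0"
    by (intro tendsto_lowerbound[of _ _ at_top]) auto
  then have "AE \<xi> in lborel. g \<xi> - h \<xi> = 0"
    by (intro L2_norm_eq_0 L2_diff gh) (simp add: antisym)
  then show ?thesis by simp
qed

lemma is_fourier_transform_cong_AE: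
  assumes f: "f \<in> square_integrable" and g: "is_fourier_transform f g"
    and [measurable]: "h \<in> borel_measurable borel" and eq: "AE \<xi> in lborel. g \<xi> = h \<xi>"
  shows "is_fourier_transform f h"
proof -
  have gS: "g \<in> square_integrable"
    using g by (auto simp: is_fourier_transform_def)
  have eq': "AE \<xi> in lborel. h \<xi> = g \<xi>" using eq by auto
  have hS: "h \<in> square_integrable"
    by (rule L2_norm_cong_AE(1)[OF gS _ eq']) simp
  have S: "FT (cut R f) \<in> square_integrable" for R
    by (intro Bessel_FT(1) cut_L2 f)
  have "L2_norm (\<lambda>\<xi>. FT (cut R f) \<xi> - h \<xi>) = L2_norm (\<lambda>\<xi>. FT (cut R f) \<xi> - g \<xi>)" for R
    by (rule L2_norm_cong_AE(2)[OF L2_diff(1)[OF S gS] square_integrableD(1)[OF L2_diff(1)[OF S hS]]])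
      (use eq in auto)
  then show ?thesis
    using g hS unfolding is_fourier_transform_iff[OF f] by simp
qed

lemma integral_Ioc_cis:
  assumes "a \<le> b" "x \<noteq> 0"
  shows "(LINT \<xi>:{a<..b}|lborel. cis (- (x * \<xi>))) = inversion_kernel a b x"
proof -
  have "(LINT \<xi>:{a<..b}|lborel. cis (- (x * \<xi>))) = (LINT \<xi>|lborel. indicator {a..b} \<xi> *\<^sub>R cis (- (x * \<xi>)))"
    unfolding set_lebesgue_integral_def
  proof (rule integral_cong_AE)
    show "AE \<xi> in lborel. indicator {a<..b} \<xi> *\<^sub>R cis (- (x * \<xi>)) = indicator {a..b} \<xi> *\<^sub>R cis (- (x * \<xi>))"
      using AE_lborel_singleton[of a] by eventually_elim (auto split: split_indicator)
  qed measurable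
  also have "\<dots> = (\<i> / of_real x) * cis (- (x * b)) - (\<i> / of_real x) * cis (- (x * a))"
  proof (rule integral_FTC_atLeastAtMost[OF assms(1)])
    fix \<xi>
    have "((\<lambda>z. (\<i> / of_real x) * exp (\<i> * (- (of_real x * z)))) has_field_derivative cis (- (x * \<xi>))) (at (of_real \<xi>))"
      using assms(2) by (auto intro!: derivative_eq_intros simp: cis_conv_exp mult_ac)
    from has_vector_derivative_real_field[OF this]
    have "((\<lambda>t. (\<i> / of_real x) * exp (\<i> * (- (of_real x * of_real t)))) has_vector_derivative cis (- (x * \<xi>))) (at \<xi> within {a..b})" .
    then show "((\<lambda>t. (\<i> / of_real x) * cis (- (x * t))) has_vector_derivative cis (- (x * \<xi>))) (at \<xi> within {a..b})"
      by (simp add: cis_conv_exp)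
  qed (intro continuous_intros)
  also have "\<dots> = inversion_kernel a b x"
    using assms(2) by (simp add: inversion_kernel_def field_simps)
  finally show ?thesis .
qed

lemma integral_Ioc_FT:
  assumes f: "integrable lborel f" and ab: "a \<le> b"
  shows "(LINT \<xi>:{a<..b}|lborel. FT f \<xi>) = (LINT x|lborel. f x * inversion_kernel a b x)"
proof -
  let ?I = "\<lambda>\<xi>. complex_of_real (indicator {a<..b} \<xi>)"
  have i: "integrable lborel ?I"
    by (intro integrable_of_real) (simp add: integrable_indicator_iff emeasure_lborel_Ioc_finite)
  have "(LINT \<xi>:{a<..b}|lborel. FT f \<xi>) = (LINT \<xi>|lborel. LINT x|lborel. cis (- (x * \<xi>)) * (?I \<xi> * f x))"
    unfolding set_lebesgue_integral_def
  proof (intro Bochner_Integration.integral_cong refl)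
    fix \<xi>
    have "(LINT x|lborel. cis (- (x * \<xi>)) * (?I \<xi> * f x)) = (LINT x|lborel. ?I \<xi> * (cis (- (x * \<xi>)) * f x))"
      by (intro Bochner_Integration.integral_cong refl) (simp only: mult_ac)
    also have "\<dots> = ?I \<xi> * FT f \<xi>"
      unfolding FT_def by (rule integral_mult_right_zero)
    finally show "indicat_real {a<..b} \<xi> *\<^sub>R FT f \<xi> = (LINT x|lborel. cis (- (x * \<xi>)) * (?I \<xi> * f x))"
      by (simp add: scaleR_conv_of_real)
  qed
  also have "\<dots> = (LINT x|lborel. LINT \<xi>|lborel. cis (- (x * \<xi>)) * (?I \<xi> * f x))"
    by (rule Fubini_kernel[OF i f, where B=1]) auto
  also have "\<dots> = (LINT x|lborel. f x * inversion_kernel a b x)"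
  proof (rule integral_cong_AE)
    have e: "(LINT \<xi>|lborel. cis (- (x * \<xi>)) * (?I \<xi> * f x)) = f x * (LINT \<xi>:{a<..b}|lborel. cis (- (x * \<xi>)))" for x
    proof -
      have "(LINT \<xi>|lborel. cis (- (x * \<xi>)) * (?I \<xi> * f x)) = (LINT \<xi>|lborel. f x * (indicator {a<..b} \<xi> *\<^sub>R cis (- (x * \<xi>))))"
        by (intro Bochner_Integration.integral_cong refl) (simp only: mult_ac scaleR_conv_of_real)
      also have "\<dots> = f x * (LINT \<xi>|lborel. indicator {a<..b} \<xi> *\<^sub>R cis (- (x * \<xi>)))"
        by (rule integral_mult_right_zero)
      finally show ?thesis
        unfolding set_lebesgue_integral_def .
    qed
    show "AE x in lborel. (LINT \<xi>|lborel. cis (- (x * \<xi>)) * (?I \<xi> * f x)) = f x * inversion_kernel a b x"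
      unfolding e using AE_lborel_singleton[of 0]
      by eventually_elim (simp add: integral_Ioc_cis[OF ab])
  qed (use f in measurable)
  finally show ?thesis .
qed

lemma tendsto_L2_pairing:
  assumes k: "k \<in> square_integrable" and f: "\<And>n. f n \<in> square_integrable" and g: "g \<in> square_integrable"
    and lim: "((\<lambda>n. L2_norm (\<lambda>x. f n x - g x)) \<longlongrightarrow> 0) F"
  shows "((\<lambda>n. LINT x|lborel. f n x * k x) \<longlongrightarrow> (LINT x|lborel. g x * k x)) F"
proof (rule Lim_null[THEN iffD2], rule Lim_null_comparison)
  have "norm ((LINT x|lborel. f n x * k x) - (LINT x|lborel. g x * k x)) \<le> L2_norm (\<lambda>x. f n x - g x) * L2_norm k" for n
  proof -
    have "(LINT x|lborel. f n x * k x) - (LINT x|lborel. g x * k x) = (LINT x|lborel. (f n x - g x) * k x)"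
      unfolding left_diff_distrib
      by (rule Bochner_Integration.integral_diff[symmetric]) (intro Cauchy_Schwarz_L2 f g k)+
    then show ?thesis
      using Cauchy_Schwarz_L2(2)[OF L2_diff(1)[OF f g] k] integral_norm_bound[of lborel "\<lambda>x. (f n x - g x) * k x"]
      by (metis (no_types, lifting) order_trans)
  qed
  then show "\<forall>\<^sub>F n in F. norm ((LINT x|lborel. f n x * k x) - (LINT x|lborel. g x * k x)) \<le> L2_norm (\<lambda>x. f n x - g x) * L2_norm k"
    by simp
  show "((\<lambda>n. L2_norm (\<lambda>x. f n x - g x) * L2_norm k) \<longlongrightarrow> 0) F"
    using tendsto_mult_left_zero[OF lim] by simp
qed

lemma indicator_L2:
  "(\<lambda>x. complex_of_real (indicator {a<..b} x)) \<in> square_integrable"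
proof -
  have "(cmod (complex_of_real (indicator {a<..b} x)))\<^sup>2 = indicator {a<..b} x" for x :: real
    by (auto split: split_indicator)
  then show ?thesis
    by (simp add: square_integrable_def integrable_indicator_iff emeasure_lborel_Ioc_finite)
qed

lemma set_lebesgue_integral_Ioc_conv_mult:
  "(LINT x:{a<..b}|lborel. f x) = (LINT x|lborel. f x * complex_of_real (indicator {a<..b} x))"
  unfolding set_lebesgue_integral_def
  by (intro Bochner_Integration.integral_cong refl) (simp add: scaleR_conv_of_real)

text \<open>By Bessel's inequality the transform \<open>G\<close> of the inverse transform of \<open>g\<close> exists. To identify it
  with \<open>g\<close> it suffices to compare integrals over bounded intervals, which are continuous in mean
  square, and for the truncations these are the integrals in Levy's inversion formula.\<close>

lemma fourier_IFT:
  assumes g1: "integrable lborel g" and g2: "g \<in> square_integrable"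
  shows "is_fourier_transform (IFT g) g"
proof -
  note f = IFT_L2[OF assms]
  note [measurable] = borel_measurable_integrable[OF g1] square_integrableD(1)[OF f]
  obtain G where G: "is_fourier_transform (IFT g) G"
    using is_fourier_transform_exists[OF f] by blast
  then have G2: "G \<in> square_integrable"
    and lim: "((\<lambda>R. L2_norm (\<lambda>\<xi>. FT (cut R (IFT g)) \<xi> - G \<xi>)) \<longlongrightarrow> 0) at_top"
    by (auto simp: is_fourier_transform_iff[OF f])
  have S: "FT (cut R (IFT g)) \<in> square_integrable" for R
    by (intro Bessel_FT(1) cut_L2 f)
  have eq: "(LINT x:{a<..b}|lborel. G x) = (LINT x:{a<..b}|lborel. g x)" if ab: "a \<le> b" for a b
  proof -
    have "(\<lambda>n. LINT x:{a<..b}|lborel. FT (cut (real n) (IFT g)) x) \<longlonglongrightarrow> (LINT x:{a<..b}|lborel. G x)"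
      unfolding set_lebesgue_integral_Ioc_conv_mult
      by (intro tendsto_L2_pairing indicator_L2 S G2 filterlim_compose[OF lim filterlim_real_sequentially])
    moreover have "(LINT x:{a<..b}|lborel. FT (cut (real n) (IFT g)) x) =
      (LINT t:{-real n<..<real n}|lborel. inversion_kernel a b t * (LINT x|lborel. cis (x * t) * g x)) / of_real (2 * pi)" for n
    proof -
      have "(LINT x:{a<..b}|lborel. FT (cut (real n) (IFT g)) x) = (LINT x|lborel. cut (real n) (IFT g) x * inversion_kernel a b x)"
        by (rule integral_Ioc_FT[OF cut_L2(2)[OF f] ab])
      also have "\<dots> = (LINT t|lborel. indicator {-real n<..<real n} t *\<^sub>R (inversion_kernel a b t * (LINT x|lborel. cis (x * t) * g x)) / of_real (2 * pi))"
      proof (rule integral_cong_AE)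
        show "AE x in lborel. cut (real n) (IFT g) x * inversion_kernel a b x =
            indicator {-real n<..<real n} x *\<^sub>R (inversion_kernel a b x * (LINT xa|lborel. cis (xa * x) * g xa)) / of_real (2 * pi)"
          using AE_lborel_singleton[of "real n"] AE_lborel_singleton[of "- real n"]
          by eventually_elim (auto simp: cut_def IFT_def mult.commute split: split_indicator)
      qed (simp_all add: cut_def[abs_def])
      also have "\<dots> = (LINT t|lborel. indicator {-real n<..<real n} t *\<^sub>R (inversion_kernel a b t * (LINT x|lborel. cis (x * t) * g x))) / of_real (2 * pi)"
        by (rule integral_divide_zero)
      finally show ?thesis
        unfolding set_lebesgue_integral_def .
    qed
    moreover have "(\<lambda>n::nat. (LINT t:{-real n<..<real n}|lborel. inversion_kernel a b t * (LINT x|lborel. cis (x * t) * g x)) / of_real (2 * pi))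
       \<longlonglongrightarrow> (of_real (2 * pi) * (LINT x:{a<..b}|lborel. g x)) / of_real (2 * pi)"
      by (intro tendsto_divide Levy_inversion_L1 g1 ab tendsto_const) simp
    ultimately show ?thesis
      using LIMSEQ_unique by simp
  qed
  have ii: "set_integrable lborel {a<..b} h" if "h \<in> square_integrable" for a b and h :: "real \<Rightarrow> complex"
    by (rule L2_imp_set_integrable(1)[OF that]) (auto simp: emeasure_lborel_Ioc_finite)
  have "AE x in lborel. G x - g x = 0"
  proof (rule AE_zero_of_Ioc_integrals)
    show "set_integrable lborel {- real n<..real n} (\<lambda>x. G x - g x)" for n
      by (intro set_integral_diff ii G2 g2)
    show "(LINT x:{a<..b}|lborel. G x - g x) = 0" if "a \<le> b" for a b
      using eq[OF that] by (subst set_integral_diff(2)[OF ii[OF G2] ii[OF g2]]) simp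
  qed
  then show ?thesis
    by (intro is_fourier_transform_cong_AE[OF f G]) auto
qed

lemma continuous_on_IFT:
  assumes g: "integrable lborel g"
  shows "continuous_on UNIV (IFT g)"
proof -
  note [measurable] = borel_measurable_integrable[OF g]
  have "continuous_on UNIV (\<lambda>x. LINT \<xi>|lborel. cis (x * \<xi>) * g \<xi>)"
  proof (intro continuous_at_imp_continuous_on ballI)
    fix x :: real
    show "isCont (\<lambda>x. LINT \<xi>|lborel. cis (x * \<xi>) * g \<xi>) x"
      unfolding continuous_at_sequentially comp_def
    proof safe
      fix X assume X: "X \<longlonglongrightarrow> x"
      show "(\<lambda>n. LINT \<xi>|lborel. cis (X n * \<xi>) * g \<xi>) \<longlonglongrightarrow> (LINT \<xi>|lborel. cis (x * \<xi>) * g \<xi>)"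
        by (rule integral_dominated_convergence[where w="\<lambda>\<xi>. cmod (g \<xi>)"])
          (use g X in \<open>auto simp: norm_mult intro!: tendsto_intros\<close>)
    qed
  qed
  then show ?thesis
    unfolding IFT_def[abs_def] by (intro continuous_intros) auto
qed

text \<open>Again integrals over bounded intervals are compared. That of the inverse transform pairs \<open>g\<close> with a
  square integrable kernel, so \<open>g\<close> may be replaced by the transforms of the truncations of \<open>f\<close>, to
  which Levy's formula applies; continuity turns almost everywhere into everywhere.\<close>

lemma IFT_fourier:
  assumes f: "f \<in> square_integrable" and cont: "continuous_on UNIV f"
    and g: "is_fourier_transform f g" and g1: "integrable lborel g"
  shows "f = IFT g"
proof (rule continuous_AE_eq[OF cont continuous_on_IFT[OF g1]])
  note [measurable] = borel_measurable_integrable[OF g1] square_integrableD(1)[OF f]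
  have g2: "g \<in> square_integrable"
    and lim: "((\<lambda>R. L2_norm (\<lambda>\<xi>. FT (cut R f) \<xi> - g \<xi>)) \<longlongrightarrow> 0) at_top"
    using g by (auto simp: is_fourier_transform_iff[OF f])
  have S: "FT (cut R f) \<in> square_integrable" for R
    by (intro Bessel_FT(1) cut_L2 f)
  have eq: "(LINT x:{a<..b}|lborel. f x) = (LINT x:{a<..b}|lborel. IFT g x)" if ab: "a \<le> b" for a b
  proof -
    let ?k = "\<lambda>\<xi>. inversion_kernel a b (- \<xi>)"
    note k = inversion_kernel_L2[OF ab]
    have "(\<lambda>n. LINT \<xi>|lborel. FT (cut (real n) f) \<xi> * ?k \<xi>) \<longlonglongrightarrow> (LINT \<xi>|lborel. g \<xi> * ?k \<xi>)"
      by (intro tendsto_L2_pairing k S g2 filterlim_compose[OF lim filterlim_real_sequentially])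
    moreover have "(LINT \<xi>|lborel. FT (cut (real n) f) \<xi> * ?k \<xi>) = of_real (2 * pi) * (LINT x:{a<..b}|lborel. cut (real n) f x)" for n
    proof (rule LIMSEQ_unique)
      \<comment> \<open>both sides are limits of the same integrals over growing intervals\<close>
      let ?h = "cut (real n) f"
      let ?q = "\<lambda>t. inversion_kernel a b t * (LINT x|lborel. cis (x * t) * ?h x)"
      note Levy_inversion_L1[OF cut_L2(2)[OF f] ab, of "real n"]
      then show "(\<lambda>m::nat. LINT t:{-real m<..<real m}|lborel. ?q t) \<longlonglongrightarrow> of_real (2 * pi) * (LINT x:{a<..b}|lborel. ?h x)" .
      have q: "?q t = FT ?h (- t) * ?k (- t)" for t
        by (simp add: FT_def)
      have iq: "integrable lborel ?q"
        unfolding q using lborel_integrable_real_affine[OF Cauchy_Schwarz_L2(1)[OF S[of "real n"] k], of "-1" 0] by simp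
      have "(\<lambda>m::nat. LINT t:{-real m<..<real m}|lborel. ?q t) \<longlonglongrightarrow> (LINT t|lborel. ?q t)"
        unfolding set_lebesgue_integral_def
      proof (rule integral_dominated_convergence[where w="\<lambda>t. cmod (?q t)"])
        show "AE x in lborel. (\<lambda>i. indicat_real {- real i<..<real i} x *\<^sub>R ?q x) \<longlonglongrightarrow> ?q x"
        proof (intro AE_I2 tendsto_eventually)
          fix x :: real
          show "\<forall>\<^sub>F i in sequentially. indicat_real {- real i<..<real i} x *\<^sub>R ?q x = ?q x"
            using eventually_gt_at_top[of "nat \<lceil>\<bar>x\<bar>\<rceil>"] by eventually_elim (auto simp: indicator_def, linarith+)
        qed
      qed (use iq in \<open>auto split: split_indicator\<close>)
      also have "(LINT t|lborel. ?q t) = (LINT \<xi>|lborel. FT ?h \<xi> * ?k \<xi>)"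
        unfolding q using lborel_integral_real_affine[of "-1" "\<lambda>\<xi>. FT ?h \<xi> * ?k \<xi>" 0] by simp
      finally show "(\<lambda>m::nat. LINT t:{-real m<..<real m}|lborel. ?q t) \<longlonglongrightarrow> (LINT \<xi>|lborel. FT ?h \<xi> * ?k \<xi>)" .
    qed
    moreover have "\<forall>\<^sub>F n in sequentially. of_real (2 * pi) * (LINT x:{a<..b}|lborel. cut (real n) f x) = of_real (2 * pi) * (LINT x:{a<..b}|lborel. f x)"
      using eventually_ge_at_top[of "nat \<lceil>max \<bar>a\<bar> \<bar>b\<bar>\<rceil>"]
    proof eventually_elim
      case (elim n)
      then have "\<bar>a\<bar> \<le> real n" "\<bar>b\<bar> \<le> real n" by linarith+
      then show ?case
        unfolding set_lebesgue_integral_def cut_def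
        by (intro arg_cong[of _ _ "\<lambda>x. of_real (2 * pi) * x"] Bochner_Integration.integral_cong refl)
          (auto simp: indicator_def)
    qed
    ultimately have "(LINT \<xi>|lborel. g \<xi> * ?k \<xi>) = of_real (2 * pi) * (LINT x:{a<..b}|lborel. f x)"
      by (intro LIMSEQ_unique[OF _ tendsto_eventually]) auto
    moreover have "(LINT x:{a<..b}|lborel. IFT g x) = (LINT \<xi>|lborel. g \<xi> * ?k \<xi>) / of_real (2 * pi)"
    proof -
      let ?r = "\<lambda>\<xi>. g (- \<xi>)"
      have r: "integrable lborel ?r"
        using lborel_integrable_real_affine[OF g1, of "-1" 0] by simp
      have "IFT g x = FT ?r x / of_real (2 * pi)" for x
        unfolding IFT_def FT_def
        by (subst lborel_integral_real_affine[of "-1" _ 0]) (simp_all add: mult.commute)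
      then have "(LINT x:{a<..b}|lborel. IFT g x) = (LINT x:{a<..b}|lborel. FT ?r x) / of_real (2 * pi)"
        by simp
      also have "(LINT x:{a<..b}|lborel. FT ?r x) = (LINT \<xi>|lborel. ?r \<xi> * inversion_kernel a b \<xi>)"
        by (rule integral_Ioc_FT[OF r ab])
      also have "\<dots> = (LINT \<xi>|lborel. g \<xi> * ?k \<xi>)"
        by (subst lborel_integral_real_affine[of "-1" _ 0]) simp_all
      finally show ?thesis .
    qed
    ultimately show ?thesis by simp
  qed
  have ii: "set_integrable lborel {a<..b} h" if "h \<in> square_integrable" for a b and h :: "real \<Rightarrow> complex"
    by (rule L2_imp_set_integrable(1)[OF that]) (auto simp: emeasure_lborel_Ioc_finite)
  have IS: "IFT g \<in> square_integrable"
    by (rule IFT_L2[OF g1 g2])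
  have "AE x in lborel. f x - IFT g x = 0"
  proof (rule AE_zero_of_Ioc_integrals)
    show "set_integrable lborel {- real n<..real n} (\<lambda>x. f x - IFT g x)" for n
      by (intro set_integral_diff ii IS f)
    show "(LINT x:{a<..b}|lborel. f x - IFT g x) = 0" if "a \<le> b" for a b
      using eq[OF that] by (subst set_integral_diff(2)[OF ii[OF f] ii[OF IS]]) simp
  qed
  then show "AE x in lborel. f x = IFT g x" by simp
qed

section \<open>Sobolev spaces in terms of spectra\<close>

definition weight :: "real \<Rightarrow> real \<Rightarrow> real" where
  "weight r \<xi> = (1 + \<xi>\<^sup>2) powr (r / 2)"

definition weighted :: "real \<Rightarrow> (real \<Rightarrow> complex) \<Rightarrow> real \<Rightarrow> complex" where
  "weighted r g \<xi> = of_real (weight r \<xi>) * g \<xi>"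

text \<open>The continuous members of a Sobolev space of order at least one are exactly the inverse transforms of
  such functions. Working with the latter frees the estimates from the choice in the definition
  of \<open>fourier\<close>.\<close>

definition sobolev_spectra :: "real \<Rightarrow> (real \<Rightarrow> complex) set" where
  "sobolev_spectra r = {g \<in> borel_measurable borel. weighted r g \<in> square_integrable}"

text \<open>Membership in a Sobolev space does not see null sets; the continuous representative is the one to
  which pointwise inversion applies.\<close>

definition sobolev_cont :: "real \<Rightarrow> (real \<Rightarrow> complex) set" where
  "sobolev_cont r = {f \<in> sobolev r. continuous_on UNIV f}"

lemma borel_measurable_weight [measurable]: "weight r \<in> borel_measurable borel"
  unfolding weight_def[abs_def] by measurable

lemma borel_measurable_weighted [measurable]:
  assumes [measurable]: "g \<in> borel_measurable borel"
  shows "weighted r g \<in> borel_measurable borel"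
  unfolding weighted_def[abs_def] by measurable

lemma one_plus_sq_ge_1: "1 + (\<xi>::real)\<^sup>2 \<ge> 1"
  by simp

lemma weight_pos [simp]: "weight r \<xi> > 0"
  using one_plus_sq_ge_1[of \<xi>] unfolding weight_def by (subst powr_gt_zero) linarith

lemma weight_nonneg [simp]: "weight r \<xi> \<ge> 0"
  by (simp add: weight_def)

lemma weight_neq_0 [simp]: "weight r \<xi> \<noteq> 0"
  using weight_pos[of r \<xi>] by linarith

lemma weight_0 [simp]: "weight 0 \<xi> = 1"
proof -
  have "1 + \<xi>\<^sup>2 \<noteq> 0"
    using one_plus_sq_ge_1[of \<xi>] by linarith
  then show ?thesis by (simp add: weight_def)
qed

lemma weight_add: "weight (r + q) \<xi> = weight r \<xi> * weight q \<xi>"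
  by (simp add: weight_def add_divide_distrib powr_add)

lemma weight_mono: "r \<le> q \<Longrightarrow> weight r \<xi> \<le> weight q \<xi>"
  unfolding weight_def using one_plus_sq_ge_1[of \<xi>] by (intro powr_mono) auto

lemma weight_2: "weight 2 \<xi> = 1 + \<xi>\<^sup>2"
  using one_plus_sq_ge_1[of \<xi>] by (simp add: weight_def)

lemma weight_1_sq: "(weight 1 \<xi>)\<^sup>2 = 1 + \<xi>\<^sup>2"
  using weight_add[of 1 1 \<xi>] by (simp add: weight_2 power2_eq_square)

lemma abs_le_weight_1: "\<bar>\<xi>\<bar> \<le> weight 1 \<xi>"
proof -
  have "\<bar>\<xi>\<bar>\<^sup>2 \<le> (weight 1 \<xi>)\<^sup>2"
    by (simp add: weight_1_sq)
  then show ?thesis by (rule power2_le_imp_le) simp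
qed

lemma sobolev_weight_eq: "sobolev_weight r f = weighted r (fourier f)"
  by (auto simp: sobolev_weight_def weighted_def weight_def)

lemma sobolev_norm_eq: "sobolev_norm r f = L2_norm (weighted r (fourier f))"
  by (simp add: sobolev_norm_def sobolev_weight_eq)

lemma sobolev_norm_nonneg [simp]: "sobolev_norm r f \<ge> 0"
  by (simp add: sobolev_norm_def)

lemma spectra_measurable: "g \<in> sobolev_spectra r \<Longrightarrow> g \<in> borel_measurable borel"
  by (simp add: sobolev_spectra_def)

lemma spectra_L2: "g \<in> sobolev_spectra r \<Longrightarrow> weighted r g \<in> square_integrable"
  by (simp add: sobolev_spectra_def)

text \<open>Fourier multipliers: differentiation, smoothing and the embeddings are all instances.\<close>

lemma spectra_mult:
  assumes g: "g \<in> sobolev_spectra r" and [measurable]: "m \<in> borel_measurable borel"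
    and m: "\<And>\<xi>. cmod (m \<xi>) * weight q \<xi> \<le> weight r \<xi>"
  shows "(\<lambda>\<xi>. m \<xi> * g \<xi>) \<in> sobolev_spectra q"
    and "L2_norm (weighted q (\<lambda>\<xi>. m \<xi> * g \<xi>)) \<le> L2_norm (weighted r g)"
proof -
  note [measurable] = spectra_measurable[OF g]
  have le: "AE \<xi> in lborel. cmod (weighted q (\<lambda>\<xi>. m \<xi> * g \<xi>) \<xi>) \<le> cmod (weighted r g \<xi>)"
  proof (intro AE_I2)
    fix \<xi>
    have "cmod (weighted q (\<lambda>\<xi>. m \<xi> * g \<xi>) \<xi>) = (cmod (m \<xi>) * weight q \<xi>) * cmod (g \<xi>)"
      by (simp add: weighted_def norm_mult)
    also have "\<dots> \<le> weight r \<xi> * cmod (g \<xi>)"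
      by (intro mult_right_mono m) simp
    finally show "cmod (weighted q (\<lambda>\<xi>. m \<xi> * g \<xi>) \<xi>) \<le> cmod (weighted r g \<xi>)"
      by (simp add: weighted_def norm_mult)
  qed
  have M: "(\<lambda>\<xi>. m \<xi> * g \<xi>) \<in> borel_measurable borel" by measurable
  note * = L2_norm_mono_AE[OF spectra_L2[OF g] borel_measurable_weighted[OF M] le]
  show "(\<lambda>\<xi>. m \<xi> * g \<xi>) \<in> sobolev_spectra q"
    using *(1) by (simp add: sobolev_spectra_def)
  show "L2_norm (weighted q (\<lambda>\<xi>. m \<xi> * g \<xi>)) \<le> L2_norm (weighted r g)"
    by (rule *(2))
qed

lemma spectra_mono:
  assumes g: "g \<in> sobolev_spectra r" and q: "q \<le> r"
  shows "g \<in> sobolev_spectra q" "L2_norm (weighted q g) \<le> L2_norm (weighted r g)"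
  using spectra_mult[OF g, of "\<lambda>_. 1" q] weight_mono[OF q] by simp_all

text \<open>A constant for the embedding of \<open>H\<^sup>1\<close> into the bounded continuous functions.\<close>

definition embedding_const :: real where
  "embedding_const = L2_norm (\<lambda>\<xi>. of_real (weight (-1) \<xi>))"

lemma embedding_const_nonneg [simp]: "embedding_const \<ge> 0"
  by (simp add: embedding_const_def)

text \<open>By the Cauchy--Schwarz inequality with the square integrable weight
  \<open>(1 + \<xi>\<^sup>2) powr (-1/2)\<close>, spectra of functions in the Sobolev space of order at least one
  are integrable.\<close>

lemma spectra_integrable:
  assumes g: "g \<in> sobolev_spectra r" and r: "r \<ge> 1"
  shows "integrable lborel g" "(LINT \<xi>|lborel. cmod (g \<xi>)) \<le> embedding_const * L2_norm (weighted r g)"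
    and "g \<in> square_integrable"
proof -
  have w: "(\<lambda>\<xi>. complex_of_real (weight (-1) \<xi>)) \<in> square_integrable"
  proof -
    have "(cmod (complex_of_real (weight (-1) \<xi>)))\<^sup>2 = inverse (1 + \<xi>\<^sup>2)" for \<xi>
    proof -
      have "(1 + \<xi>\<^sup>2) * (weight (-1) \<xi>)\<^sup>2 = 1"
        using weight_add[of 1 "-1" \<xi>] unfolding weight_1_sq[symmetric]
        by (simp add: power_mult_distrib[symmetric])
      then have "inverse (1 + \<xi>\<^sup>2) = (weight (-1) \<xi>)\<^sup>2"
        by (rule inverse_unique)
      then show ?thesis by simp
    qed
    then show ?thesis
      using integrable_inverse_1_plus_sq by (simp add: square_integrable_def)
  qed
  note g1 = spectra_mono[OF g r]
  have e: "of_real (weight (-1) \<xi>) * weighted 1 g \<xi> = g \<xi>" for \<xi>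
    using weight_add[of "-1" 1 \<xi>] unfolding weighted_def
    by (simp add: mult.assoc[symmetric] of_real_mult[symmetric] del: of_real_mult)
  note cs = Cauchy_Schwarz_L2[OF w spectra_L2[OF g1(1)], unfolded e]
  show "integrable lborel g" by (rule cs(1))
  have "embedding_const * L2_norm (weighted 1 g) \<le> embedding_const * L2_norm (weighted r g)"
    by (intro mult_left_mono g1) simp
  then show "(LINT \<xi>|lborel. cmod (g \<xi>)) \<le> embedding_const * L2_norm (weighted r g)"
    using cs(2) unfolding embedding_const_def by linarith
  have "weighted 0 g = g" by (auto simp: weighted_def)
  then show "g \<in> square_integrable"
    using spectra_L2[OF spectra_mono(1)[OF g, of 0]] r by simp
qed

lemma IFT_cong_AE:
  assumes [measurable]: "g \<in> borel_measurable borel" "h \<in> borel_measurable borel"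
    and eq: "AE \<xi> in lborel. g \<xi> = h \<xi>"
  shows "IFT g = IFT h"
  unfolding IFT_def[abs_def]
  by (intro ext arg_cong[of _ _ "\<lambda>z. z / of_real (2 * pi)"] integral_cong_AE) (use eq in auto)

lemma fourier_square_integrable:
  assumes "f \<in> square_integrable"
  shows "fourier f \<in> square_integrable"
  using is_fourier_transform_fourier[OF assms] by (simp add: is_fourier_transform_def)

lemma sobolev_cont_D:
  assumes "f \<in> sobolev_cont r"
  shows "f \<in> square_integrable" "fourier f \<in> sobolev_spectra r" "continuous_on UNIV f"
  using assms fourier_square_integrable[of f]
  by (auto simp: sobolev_cont_def sobolev_def sobolev_spectra_def sobolev_weight_eq dest: square_integrableD(1))

lemma sobolev_cont_inversion:
  assumes "f \<in> sobolev_cont r" "r \<ge> 1"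
  shows "IFT (fourier f) = f"
  using IFT_fourier[OF sobolev_cont_D(1,3)[OF assms(1)] is_fourier_transform_fourier]
    spectra_integrable(1)[OF sobolev_cont_D(2)[OF assms(1)] assms(2)] sobolev_cont_D(1)[OF assms(1)]
  by simp

lemma IFT_sobolev:
  assumes g: "g \<in> sobolev_spectra r" and r: "r \<ge> 1"
  shows "IFT g \<in> sobolev_cont r" "sobolev_norm r (IFT g) = L2_norm (weighted r g)"
    "AE \<xi> in lborel. fourier (IFT g) \<xi> = g \<xi>"
proof -
  note i = spectra_integrable[OF g r]
  note [measurable] = spectra_measurable[OF g]
  have S: "IFT g \<in> square_integrable"
    by (rule IFT_L2[OF i(1,3)])
  note [measurable] = square_integrableD(1)[OF fourier_square_integrable[OF S]]
  show ae: "AE \<xi> in lborel. fourier (IFT g) \<xi> = g \<xi>"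
    by (rule is_fourier_transform_unique[OF S is_fourier_transform_fourier[OF S] fourier_IFT[OF i(1,3)]])
  then have ae': "AE \<xi> in lborel. weighted r (fourier (IFT g)) \<xi> = weighted r g \<xi>"
    by eventually_elim (simp add: weighted_def)
  note * = L2_norm_cong_AE[OF spectra_L2[OF g] _ ae']
  show "sobolev_norm r (IFT g) = L2_norm (weighted r g)"
    using *(2) by (simp add: sobolev_norm_eq)
  show "IFT g \<in> sobolev_cont r"
    using S *(1) continuous_on_IFT[OF i(1)] by (simp add: sobolev_cont_def sobolev_def sobolev_weight_eq)
qed

lemma sobolev_cont_cases:
  assumes "f \<in> sobolev_cont r" "r \<ge> 1"
  obtains g where "g \<in> sobolev_spectra r" "f = IFT g" "sobolev_norm r f = L2_norm (weighted r g)"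
  using sobolev_cont_inversion[OF assms] sobolev_cont_D(2)[OF assms(1)]
  by (metis sobolev_norm_eq)

lemma IFT_add:
  assumes "integrable lborel g" "integrable lborel h"
  shows "IFT (\<lambda>\<xi>. g \<xi> + h \<xi>) x = IFT g x + IFT h x"
  unfolding IFT_def using integrable_cis_mult(2)[OF assms(1)] integrable_cis_mult(2)[OF assms(2)]
  by (simp add: distrib_left add_divide_distrib)

lemma IFT_cmult: "IFT (\<lambda>\<xi>. c * g \<xi>) x = c * IFT g x"
proof -
  have "(LINT \<xi>|lborel. cis (x * \<xi>) * (c * g \<xi>)) = (LINT \<xi>|lborel. c * (cis (x * \<xi>) * g \<xi>))"
    by (intro Bochner_Integration.integral_cong refl) (simp only: mult_ac)
  also have "\<dots> = c * (LINT \<xi>|lborel. cis (x * \<xi>) * g \<xi>)"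
    by (rule integral_mult_right_zero)
  finally show ?thesis by (simp add: IFT_def)
qed

lemma sobolev_cont_add:
  assumes "f \<in> sobolev_cont r" "h \<in> sobolev_cont r" and r: "r \<ge> 1"
  shows "(\<lambda>x. f x + h x) \<in> sobolev_cont r"
    and "sobolev_norm r (\<lambda>x. f x + h x) \<le> sobolev_norm r f + sobolev_norm r h"
proof -
  obtain g where g: "g \<in> sobolev_spectra r" "f = IFT g" "sobolev_norm r f = L2_norm (weighted r g)"
    using assms(1) r by (rule sobolev_cont_cases)
  obtain k where k: "k \<in> sobolev_spectra r" "h = IFT k" "sobolev_norm r h = L2_norm (weighted r k)"
    using assms(2) r by (rule sobolev_cont_cases)
  let ?m = "\<lambda>\<xi>. g \<xi> + k \<xi>"
  have w: "weighted r ?m = (\<lambda>\<xi>. weighted r g \<xi> + weighted r k \<xi>)"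
    by (auto simp: weighted_def distrib_left)
  note L = L2_add[OF spectra_L2[OF g(1)] spectra_L2[OF k(1)]]
  have m: "?m \<in> sobolev_spectra r"
    using L(1) spectra_measurable[OF g(1)] spectra_measurable[OF k(1)] by (simp add: sobolev_spectra_def w)
  have e: "(\<lambda>x. f x + h x) = IFT ?m"
    using IFT_add[OF spectra_integrable(1)[OF g(1) r] spectra_integrable(1)[OF k(1) r]] g k by auto
  show "(\<lambda>x. f x + h x) \<in> sobolev_cont r" "sobolev_norm r (\<lambda>x. f x + h x) \<le> sobolev_norm r f + sobolev_norm r h"
    unfolding e g(3) k(3) using IFT_sobolev[OF m r] L(2) by (simp_all add: w)
qed

lemma sobolev_cont_cmult:
  assumes "f \<in> sobolev_cont r" and r: "r \<ge> 1"
  shows "(\<lambda>x. c * f x) \<in> sobolev_cont r"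
    and "sobolev_norm r (\<lambda>x. c * f x) = cmod c * sobolev_norm r f"
proof -
  obtain g where g: "g \<in> sobolev_spectra r" "f = IFT g" "sobolev_norm r f = L2_norm (weighted r g)"
    using assms(1) r by (rule sobolev_cont_cases)
  let ?m = "\<lambda>\<xi>. c * g \<xi>"
  have w: "weighted r ?m = (\<lambda>\<xi>. c * weighted r g \<xi>)"
    by (auto simp: weighted_def)
  note L = L2_cmult[OF spectra_L2[OF g(1)], of c]
  have m: "?m \<in> sobolev_spectra r"
    using L(1) spectra_measurable[OF g(1)] by (simp add: sobolev_spectra_def w)
  have e: "(\<lambda>x. c * f x) = IFT ?m"
    unfolding g(2) by (auto simp: IFT_cmult)
  show "(\<lambda>x. c * f x) \<in> sobolev_cont r" "sobolev_norm r (\<lambda>x. c * f x) = cmod c * sobolev_norm r f"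
    unfolding e g(3) using IFT_sobolev[OF m r] L(2) by (simp_all add: w)
qed

lemma sobolev_cont_mono:
  assumes "f \<in> sobolev_cont r" "1 \<le> q" "q \<le> r"
  shows "f \<in> sobolev_cont q" "sobolev_norm q f \<le> sobolev_norm r f"
proof -
  have "1 \<le> r" using assms by simp
  with assms(1) obtain g where g: "g \<in> sobolev_spectra r" "f = IFT g" "sobolev_norm r f = L2_norm (weighted r g)"
    by (rule sobolev_cont_cases)
  show "f \<in> sobolev_cont q" "sobolev_norm q f \<le> sobolev_norm r f"
    unfolding g(3) unfolding g(2)
    using IFT_sobolev[OF spectra_mono(1)[OF g(1) assms(3)] assms(2)] spectra_mono(2)[OF g(1) assms(3)] by auto
qed

lemma sobolev_sup_bound:
  assumes "f \<in> sobolev_cont r" and r: "r \<ge> 1"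
  shows "cmod (f x) \<le> embedding_const * sobolev_norm r f"
proof -
  obtain g where g: "g \<in> sobolev_spectra r" "f = IFT g" "sobolev_norm r f = L2_norm (weighted r g)"
    using assms by (rule sobolev_cont_cases)
  have "cmod (f x) = cmod (LINT \<xi>|lborel. cis (x * \<xi>) * g \<xi>) / (2 * pi)"
    by (simp add: g(2) IFT_def norm_divide)
  also have "\<dots> \<le> (LINT \<xi>|lborel. cmod (cis (x * \<xi>) * g \<xi>)) / (2 * pi)"
    by (intro divide_right_mono integral_norm_bound) simp
  also have "\<dots> \<le> (LINT \<xi>|lborel. cmod (cis (x * \<xi>) * g \<xi>)) / 1"
    using pi_gt3 by (intro divide_left_mono Bochner_Integration.integral_nonneg) auto
  also have "\<dots> \<le> embedding_const * L2_norm (weighted r g)"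
    using spectra_integrable(2)[OF g(1) r] by (simp add: norm_mult)
  finally show ?thesis by (simp add: g(3))
qed

text \<open>The spectra are summed by completeness of \<open>L\<^sup>2\<close>; since their \<open>L\<^sup>1\<close> norms are summable as well,
  the inverse transform passes through the sum.\<close>

lemma sobolev_suminf:
  assumes f: "\<And>n. f n \<in> sobolev_cont r" and r: "r \<ge> 1" and sm: "summable (\<lambda>n. sobolev_norm r (f n))"
  shows "(\<lambda>x. \<Sum>n. f n x) \<in> sobolev_cont r"
    and "sobolev_norm r (\<lambda>x. \<Sum>n. f n x) \<le> (\<Sum>n. sobolev_norm r (f n))"
proof -
  define g where "g n = fourier (f n)" for n
  have g: "g n \<in> sobolev_spectra r" "f n = IFT (g n)" "L2_norm (weighted r (g n)) = sobolev_norm r (f n)" for n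
    using sobolev_cont_D(2)[OF f] sobolev_cont_inversion[OF f r] by (auto simp: g_def sobolev_norm_eq)
  note [measurable] = spectra_measurable[OF g(1)]
  have sm': "summable (\<lambda>n. L2_norm (weighted r (g n)))"
    using sm by (simp add: g(3))
  note L = L2_suminf[OF spectra_L2[OF g(1)] sm']
  define G where "G \<xi> = (\<Sum>n. g n \<xi>)" for \<xi>
  have [measurable]: "G \<in> borel_measurable borel"
    unfolding G_def by measurable
  have ae1: "AE \<xi> in lborel. summable (\<lambda>n. cmod (g n \<xi>))"
    using L(1)
  proof eventually_elim
    case (elim \<xi>)
    then have "summable (\<lambda>n. inverse (weight r \<xi>) * cmod (weighted r (g n) \<xi>))"
      by (rule summable_mult)
    then show ?case by (simp add: weighted_def norm_mult)
  qed
  have ae: "AE \<xi> in lborel. weighted r G \<xi> = (\<Sum>n. weighted r (g n) \<xi>)"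
    using ae1
  proof eventually_elim
    case (elim \<xi>)
    then have "summable (\<lambda>n. g n \<xi>)"
      by (rule summable_norm_cancel)
    then show ?case
      unfolding weighted_def G_def by (rule suminf_mult[symmetric])
  qed
  note W = L2_norm_cong_AE[OF L(2) borel_measurable_weighted ae]
  have G: "G \<in> sobolev_spectra r"
    using W(1) by (simp add: sobolev_spectra_def)
  have "(\<lambda>x. \<Sum>n. f n x) = IFT G"
  proof
    fix x
    have i: "integrable lborel (\<lambda>\<xi>. cis (x * \<xi>) * g n \<xi>)" for n
      by (intro integrable_cis_mult spectra_integrable(1)[OF g(1) r])
    have "(\<lambda>n. LINT \<xi>|lborel. cis (x * \<xi>) * g n \<xi>) sums (LINT \<xi>|lborel. (\<Sum>n. cis (x * \<xi>) * g n \<xi>))"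
    proof (rule sums_integral[OF i])
      show "AE \<xi> in lborel. summable (\<lambda>n. norm (cis (x * \<xi>) * g n \<xi>))"
        using ae1 by (simp add: norm_mult)
      show "summable (\<lambda>n. LINT \<xi>|lborel. norm (cis (x * \<xi>) * g n \<xi>))"
      proof (rule summable_comparison_test'[of "\<lambda>n. embedding_const * sobolev_norm r (f n)" 0])
        show "summable (\<lambda>n. embedding_const * sobolev_norm r (f n))"
          using sm by (rule summable_mult)
        show "norm (LINT \<xi>|lborel. norm (cis (x * \<xi>) * g n \<xi>)) \<le> embedding_const * sobolev_norm r (f n)" for n
          using spectra_integrable(2)[OF g(1)[of n] r] by (simp add: norm_mult g(3))
      qed
    qed
    also have "(LINT \<xi>|lborel. (\<Sum>n. cis (x * \<xi>) * g n \<xi>)) = (LINT \<xi>|lborel. cis (x * \<xi>) * G \<xi>)"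
    proof (rule integral_cong_AE)
      show "AE \<xi> in lborel. (\<Sum>n. cis (x * \<xi>) * g n \<xi>) = cis (x * \<xi>) * G \<xi>"
        using ae1 by eventually_elim (auto simp: G_def intro!: suminf_mult dest: summable_norm_cancel)
    qed measurable
    finally have "(\<lambda>n. (LINT \<xi>|lborel. cis (x * \<xi>) * g n \<xi>) / of_real (2 * pi)) sums ((LINT \<xi>|lborel. cis (x * \<xi>) * G \<xi>) / of_real (2 * pi))"
      by (rule sums_divide)
    then have "(\<lambda>n. f n x) sums IFT G x"
      by (simp add: g(2) IFT_def)
    then show "(\<Sum>n. f n x) = IFT G x"
      by (rule sums_unique[symmetric])
  qed
  then show "(\<lambda>x. \<Sum>n. f n x) \<in> sobolev_cont r" "sobolev_norm r (\<lambda>x. \<Sum>n. f n x) \<le> (\<Sum>n. sobolev_norm r (f n))"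
    using IFT_sobolev[OF G r] W(2) L(3) by (simp_all add: g(3))
qed

text \<open>Differentiation under the integral sign. The difference quotient of \<open>cis (x * \<xi>)\<close> minus its
  derivative is bounded by \<open>2 * \<bar>\<xi>\<bar>\<close> and tends to zero.\<close>

lemma IFT_has_vector_derivative:
  assumes g: "g \<in> sobolev_spectra r" and r: "r \<ge> 2"
  shows "(IFT g has_vector_derivative IFT (\<lambda>\<xi>. \<i> * of_real \<xi> * g \<xi>) x) (at x)"
    and "(\<lambda>\<xi>. \<i> * of_real \<xi> * g \<xi>) \<in> sobolev_spectra (r - 1)"
    and "L2_norm (weighted (r - 1) (\<lambda>\<xi>. \<i> * of_real \<xi> * g \<xi>)) \<le> L2_norm (weighted r g)"
proof -
  note [measurable] = spectra_measurable[OF g]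
  let ?d = "\<lambda>\<xi>. \<i> * of_real \<xi> * g \<xi>"
  have m: "cmod (\<i> * of_real \<xi>) * weight (r - 1) \<xi> \<le> weight r \<xi>" for \<xi>
    using weight_add[of 1 "r - 1" \<xi>] abs_le_weight_1[of \<xi>]
    by (simp add: norm_mult mult_right_mono)
  note d = spectra_mult[OF g _ m]
  show d1: "?d \<in> sobolev_spectra (r - 1)"
    by (rule d(1)) measurable
  show "L2_norm (weighted (r - 1) ?d) \<le> L2_norm (weighted r g)"
    by (rule d(2)) measurable
  have ig: "integrable lborel g"
    using spectra_integrable(1)[OF g] r by simp
  have idd: "integrable lborel ?d"
    using spectra_integrable(1)[OF d1] r by simp
  have "((\<lambda>h. norm (IFT g (x + h) - IFT g x - h *\<^sub>R IFT ?d x) / norm h) \<longlongrightarrow> 0) (at 0)"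
    unfolding tendsto_at_iff_sequentially comp_def
  proof safe
    fix h :: "nat \<Rightarrow> real" assume h0: "\<forall>i. h i \<in> UNIV - {0}" and h: "h \<longlonglongrightarrow> 0"
    let ?e = "\<lambda>n \<xi>. (cis ((x + h n) * \<xi>) - cis (x * \<xi>) - of_real (h n) * (\<i> * of_real \<xi>) * cis (x * \<xi>)) / of_real (h n) * g \<xi>"
    have eq: "norm (IFT g (x + h n) - IFT g x - h n *\<^sub>R IFT ?d x) / norm (h n) = norm ((LINT \<xi>|lborel. ?e n \<xi>) / of_real (2 * pi))" for n
    proof -
      have "(LINT \<xi>|lborel. ?e n \<xi>) = (LINT \<xi>|lborel. (cis ((x + h n) * \<xi>) * g \<xi> - cis (x * \<xi>) * g \<xi> - of_real (h n) * (cis (x * \<xi>) * ?d \<xi>)) / of_real (h n))"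
        by (intro Bochner_Integration.integral_cong refl) (simp add: field_simps)
      also have "\<dots> = ((LINT \<xi>|lborel. cis ((x + h n) * \<xi>) * g \<xi>) - (LINT \<xi>|lborel. cis (x * \<xi>) * g \<xi>) - of_real (h n) * (LINT \<xi>|lborel. cis (x * \<xi>) * ?d \<xi>)) / of_real (h n)"
        using integrable_cis_mult(2)[OF ig, of "x + h n"] integrable_cis_mult(2)[OF ig, of x] integrable_cis_mult(2)[OF idd, of x]
        by (subst integral_divide_zero, subst Bochner_Integration.integral_diff) auto
      also have "\<dots> / of_real (2 * pi) = (IFT g (x + h n) - IFT g x - h n *\<^sub>R IFT ?d x) / of_real (h n)"
        by (simp add: IFT_def scaleR_conv_of_real diff_divide_distrib mult_ac)
      finally show ?thesis
        by (simp add: norm_divide)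
    qed
    have b: "cmod ((cis ((x + t) * \<xi>) - cis (x * \<xi>) - of_real t * (\<i> * of_real \<xi>) * cis (x * \<xi>)) / of_real t) \<le> min (2 * \<bar>\<xi>\<bar>) (\<bar>t\<bar> * \<xi>\<^sup>2 / 2)"
      if t: "t \<noteq> 0" for t \<xi>
    proof -
      have c: "cis ((x + t) * \<xi>) = cis (x * \<xi>) * cis (t * \<xi>)"
        by (simp only: distrib_right cis_mult)
      have s: "(\<Sum>k \<le> 1. (\<i> * complex_of_real (t * \<xi>))^k / fact k) = 1 + \<i> * of_real (t * \<xi>)"
        by simp
      have "cis ((x + t) * \<xi>) - cis (x * \<xi>) - of_real t * (\<i> * of_real \<xi>) * cis (x * \<xi>) = cis (x * \<xi>) * (iexp (t * \<xi>) - (\<Sum>k \<le> 1. (\<i> * complex_of_real (t * \<xi>))^k / fact k))"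
        unfolding s c cis_eq_iexp[of "t * \<xi>", symmetric] by (simp add: algebra_simps)
      then have e: "cmod ((cis ((x + t) * \<xi>) - cis (x * \<xi>) - of_real t * (\<i> * of_real \<xi>) * cis (x * \<xi>)) / of_real t) =
          cmod (iexp (t * \<xi>) - (\<Sum>k \<le> 1. (\<i> * complex_of_real (t * \<xi>))^k / fact k)) / \<bar>t\<bar>"
        by (simp only: norm_divide norm_mult norm_cis norm_of_real mult_1)
      have 1: "cmod (iexp (t * \<xi>) - (\<Sum>k \<le> 1. (\<i> * complex_of_real (t * \<xi>))^k / fact k)) \<le> (\<bar>t\<bar> * \<bar>\<xi>\<bar>)\<^sup>2 / 2"
        using iexp_approx1[of "t * \<xi>" 1] by (simp add: abs_mult numeral_2_eq_2)
      have 2: "cmod (iexp (t * \<xi>) - (\<Sum>k \<le> 1. (\<i> * complex_of_real (t * \<xi>))^k / fact k)) \<le> 2 * (\<bar>t\<bar> * \<bar>\<xi>\<bar>)"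
        using iexp_approx2[of "t * \<xi>" 1] by (simp add: abs_mult)
      have "(\<bar>t\<bar> * \<bar>\<xi>\<bar>)\<^sup>2 = \<bar>t\<bar> * (\<bar>t\<bar> * \<xi>\<^sup>2)"
        by (simp only: power_mult_distrib power2_abs) (simp add: power2_eq_square mult.assoc[symmetric])
      then have q: "(\<bar>t\<bar> * \<bar>\<xi>\<bar>)\<^sup>2 / 2 / \<bar>t\<bar> = \<bar>t\<bar> * \<xi>\<^sup>2 / 2" "2 * (\<bar>t\<bar> * \<bar>\<xi>\<bar>) / \<bar>t\<bar> = 2 * \<bar>\<xi>\<bar>"
        using t by simp_all
      show ?thesis
        unfolding e using divide_right_mono[OF 1, of "\<bar>t\<bar>"] divide_right_mono[OF 2, of "\<bar>t\<bar>"]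
        unfolding q by (intro min.boundedI) auto
    qed
    have "(\<lambda>n. LINT \<xi>|lborel. ?e n \<xi>) \<longlonglongrightarrow> (LINT \<xi>::real|lborel. (0::complex))"
    proof (rule integral_dominated_convergence[where w="\<lambda>\<xi>. 2 * cmod (?d \<xi>)"])
      show "AE \<xi> in lborel. (\<lambda>n. ?e n \<xi>) \<longlonglongrightarrow> 0"
      proof (rule AE_I2, rule tendsto_norm_zero_cancel)
        fix \<xi> :: real
        have "(\<lambda>n. \<bar>h n\<bar> * \<xi>\<^sup>2 / 2 * cmod (g \<xi>)) \<longlonglongrightarrow> \<bar>0\<bar> * \<xi>\<^sup>2 / 2 * cmod (g \<xi>)"
          by (intro tendsto_intros h) simp
        then have lim: "(\<lambda>n. \<bar>h n\<bar> * \<xi>\<^sup>2 / 2 * cmod (g \<xi>)) \<longlonglongrightarrow> 0"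
          by simp
        have "norm (cmod (?e n \<xi>)) \<le> \<bar>h n\<bar> * \<xi>\<^sup>2 / 2 * cmod (g \<xi>)" for n
        proof -
          have "cmod (?e n \<xi>) \<le> \<bar>h n\<bar> * \<xi>\<^sup>2 / 2 * cmod (g \<xi>)"
            unfolding norm_mult[of _ "g \<xi>"] using b[of "h n" \<xi>] h0 by (intro mult_right_mono) auto
          then show ?thesis by simp
        qed
        then show "(\<lambda>n. cmod (?e n \<xi>)) \<longlonglongrightarrow> 0"
          by (intro Lim_null_comparison[OF _ lim] always_eventually allI)
      qed
      show "AE \<xi> in lborel. norm (?e n \<xi>) \<le> 2 * cmod (?d \<xi>)" for n
      proof (intro AE_I2)
        fix \<xi>
        have "norm (?e n \<xi>) \<le> (2 * \<bar>\<xi>\<bar>) * cmod (g \<xi>)"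
          unfolding norm_mult[of _ "g \<xi>"] using b[of "h n" \<xi>] h0 by (intro mult_right_mono) auto
        then show "norm (?e n \<xi>) \<le> 2 * cmod (?d \<xi>)"
          by (simp add: norm_mult)
      qed
      show "integrable lborel (\<lambda>\<xi>. 2 * cmod (?d \<xi>))"
        using idd by (intro integrable_mult_right integrable_norm)
    qed measurable
    then have "(\<lambda>n. norm ((LINT \<xi>|lborel. ?e n \<xi>) / of_real (2 * pi))) \<longlonglongrightarrow> norm ((LINT \<xi>::real|lborel. (0::complex)) / of_real (2 * pi))"
      by (intro tendsto_norm tendsto_divide tendsto_const) simp_all
    then show "(\<lambda>n. norm (IFT g (x + h n) - IFT g x - h n *\<^sub>R IFT ?d x) / norm (h n)) \<longlonglongrightarrow> 0"
      unfolding eq by simp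
  qed
  then show "(IFT g has_vector_derivative IFT ?d x) (at x)"
    unfolding has_vector_derivative_def has_derivative_at by (simp add: bounded_linear_scaleR_left)
qed

lemma sobolev_cont_Dx:
  assumes "f \<in> sobolev_cont r" and r: "r \<ge> 2"
  shows "(f has_vector_derivative Dx f x) (at x)" "Dx f \<in> sobolev_cont (r - 1)"
    and "sobolev_norm (r - 1) (Dx f) \<le> sobolev_norm r f"
proof -
  have r': "r \<ge> 1" "r - 1 \<ge> 1" using r by auto
  obtain g where g: "g \<in> sobolev_spectra r" "f = IFT g" "sobolev_norm r f = L2_norm (weighted r g)"
    using assms(1) r'(1) by (rule sobolev_cont_cases)
  note d = IFT_has_vector_derivative[OF g(1) r]
  have D: "Dx f = IFT (\<lambda>\<xi>. \<i> * of_real \<xi> * g \<xi>)"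
    unfolding Dx_def g(2) using vector_derivative_at[OF d(1)] by auto
  show "(f has_vector_derivative Dx f x) (at x)" "Dx f \<in> sobolev_cont (r - 1)"
    "sobolev_norm (r - 1) (Dx f) \<le> sobolev_norm r f"
    unfolding D g(3) using d IFT_sobolev[OF d(2) r'(2)] by (auto simp: g(2))
qed

text \<open>The operator \<open>(1 - d\<^sup>2/dx\<^sup>2)\<^sup>-\<^sup>1 d/dx\<close> as a Fourier multiplier.\<close>

definition smoothing_symbol :: "real \<Rightarrow> complex" where
  "smoothing_symbol \<xi> = \<i> * of_real \<xi> / of_real (1 + \<xi>\<^sup>2)"

definition smoothing :: "(real \<Rightarrow> complex) \<Rightarrow> real \<Rightarrow> complex" where
  "smoothing f = IFT (\<lambda>\<xi>. smoothing_symbol \<xi> * fourier f \<xi>)"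

lemma borel_measurable_smoothing_symbol [measurable]: "smoothing_symbol \<in> borel_measurable borel"
  unfolding smoothing_symbol_def[abs_def] by measurable

lemma smoothing_symbol_le: "cmod (smoothing_symbol \<xi>) * weight (r + 1) \<xi> \<le> weight r \<xi>"
proof -
  have "cmod (smoothing_symbol \<xi>) = \<bar>\<xi>\<bar> / (1 + \<xi>\<^sup>2)"
    unfolding smoothing_symbol_def norm_divide norm_mult norm_of_real by simp
  then have "cmod (smoothing_symbol \<xi>) * (1 + \<xi>\<^sup>2) = \<bar>\<xi>\<bar>"
    using one_plus_sq_ge_1[of \<xi>] by (metis nonzero_eq_divide_eq not_one_le_zero)
  moreover have "weight 1 \<xi> * weight 1 \<xi> = 1 + \<xi>\<^sup>2"
    using weight_1_sq[of \<xi>] by (simp add: power2_eq_square)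
  ultimately have "cmod (smoothing_symbol \<xi>) * (weight 1 \<xi> * weight 1 \<xi>) = \<bar>\<xi>\<bar>"
    by simp
  then have "cmod (smoothing_symbol \<xi>) * weight 1 \<xi> * weight 1 \<xi> \<le> 1 * weight 1 \<xi>"
    using abs_le_weight_1[of \<xi>] by (simp add: mult.assoc)
  then have "cmod (smoothing_symbol \<xi>) * weight 1 \<xi> \<le> 1"
    by (rule mult_right_le_imp_le) simp
  then have "cmod (smoothing_symbol \<xi>) * weight 1 \<xi> * weight r \<xi> \<le> 1 * weight r \<xi>"
    by (rule mult_right_mono) simp
  then show ?thesis by (simp add: weight_add mult_ac)
qed

lemma smoothing_IFT:
  assumes g: "g \<in> sobolev_spectra r" and r: "r \<ge> 1"
  shows "smoothing (IFT g) = IFT (\<lambda>\<xi>. smoothing_symbol \<xi> * g \<xi>)"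
proof -
  note I = IFT_sobolev[OF g r]
  note [measurable] = spectra_measurable[OF g] spectra_measurable[OF sobolev_cont_D(2)[OF I(1)]]
  show ?thesis
    unfolding smoothing_def by (rule IFT_cong_AE) (use I(3) in auto)
qed

lemma smoothing_sobolev:
  assumes "f \<in> sobolev_cont r" and r: "r \<ge> 1"
  shows "smoothing f \<in> sobolev_cont (r + 1)" "sobolev_norm (r + 1) (smoothing f) \<le> sobolev_norm r f"
proof -
  obtain g where g: "g \<in> sobolev_spectra r" "f = IFT g" "sobolev_norm r f = L2_norm (weighted r g)"
    using assms by (rule sobolev_cont_cases)
  note m = spectra_mult[OF g(1) borel_measurable_smoothing_symbol smoothing_symbol_le]
  show "smoothing f \<in> sobolev_cont (r + 1)" "sobolev_norm (r + 1) (smoothing f) \<le> sobolev_norm r f"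
    unfolding g(3) unfolding g(2) smoothing_IFT[OF g(1) r]
    using IFT_sobolev[OF m(1)] m(2) r by simp_all
qed

lemma Dx_IFT:
  assumes "g \<in> sobolev_spectra r" and "r \<ge> 2"
  shows "Dx (IFT g) = IFT (\<lambda>\<xi>. \<i> * of_real \<xi> * g \<xi>)"
  unfolding Dx_def using vector_derivative_at[OF IFT_has_vector_derivative(1)[OF assms]] by auto

lemma Dx_smoothing:
  assumes "f \<in> sobolev_cont r" and r: "r \<ge> 2"
  shows "Dx (smoothing f) = smoothing (Dx f)"
proof -
  have r': "r \<ge> 1" using r by simp
  obtain g where g: "g \<in> sobolev_spectra r" "f = IFT g" "sobolev_norm r f = L2_norm (weighted r g)"
    using assms(1) r' by (rule sobolev_cont_cases)
  note m = spectra_mult[OF g(1) borel_measurable_smoothing_symbol smoothing_symbol_le]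
  note d = IFT_has_vector_derivative[OF g(1) r]
  have "Dx (smoothing f) = IFT (\<lambda>\<xi>. \<i> * of_real \<xi> * (smoothing_symbol \<xi> * g \<xi>))"
    unfolding g(2) smoothing_IFT[OF g(1) r'] by (rule Dx_IFT[OF m(1)]) (use r in simp)
  also have "\<dots> = IFT (\<lambda>\<xi>. smoothing_symbol \<xi> * (\<i> * of_real \<xi> * g \<xi>))"
    by (simp only: mult_ac)
  also have "\<dots> = smoothing (Dx f)"
    unfolding g(2) Dx_IFT[OF g(1) r] using r by (intro smoothing_IFT[symmetric, OF d(2)]) simp
  finally show ?thesis .
qed

text \<open>The symbols satisfy \<open>(1 + \<xi>\<^sup>2) * smoothing_symbol \<xi> = \<i> * \<xi>\<close>.\<close>

lemma smoothing_helmholtz: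
  assumes "f \<in> sobolev_cont r" and r: "r \<ge> 2"
  shows "smoothing f x - Dx (Dx (smoothing f)) x = Dx f x"
proof -
  have r': "r \<ge> 1" using r by simp
  obtain g where g: "g \<in> sobolev_spectra r" "f = IFT g" "sobolev_norm r f = L2_norm (weighted r g)"
    using assms(1) r' by (rule sobolev_cont_cases)
  let ?g0 = "\<lambda>\<xi>. smoothing_symbol \<xi> * g \<xi>"
  let ?g1 = "\<lambda>\<xi>. \<i> * of_real \<xi> * ?g0 \<xi>"
  let ?g2 = "\<lambda>\<xi>. \<i> * of_real \<xi> * ?g1 \<xi>"
  have s0: "?g0 \<in> sobolev_spectra (r + 1)"
    by (rule spectra_mult[OF g(1) borel_measurable_smoothing_symbol smoothing_symbol_le])
  have r1: "r + 1 \<ge> 2" "r + 1 - 1 \<ge> 2" using r by auto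
  note d0 = IFT_has_vector_derivative[OF s0 r1(1)]
  note d1 = IFT_has_vector_derivative[OF d0(2) r1(2)]
  have i0: "integrable lborel ?g0" and i2: "integrable lborel ?g2"
    using spectra_integrable(1)[OF s0] spectra_integrable(1)[OF d1(2)] r by auto
  have D2: "Dx (Dx (smoothing f)) = IFT ?g2"
    unfolding g(2) smoothing_IFT[OF g(1) r'] Dx_IFT[OF s0 r1(1)] Dx_IFT[OF d0(2) r1(2)] ..
  have eq: "\<i> * of_real \<xi> * g \<xi> + ?g2 \<xi> = ?g0 \<xi>" for \<xi>
  proof -
    have "1 + (of_real \<xi>)\<^sup>2 \<noteq> (0::complex)"
    proof -
      have "complex_of_real (1 + \<xi>\<^sup>2) \<noteq> 0"
        using one_plus_sq_ge_1[of \<xi>] by (subst of_real_eq_0_iff) linarith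
      then show ?thesis by simp
    qed
    then show ?thesis
      unfolding smoothing_symbol_def by (simp add: field_simps power2_eq_square)
  qed
  have id: "integrable lborel (\<lambda>\<xi>. \<i> * of_real \<xi> * g \<xi>)"
    using spectra_integrable(1)[OF IFT_has_vector_derivative(2)[OF g(1) r]] r by simp
  have "Dx f x + IFT ?g2 x = smoothing f x"
    unfolding g(2) smoothing_IFT[OF g(1) r'] Dx_IFT[OF g(1) r]
    by (subst IFT_add[OF id i2, symmetric]) (simp only: eq)
  then show ?thesis
    unfolding D2 by (simp add: algebra_simps)
qed

text \<open>Young's inequality: the Cauchy--Schwarz inequality with respect to the measure with density
  \<open>cmod (q \<eta>)\<close>, followed by an exchange of the integrations.\<close>

lemma Young_L2_L1:
  assumes p: "p \<in> square_integrable" and q: "integrable lborel q"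
  shows "(\<integral>\<^sup>+\<xi>. (\<integral>\<^sup>+\<eta>. ennreal (cmod (p (\<xi> - \<eta>)) * cmod (q \<eta>)) \<partial>lborel)\<^sup>2 \<partial>lborel)
     \<le> ennreal ((L2_norm p * (LINT \<eta>|lborel. cmod (q \<eta>)))\<^sup>2)"
proof -
  note [measurable] = square_integrableD(1)[OF p] borel_measurable_integrable[OF q]
  let ?Q = "LINT \<eta>|lborel. cmod (q \<eta>)"
  have Q: "(\<integral>\<^sup>+\<eta>. ennreal (cmod (q \<eta>)) \<partial>lborel) = ennreal ?Q"
    using q by (intro nn_integral_eq_integral) auto
  have "(\<integral>\<^sup>+\<eta>. ennreal (cmod (p (\<xi> - \<eta>)) * cmod (q \<eta>)) \<partial>lborel)\<^sup>2
      \<le> (\<integral>\<^sup>+\<eta>. ennreal ((cmod (p (\<xi> - \<eta>)))\<^sup>2) * ennreal (cmod (q \<eta>)) \<partial>lborel) * ennreal ?Q" for \<xi>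
  proof -
    have "(\<integral>\<^sup>+\<eta>. ennreal (cmod (p (\<xi> - \<eta>)) * cmod (q \<eta>)) \<partial>lborel) =
      (\<integral>\<^sup>+\<eta>. ennreal (cmod (p (\<xi> - \<eta>)) * sqrt (cmod (q \<eta>))) * ennreal (sqrt (cmod (q \<eta>))) \<partial>lborel)"
      by (intro nn_integral_cong) (simp add: ennreal_mult[symmetric] mult.assoc)
    also have "\<dots>\<^sup>2 \<le> (\<integral>\<^sup>+\<eta>. (ennreal (cmod (p (\<xi> - \<eta>)) * sqrt (cmod (q \<eta>))))\<^sup>2 \<partial>lborel) * (\<integral>\<^sup>+\<eta>. (ennreal (sqrt (cmod (q \<eta>))))\<^sup>2 \<partial>lborel)"
      by (rule Cauchy_Schwarz_nn_integral) measurable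
    also have "(\<integral>\<^sup>+\<eta>. (ennreal (sqrt (cmod (q \<eta>))))\<^sup>2 \<partial>lborel) = ennreal ?Q"
      unfolding Q[symmetric] by (intro nn_integral_cong) (simp add: ennreal_power)
    also have "(\<integral>\<^sup>+\<eta>. (ennreal (cmod (p (\<xi> - \<eta>)) * sqrt (cmod (q \<eta>))))\<^sup>2 \<partial>lborel) = (\<integral>\<^sup>+\<eta>. ennreal ((cmod (p (\<xi> - \<eta>)))\<^sup>2) * ennreal (cmod (q \<eta>)) \<partial>lborel)"
      by (intro nn_integral_cong) (simp add: ennreal_power ennreal_mult[symmetric] power_mult_distrib)
    finally show ?thesis .
  qed
  then have "(\<integral>\<^sup>+\<xi>. (\<integral>\<^sup>+\<eta>. ennreal (cmod (p (\<xi> - \<eta>)) * cmod (q \<eta>)) \<partial>lborel)\<^sup>2 \<partial>lborel) \<le>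
     (\<integral>\<^sup>+\<xi>. (\<integral>\<^sup>+\<eta>. ennreal ((cmod (p (\<xi> - \<eta>)))\<^sup>2) * ennreal (cmod (q \<eta>)) \<partial>lborel) * ennreal ?Q \<partial>lborel)"
    by (intro nn_integral_mono)
  also have "\<dots> = (\<integral>\<^sup>+\<xi>. \<integral>\<^sup>+\<eta>. ennreal ((cmod (p (\<xi> - \<eta>)))\<^sup>2) * ennreal (cmod (q \<eta>)) \<partial>lborel \<partial>lborel) * ennreal ?Q"
    by (rule nn_integral_multc) measurable
  also have "(\<integral>\<^sup>+\<xi>. \<integral>\<^sup>+\<eta>. ennreal ((cmod (p (\<xi> - \<eta>)))\<^sup>2) * ennreal (cmod (q \<eta>)) \<partial>lborel \<partial>lborel) =
     (\<integral>\<^sup>+\<eta>. \<integral>\<^sup>+\<xi>. ennreal ((cmod (p (\<xi> - \<eta>)))\<^sup>2) * ennreal (cmod (q \<eta>)) \<partial>lborel \<partial>lborel)"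
    by (rule lborel_pair.Fubini') measurable
  also have "\<dots> = (\<integral>\<^sup>+\<eta>. ennreal ((L2_norm p)\<^sup>2) * ennreal (cmod (q \<eta>)) \<partial>lborel)"
  proof (intro nn_integral_cong)
    fix \<eta> :: real
    have "(\<integral>\<^sup>+\<xi>. ennreal ((cmod (p (\<xi> - \<eta>)))\<^sup>2) * ennreal (cmod (q \<eta>)) \<partial>lborel) = (\<integral>\<^sup>+\<xi>. ennreal ((cmod (p (\<xi> - \<eta>)))\<^sup>2) \<partial>lborel) * ennreal (cmod (q \<eta>))"
      by (rule nn_integral_multc) measurable
    also have "(\<integral>\<^sup>+\<xi>. ennreal ((cmod (p (\<xi> - \<eta>)))\<^sup>2) \<partial>lborel) = ennreal ((L2_norm p)\<^sup>2)"
      using nn_integral_real_affine[of "\<lambda>z. ennreal ((cmod (p z))\<^sup>2)" 1 "-\<eta>"] square_integrableD(2)[OF p] by simp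
    finally show "(\<integral>\<^sup>+\<xi>. ennreal ((cmod (p (\<xi> - \<eta>)))\<^sup>2) * ennreal (cmod (q \<eta>)) \<partial>lborel) = ennreal ((L2_norm p)\<^sup>2) * ennreal (cmod (q \<eta>))" .
  qed
  also have "\<dots> = ennreal ((L2_norm p)\<^sup>2) * ennreal ?Q"
    by (subst nn_integral_cmult) (simp_all add: Q)
  also have "ennreal ((L2_norm p)\<^sup>2) * ennreal ?Q * ennreal ?Q = ennreal ((L2_norm p * ?Q)\<^sup>2)"
    by (simp add: ennreal_mult[symmetric] power2_eq_square mult_ac)
  finally show ?thesis .
qed

definition convolution :: "(real \<Rightarrow> complex) \<Rightarrow> (real \<Rightarrow> complex) \<Rightarrow> real \<Rightarrow> complex" where
  "convolution g h \<xi> = (LINT \<eta>|lborel. g (\<xi> - \<eta>) * h \<eta>) / of_real (2 * pi)"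

lemma borel_measurable_convolution [measurable]:
  assumes [measurable]: "g \<in> borel_measurable borel" "h \<in> borel_measurable borel"
  shows "convolution g h \<in> borel_measurable borel"
  unfolding convolution_def[abs_def] by measurable

lemma IFT_convolution:
  assumes g: "integrable lborel g" and h: "integrable lborel h"
  shows "IFT (convolution g h) x = IFT g x * IFT h x"
proof -
  note [measurable] = borel_measurable_integrable[OF g] borel_measurable_integrable[OF h]
  have "integrable (lborel \<Otimes>\<^sub>M lborel) (\<lambda>(\<xi>, \<eta>). cis (x * \<xi>) * (g (\<xi> - \<eta>) * h \<eta>))"
  proof (rule integrableI_bounded)
    have "(\<integral>\<^sup>+p. ennreal (norm (case p of (\<xi>, \<eta>) \<Rightarrow> cis (x * \<xi>) * (g (\<xi> - \<eta>) * h \<eta>))) \<partial>(lborel \<Otimes>\<^sub>M lborel)) =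
        (\<integral>\<^sup>+\<xi>. \<integral>\<^sup>+\<eta>. ennreal (cmod (g (\<xi> - \<eta>))) * ennreal (cmod (h \<eta>)) \<partial>lborel \<partial>lborel)"
      by (subst lborel.nn_integral_fst[symmetric]) (auto simp: norm_mult ennreal_mult)
    also have "\<dots> = (\<integral>\<^sup>+\<eta>. \<integral>\<^sup>+\<xi>. ennreal (cmod (g (\<xi> - \<eta>))) * ennreal (cmod (h \<eta>)) \<partial>lborel \<partial>lborel)"
      by (rule lborel_pair.Fubini') measurable
    also have "\<dots> = (\<integral>\<^sup>+\<eta>. (\<integral>\<^sup>+\<xi>. ennreal (cmod (g \<xi>)) \<partial>lborel) * ennreal (cmod (h \<eta>)) \<partial>lborel)"
    proof (intro nn_integral_cong)
      fix \<eta> :: real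
      have "(\<integral>\<^sup>+\<xi>. ennreal (cmod (g (\<xi> - \<eta>))) * ennreal (cmod (h \<eta>)) \<partial>lborel) = (\<integral>\<^sup>+\<xi>. ennreal (cmod (g (\<xi> - \<eta>))) \<partial>lborel) * ennreal (cmod (h \<eta>))"
        by (rule nn_integral_multc) measurable
      then show "(\<integral>\<^sup>+\<xi>. ennreal (cmod (g (\<xi> - \<eta>))) * ennreal (cmod (h \<eta>)) \<partial>lborel) = (\<integral>\<^sup>+\<xi>. ennreal (cmod (g \<xi>)) \<partial>lborel) * ennreal (cmod (h \<eta>))"
        using nn_integral_real_affine[of "\<lambda>z. ennreal (cmod (g z))" 1 "-\<eta>"] by simp
    qed
    also have "\<dots> = (\<integral>\<^sup>+\<xi>. ennreal (cmod (g \<xi>)) \<partial>lborel) * (\<integral>\<^sup>+\<eta>. ennreal (cmod (h \<eta>)) \<partial>lborel)"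
      by (rule nn_integral_cmult) measurable
    also have "\<dots> < \<infinity>"
      using g h by (auto simp: integrable_iff_bounded ennreal_mult_less_top)
    finally show "(\<integral>\<^sup>+p. ennreal (norm (case p of (\<xi>, \<eta>) \<Rightarrow> cis (x * \<xi>) * (g (\<xi> - \<eta>) * h \<eta>))) \<partial>(lborel \<Otimes>\<^sub>M lborel)) < \<infinity>" .
  qed measurable
  then have swap: "(LINT \<eta>|lborel. LINT \<xi>|lborel. cis (x * \<xi>) * (g (\<xi> - \<eta>) * h \<eta>)) = (LINT \<xi>|lborel. LINT \<eta>|lborel. cis (x * \<xi>) * (g (\<xi> - \<eta>) * h \<eta>))"
    by (rule lborel_pair.Fubini_integral)
  have inner: "(LINT \<xi>|lborel. cis (x * \<xi>) * (g (\<xi> - \<eta>) * h \<eta>)) = (LINT \<xi>|lborel. cis (x * \<xi>) * g \<xi>) * (cis (x * \<eta>) * h \<eta>)" for \<eta>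
  proof -
    have "(LINT \<xi>|lborel. cis (x * \<xi>) * (g (\<xi> - \<eta>) * h \<eta>)) = (LINT \<xi>|lborel. cis (x * (\<eta> + 1 * \<xi>)) * (g ((\<eta> + 1 * \<xi>) - \<eta>) * h \<eta>))"
      by (subst lborel_integral_real_affine[of 1 _ \<eta>]) simp_all
    also have "\<dots> = (LINT \<xi>|lborel. (cis (x * \<xi>) * g \<xi>) * (cis (x * \<eta>) * h \<eta>))"
    proof (intro Bochner_Integration.integral_cong refl)
      fix \<xi>
      have "cis (x * (\<eta> + 1 * \<xi>)) = cis (x * \<eta>) * cis (x * \<xi>)"
        by (simp add: cis_mult distrib_left)
      then show "cis (x * (\<eta> + 1 * \<xi>)) * (g ((\<eta> + 1 * \<xi>) - \<eta>) * h \<eta>) = (cis (x * \<xi>) * g \<xi>) * (cis (x * \<eta>) * h \<eta>)"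
        by (simp only: mult_1 add_diff_cancel_left' mult_ac)
    qed
    also have "\<dots> = (LINT \<xi>|lborel. cis (x * \<xi>) * g \<xi>) * (cis (x * \<eta>) * h \<eta>)"
      by (rule integral_mult_left_zero)
    finally show ?thesis .
  qed
  have "(LINT \<xi>|lborel. cis (x * \<xi>) * convolution g h \<xi>) = (LINT \<xi>|lborel. (LINT \<eta>|lborel. cis (x * \<xi>) * (g (\<xi> - \<eta>) * h \<eta>)) / of_real (2 * pi))"
    unfolding convolution_def
    by (intro Bochner_Integration.integral_cong refl) (simp only: integral_mult_right_zero times_divide_eq_right)
  also have "\<dots> = (LINT \<xi>|lborel. LINT \<eta>|lborel. cis (x * \<xi>) * (g (\<xi> - \<eta>) * h \<eta>)) / of_real (2 * pi)"
    by (rule integral_divide_zero)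
  also have "\<dots> = (LINT \<eta>|lborel. (LINT \<xi>|lborel. cis (x * \<xi>) * g \<xi>) * (cis (x * \<eta>) * h \<eta>)) / of_real (2 * pi)"
    unfolding swap[symmetric] inner ..
  also have "\<dots> = (LINT \<xi>|lborel. cis (x * \<xi>) * g \<xi>) * (LINT \<eta>|lborel. cis (x * \<eta>) * h \<eta>) / of_real (2 * pi)"
    by (simp only: integral_mult_right_zero)
  finally show ?thesis
    by (simp add: IFT_def)
qed

text \<open>From \<open>1 + \<xi>\<^sup>2 \<le> 2 * (1 + (\<xi> - \<eta>)\<^sup>2) + 2 * (1 + \<eta>\<^sup>2)\<close>, whose right side is at most four times
  the larger summand.\<close>

lemma weight_subadditive:
  assumes r: "r \<ge> 0"
  shows "weight r \<xi> \<le> 2 powr r * (weight r (\<xi> - \<eta>) + weight r \<eta>)"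
proof -
  let ?a = "1 + (\<xi> - \<eta>)\<^sup>2" and ?b = "1 + \<eta>\<^sup>2"
  have ab: "?a > 0" "?b > 0"
    using one_plus_sq_ge_1[of "\<xi> - \<eta>"] one_plus_sq_ge_1[of \<eta>] by linarith+
  have "1 + \<xi>\<^sup>2 + (\<xi> - 2 * \<eta>)\<^sup>2 + 3 = 2 * ?a + 2 * ?b"
    by (simp add: power2_eq_square algebra_simps)
  then have "1 + \<xi>\<^sup>2 \<le> 2 * ?a + 2 * ?b"
    using zero_le_power2[of "\<xi> - 2 * \<eta>"] by linarith
  also have "\<dots> \<le> 4 * max ?a ?b"
    by (simp add: max_def)
  finally have "weight r \<xi> \<le> (4 * max ?a ?b) powr (r / 2)"
    unfolding weight_def using r one_plus_sq_ge_1[of \<xi>] by (intro powr_mono2) auto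
  also have "\<dots> = 4 powr (r / 2) * (max ?a ?b) powr (r / 2)"
    using ab by (intro powr_mult)
  also have "4 powr (r / 2) = 2 powr r"
    using powr_powr[of 2 2 "r / 2"] by (simp add: powr_numeral)
  also have "(max ?a ?b) powr (r / 2) \<le> weight r (\<xi> - \<eta>) + weight r \<eta>"
    by (simp add: weight_def max_def)
  finally show ?thesis
    by (simp add: mult_left_mono)
qed

text \<open>Twice the constant \<open>2 powr r\<close> of \<open>weight_subadditive\<close>, one for each factor that may carry the
  weight, times the constant of the embedding that controls the other factor.\<close>

definition algebra_const :: "real \<Rightarrow> real" where
  "algebra_const r = 2 * 2 powr r * embedding_const"

lemma algebra_const_nonneg [simp]: "algebra_const r \<ge> 0"
  by (simp add: algebra_const_def)

text \<open>The algebra property of Sobolev spaces: the weight is subadditive up to a constant, so in the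
  convolution of the spectra it may be moved onto one of the factors while the other factor is
  integrable.\<close>

lemma convolution_spectra:
  assumes g: "g \<in> sobolev_spectra r" and h: "h \<in> sobolev_spectra r" and r: "r \<ge> 1"
  shows "convolution g h \<in> sobolev_spectra r"
    and "L2_norm (weighted r (convolution g h)) \<le> algebra_const r * L2_norm (weighted r g) * L2_norm (weighted r h)"
proof -
  note [measurable] = spectra_measurable[OF g] spectra_measurable[OF h]
  note ig = spectra_integrable[OF g r] and ih = spectra_integrable[OF h r]
  let ?G = "L2_norm (weighted r g)" and ?H = "L2_norm (weighted r h)"
  define Y1 where "Y1 \<xi> = (\<integral>\<^sup>+\<eta>. ennreal (cmod (weighted r g (\<xi> - \<eta>)) * cmod (h \<eta>)) \<partial>lborel)" for \<xi>
  define Y2 where "Y2 \<xi> = (\<integral>\<^sup>+\<eta>. ennreal (cmod (weighted r h (\<xi> - \<eta>)) * cmod (g \<eta>)) \<partial>lborel)" for \<xi>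
  have [measurable]: "Y1 \<in> borel_measurable borel" "Y2 \<in> borel_measurable borel"
    unfolding Y1_def Y2_def by measurable
  have Y2: "(\<integral>\<^sup>+\<eta>. ennreal (cmod (weighted r h \<eta>) * cmod (g (\<xi> - \<eta>))) \<partial>lborel) = Y2 \<xi>" for \<xi>
    unfolding Y2_def
    using nn_integral_real_affine[of "\<lambda>\<eta>. ennreal (cmod (weighted r h \<eta>) * cmod (g (\<xi> - \<eta>)))" "-1" \<xi>] by simp
  let ?c = "2 powr r"
  have pt: "ennreal (cmod (weighted r (convolution g h) \<xi>)) \<le> ennreal ?c * (Y1 \<xi> + Y2 \<xi>)" for \<xi>
  proof -
    have "cmod (convolution g h \<xi>) \<le> cmod (LINT \<eta>|lborel. g (\<xi> - \<eta>) * h \<eta>) / 1"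
      unfolding convolution_def norm_divide using pi_gt3 by (intro divide_left_mono) auto
    then have "ennreal (cmod (weighted r (convolution g h) \<xi>)) \<le> ennreal (weight r \<xi>) * ennreal (cmod (LINT \<eta>|lborel. g (\<xi> - \<eta>) * h \<eta>))"
      by (simp add: weighted_def norm_mult ennreal_mult[symmetric] ennreal_leI mult_left_mono)
    also have "\<dots> \<le> ennreal (weight r \<xi>) * (\<integral>\<^sup>+\<eta>. ennreal (cmod (g (\<xi> - \<eta>) * h \<eta>)) \<partial>lborel)"
      by (intro mult_left_mono norm_integral_le_nn_integral) simp
    also have "\<dots> = (\<integral>\<^sup>+\<eta>. ennreal (weight r \<xi>) * ennreal (cmod (g (\<xi> - \<eta>) * h \<eta>)) \<partial>lborel)"
      by (rule nn_integral_cmult[symmetric]) measurable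
    also have "\<dots> \<le> (\<integral>\<^sup>+\<eta>. ennreal ?c * (ennreal (cmod (weighted r g (\<xi> - \<eta>)) * cmod (h \<eta>)) + ennreal (cmod (weighted r h \<eta>) * cmod (g (\<xi> - \<eta>)))) \<partial>lborel)"
    proof (intro nn_integral_mono)
      fix \<eta>
      have "weight r \<xi> * (cmod (g (\<xi> - \<eta>)) * cmod (h \<eta>)) \<le> (?c * (weight r (\<xi> - \<eta>) + weight r \<eta>)) * (cmod (g (\<xi> - \<eta>)) * cmod (h \<eta>))"
        using r by (intro mult_right_mono weight_subadditive) auto
      also have "\<dots> = ?c * (cmod (weighted r g (\<xi> - \<eta>)) * cmod (h \<eta>) + cmod (weighted r h \<eta>) * cmod (g (\<xi> - \<eta>)))"
        by (simp add: weighted_def norm_mult distrib_left distrib_right mult_ac)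
      finally show "ennreal (weight r \<xi>) * ennreal (cmod (g (\<xi> - \<eta>) * h \<eta>)) \<le> ennreal ?c * (ennreal (cmod (weighted r g (\<xi> - \<eta>)) * cmod (h \<eta>)) + ennreal (cmod (weighted r h \<eta>) * cmod (g (\<xi> - \<eta>))))"
        by (simp add: ennreal_mult[symmetric] ennreal_plus[symmetric] norm_mult ennreal_leI del: ennreal_plus)
    qed
    also have "\<dots> = ennreal ?c * (\<integral>\<^sup>+\<eta>. (ennreal (cmod (weighted r g (\<xi> - \<eta>)) * cmod (h \<eta>)) + ennreal (cmod (weighted r h \<eta>) * cmod (g (\<xi> - \<eta>)))) \<partial>lborel)"
      by (rule nn_integral_cmult) measurable
    also have "(\<integral>\<^sup>+\<eta>. (ennreal (cmod (weighted r g (\<xi> - \<eta>)) * cmod (h \<eta>)) + ennreal (cmod (weighted r h \<eta>) * cmod (g (\<xi> - \<eta>)))) \<partial>lborel) = Y1 \<xi> + Y2 \<xi>"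
      unfolding Y1_def Y2[symmetric] by (rule nn_integral_add) measurable
    finally show ?thesis .
  qed
  have sq: "(Y1 \<xi> + Y2 \<xi>)\<^sup>2 \<le> 2 * (Y1 \<xi>)\<^sup>2 + 2 * (Y2 \<xi>)\<^sup>2" for \<xi>
  proof (cases "Y1 \<xi>" "Y2 \<xi>" rule: ennreal2_cases)
    case (real_real a b)
    have "(a + b)\<^sup>2 \<le> 2 * a\<^sup>2 + 2 * b\<^sup>2"
      using zero_le_power2[of "a - b"] by (simp add: power2_eq_square algebra_simps)
    then have "ennreal ((a + b)\<^sup>2) \<le> ennreal (2 * a\<^sup>2 + 2 * b\<^sup>2)"
      by (rule ennreal_leI)
    then show ?thesis
      using real_real by (simp add: ennreal_power ennreal_plus[symmetric] ennreal_mult'[symmetric] ennreal_numeral[symmetric] del: ennreal_plus ennreal_numeral)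
  qed (simp_all add: power2_eq_square ennreal_mult_top ennreal_top_mult)
  have Y1b: "(\<integral>\<^sup>+\<xi>. (Y1 \<xi>)\<^sup>2 \<partial>lborel) \<le> ennreal ((?G * (embedding_const * ?H))\<^sup>2)"
    unfolding Y1_def
    by (rule order_trans[OF Young_L2_L1[OF spectra_L2[OF g] ih(1)]])
      (intro ennreal_leI power_mono mult_left_mono ih(2), auto)
  have Y2b: "(\<integral>\<^sup>+\<xi>. (Y2 \<xi>)\<^sup>2 \<partial>lborel) \<le> ennreal ((?H * (embedding_const * ?G))\<^sup>2)"
    unfolding Y2_def
    by (rule order_trans[OF Young_L2_L1[OF spectra_L2[OF h] ig(1)]])
      (intro ennreal_leI power_mono mult_left_mono ig(2), auto)
  let ?E = "(embedding_const * ?G * ?H)\<^sup>2"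
  have "(\<integral>\<^sup>+\<xi>. ennreal ((cmod (weighted r (convolution g h) \<xi>))\<^sup>2) \<partial>lborel) \<le> (\<integral>\<^sup>+\<xi>. ennreal (?c\<^sup>2) * (2 * (Y1 \<xi>)\<^sup>2 + 2 * (Y2 \<xi>)\<^sup>2) \<partial>lborel)"
  proof (intro nn_integral_mono)
    fix \<xi>
    have "(ennreal (cmod (weighted r (convolution g h) \<xi>)))\<^sup>2 \<le> (ennreal ?c * (Y1 \<xi> + Y2 \<xi>))\<^sup>2"
      by (intro power_mono pt) simp
    also have "\<dots> = ennreal (?c\<^sup>2) * (Y1 \<xi> + Y2 \<xi>)\<^sup>2"
      by (simp add: power_mult_distrib ennreal_power)
    also have "\<dots> \<le> ennreal (?c\<^sup>2) * (2 * (Y1 \<xi>)\<^sup>2 + 2 * (Y2 \<xi>)\<^sup>2)"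
      by (intro mult_left_mono sq) simp
    finally show "ennreal ((cmod (weighted r (convolution g h) \<xi>))\<^sup>2) \<le> ennreal (?c\<^sup>2) * (2 * (Y1 \<xi>)\<^sup>2 + 2 * (Y2 \<xi>)\<^sup>2)"
      by (simp add: ennreal_power)
  qed
  also have "\<dots> = ennreal (?c\<^sup>2) * (2 * (\<integral>\<^sup>+\<xi>. (Y1 \<xi>)\<^sup>2 \<partial>lborel) + 2 * (\<integral>\<^sup>+\<xi>. (Y2 \<xi>)\<^sup>2 \<partial>lborel))"
    by (simp add: nn_integral_cmult nn_integral_add)
  also have "\<dots> \<le> ennreal (?c\<^sup>2) * (2 * ennreal ?E + 2 * ennreal ?E)"
    using Y1b Y2b by (intro mult_left_mono add_mono) (auto simp: mult_ac)
  also have "\<dots> = ennreal ((algebra_const r * ?G * ?H)\<^sup>2)"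
  proof -
    have "2 * ennreal ?E + 2 * ennreal ?E = ennreal (2 * ?E + 2 * ?E)"
    proof -
      have "2 * ennreal ?E + 2 * ennreal ?E = (2 + 2) * ennreal ?E"
        by (rule distrib_right[symmetric])
      also have "\<dots> = ennreal (2 * ?E + 2 * ?E)"
        by (simp add: ennreal_mult')
      finally show ?thesis .
    qed
    then show ?thesis
      by (simp add: ennreal_mult'[symmetric] algebra_const_def power2_eq_square mult_ac)
  qed
  finally have "(\<integral>\<^sup>+\<xi>. ennreal ((cmod (weighted r (convolution g h) \<xi>))\<^sup>2) \<partial>lborel) \<le> ennreal ((algebra_const r * ?G * ?H)\<^sup>2)" .
  note * = L2_normI[OF _ _ this]
  show "convolution g h \<in> sobolev_spectra r"
    using *(1) by (simp add: sobolev_spectra_def)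
  show "L2_norm (weighted r (convolution g h)) \<le> algebra_const r * ?G * ?H"
    by (rule *(2)) simp_all
qed

lemma sobolev_cont_mult:
  assumes "f \<in> sobolev_cont r" "h \<in> sobolev_cont r" and r: "r \<ge> 1"
  shows "(\<lambda>x. f x * h x) \<in> sobolev_cont r"
    and "sobolev_norm r (\<lambda>x. f x * h x) \<le> algebra_const r * sobolev_norm r f * sobolev_norm r h"
proof -
  obtain g where g: "g \<in> sobolev_spectra r" "f = IFT g" "sobolev_norm r f = L2_norm (weighted r g)"
    using assms(1) r by (rule sobolev_cont_cases)
  obtain k where k: "k \<in> sobolev_spectra r" "h = IFT k" "sobolev_norm r h = L2_norm (weighted r k)"
    using assms(2) r by (rule sobolev_cont_cases)
  note c = convolution_spectra[OF g(1) k(1) r]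
  have e: "(\<lambda>x. f x * h x) = IFT (convolution g k)"
    unfolding g(2) k(2)
    by (intro ext IFT_convolution[symmetric] spectra_integrable(1)[OF g(1) r] spectra_integrable(1)[OF k(1) r])
  show "(\<lambda>x. f x * h x) \<in> sobolev_cont r"
    "sobolev_norm r (\<lambda>x. f x * h x) \<le> algebra_const r * sobolev_norm r f * sobolev_norm r h"
    unfolding e g(3) k(3) using IFT_sobolev[OF c(1) r] c(2) by auto
qed

section \<open>Smooth functions and the Helmholtz operator\<close>

lemma smooth_has_vector_derivative:
  assumes "f \<in> smooth"
  shows "((Dx ^^ k) f has_vector_derivative (Dx ^^ Suc k) f x) (at x)"
  using assms unfolding smooth_def by (auto simp: Dx_def vector_derivative_works[symmetric])

lemma Dx_eqI: "(\<And>x. (f has_vector_derivative g x) (at x)) \<Longrightarrow> Dx f = g"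
  unfolding Dx_def by (auto intro: vector_derivative_at)

text \<open>Iterated derivatives are computed by exhibiting the whole sequence of candidates at once; sums,
  products, series and the smoothing operator are treated in this way.\<close>

lemma derivative_tower:
  assumes "\<And>k x. (F k has_vector_derivative F (Suc k) x) (at x)"
  shows "(Dx ^^ k) (F 0) = F k" "F 0 \<in> smooth"
proof -
  show *: "(Dx ^^ k) (F 0) = F k" for k
    by (induction k) (auto intro!: Dx_eqI assms)
  show "F 0 \<in> smooth"
    unfolding smooth_def using * assms by (auto simp: intro: differentiableI_vector)
qed

lemma smooth_Dx: "f \<in> smooth \<Longrightarrow> Dx f \<in> smooth"
proof -
  assume f: "f \<in> smooth"
  have "((Dx ^^ Suc k) f has_vector_derivative (Dx ^^ Suc (Suc k)) f x) (at x)" for k x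
    by (rule smooth_has_vector_derivative[OF f])
  from derivative_tower(2)[of "\<lambda>k. (Dx ^^ Suc k) f", OF this] show ?thesis by simp
qed

lemma Dx_funpow_Dx: "(Dx ^^ k) (Dx f) = (Dx ^^ Suc k) f"
  by (simp add: funpow_swap1)

lemma smooth_add:
  assumes f: "f \<in> smooth" and g: "g \<in> smooth"
  shows "(\<lambda>x. f x + g x) \<in> smooth" "(Dx ^^ k) (\<lambda>x. f x + g x) = (\<lambda>x. (Dx ^^ k) f x + (Dx ^^ k) g x)"
proof -
  let ?F = "\<lambda>k x. (Dx ^^ k) f x + (Dx ^^ k) g x"
  have "(?F k has_vector_derivative ?F (Suc k) x) (at x)" for k x
    by (intro has_vector_derivative_add smooth_has_vector_derivative f g)
  from derivative_tower[of ?F, OF this]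
  show "(\<lambda>x. f x + g x) \<in> smooth" "(Dx ^^ k) (\<lambda>x. f x + g x) = (\<lambda>x. (Dx ^^ k) f x + (Dx ^^ k) g x)"
    by simp_all
qed

lemma smooth_cmult:
  assumes f: "f \<in> smooth"
  shows "(\<lambda>x. c * f x) \<in> smooth" "(Dx ^^ k) (\<lambda>x. c * f x) = (\<lambda>x. c * (Dx ^^ k) f x)"
proof -
  let ?F = "\<lambda>k x. c * (Dx ^^ k) f x"
  have "(?F k has_vector_derivative ?F (Suc k) x) (at x)" for k x
    by (intro has_vector_derivative_mult_right smooth_has_vector_derivative f)
  from derivative_tower[of ?F, OF this]
  show "(\<lambda>x. c * f x) \<in> smooth" "(Dx ^^ k) (\<lambda>x. c * f x) = (\<lambda>x. c * (Dx ^^ k) f x)"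
    by simp_all
qed

lemma smooth_diff:
  assumes f: "f \<in> smooth" and g: "g \<in> smooth"
  shows "(\<lambda>x. f x - g x) \<in> smooth" "(Dx ^^ k) (\<lambda>x. f x - g x) = (\<lambda>x. (Dx ^^ k) f x - (Dx ^^ k) g x)"
  using smooth_add[OF f smooth_cmult(1)[OF g, of "-1"]] smooth_cmult(2)[OF g, of k "-1"] by auto

text \<open>Leibniz' rule, as the verification that its right sides form a tower of derivatives.\<close>

lemma smooth_mult:
  assumes f: "f \<in> smooth" and g: "g \<in> smooth"
  shows "(\<lambda>x. f x * g x) \<in> smooth"
    and "(Dx ^^ k) (\<lambda>x. f x * g x) = (\<lambda>x. \<Sum>i\<le>k. of_nat (k choose i) * ((Dx ^^ i) f x * (Dx ^^ (k - i)) g x))"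
proof -
  let ?F = "\<lambda>k x. \<Sum>i\<le>k. of_nat (k choose i) * ((Dx ^^ i) f x * (Dx ^^ (k - i)) g x)"
  have "(?F k has_vector_derivative ?F (Suc k) x) (at x)" for k x
  proof -
    let ?a = "\<lambda>i. (Dx ^^ i) f x" and ?b = "\<lambda>i. (Dx ^^ i) g x"
    have "(?F k has_vector_derivative (\<Sum>i\<le>k. of_nat (k choose i) * (?a i * ?b (Suc (k - i)) + ?a (Suc i) * ?b (k - i)))) (at x)"
      by (intro has_vector_derivative_sum has_vector_derivative_mult_right has_vector_derivative_mult
          smooth_has_vector_derivative f g)
    moreover have "(\<Sum>i\<le>k. of_nat (k choose i) * (?a i * ?b (Suc (k - i)) + ?a (Suc i) * ?b (k - i))) =
        (\<Sum>i\<le>Suc k. of_nat (Suc k choose i) * (?a i * ?b (Suc k - i)))"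
    proof -
      have "(\<Sum>i\<le>Suc k. of_nat (Suc k choose i) * (?a i * ?b (Suc k - i))) =
          ?a 0 * ?b (Suc k) + (\<Sum>i\<le>k. of_nat (Suc k choose Suc i) * (?a (Suc i) * ?b (k - i)))"
        by (subst sum.atMost_Suc_shift) simp
      also have "(\<Sum>i\<le>k. of_nat (Suc k choose Suc i) * (?a (Suc i) * ?b (k - i))) =
          (\<Sum>i\<le>k. of_nat (k choose i) * (?a (Suc i) * ?b (k - i))) + (\<Sum>i\<le>k. of_nat (k choose Suc i) * (?a (Suc i) * ?b (k - i)))"
        by (simp add: distrib_right sum.distrib)
      also have "?a 0 * ?b (Suc k) + (\<dots>) = (\<Sum>i\<le>k. of_nat (k choose i) * (?a (Suc i) * ?b (k - i))) +
          (?a 0 * ?b (Suc k) + (\<Sum>i\<le>k. of_nat (k choose Suc i) * (?a (Suc i) * ?b (k - i))))"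
        by simp
      also have "?a 0 * ?b (Suc k) + (\<Sum>i\<le>k. of_nat (k choose Suc i) * (?a (Suc i) * ?b (k - i))) =
          (\<Sum>i\<le>Suc k. of_nat (k choose i) * (?a i * ?b (Suc k - i)))"
        by (subst sum.atMost_Suc_shift) simp
      also have "\<dots> = (\<Sum>i\<le>k. of_nat (k choose i) * (?a i * ?b (Suc (k - i))))"
        by (simp add: Suc_diff_le)
      finally show ?thesis
        by (simp add: distrib_left sum.distrib)
    qed
    ultimately show ?thesis by simp
  qed
  from derivative_tower[of ?F, OF this]
  show "(\<lambda>x. f x * g x) \<in> smooth" "(Dx ^^ k) (\<lambda>x. f x * g x) = ?F k"
    by simp_all
qed

lemma has_vector_derivative_suminf:
  fixes f f' :: "nat \<Rightarrow> real \<Rightarrow> complex"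
  assumes d: "\<And>n x. (f n has_vector_derivative f' n x) (at x)"
    and M: "\<And>n x. cmod (f' n x) \<le> M n" and sM: "summable M" and sf: "\<And>x. summable (\<lambda>n. f n x)"
  shows "((\<lambda>x. \<Sum>n. f n x) has_vector_derivative (\<Sum>n. f' n x)) (at x)"
proof -
  have sn: "summable (\<lambda>n. cmod (f' n x))" for x
    by (rule summable_comparison_test'[OF sM, of 0]) (use M in auto)
  have sf': "summable (\<lambda>n. f' n x)" for x
    by (rule summable_norm_cancel[OF sn])
  have "\<exists>g. \<forall>x\<in>UNIV. (\<lambda>n. f n x) sums g x \<and> (g has_derivative (\<lambda>h. h *\<^sub>R (\<Sum>n. f' n x))) (at x within UNIV)"
  proof (rule has_derivative_series[where x=0 and f'="\<lambda>n x h. h *\<^sub>R f' n x"])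
    show "(f n has_derivative (\<lambda>h. h *\<^sub>R f' n x)) (at x within UNIV)" for n x
      using d by (simp add: has_vector_derivative_def)
    show "(\<lambda>n. f n 0) sums (\<Sum>n. f n 0)"
      by (rule summable_sums[OF sf])
    fix e :: real assume e: "e > 0"
    have "(\<lambda>n. \<Sum>i. M (i + n)) \<longlonglongrightarrow> 0"
      by (rule suminf_exist_split2[OF sM])
    then have "\<forall>\<^sub>F n in sequentially. (\<Sum>i. M (i + n)) < e"
      using e by (rule order_tendstoD)
    then show "\<forall>\<^sub>F n in sequentially. \<forall>x\<in>UNIV. \<forall>h. norm ((\<Sum>i<n. h *\<^sub>R f' i x) - h *\<^sub>R (\<Sum>n. f' n x)) \<le> e * norm h"
    proof eventually_elim
      case (elim n)
      show ?case
      proof safe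
        fix x h :: real
        have "(\<Sum>i<n. f' i x) - (\<Sum>n. f' n x) = - (\<Sum>i. f' (i + n) x)"
          using suminf_split_initial_segment[OF sf', of x n] by simp
        moreover have "cmod (\<Sum>i. f' (i + n) x) \<le> (\<Sum>i. cmod (f' (i + n) x))"
          by (rule summable_norm) (rule summable_ignore_initial_segment[OF sn])
        moreover have "(\<Sum>i. cmod (f' (i + n) x)) \<le> (\<Sum>i. M (i + n))"
          by (intro suminf_le M summable_ignore_initial_segment sn sM)
        ultimately have "cmod ((\<Sum>i<n. f' i x) - (\<Sum>n. f' n x)) \<le> e"
          using elim by simp
        then have "cmod ((\<Sum>i<n. f' i x) - (\<Sum>n. f' n x)) * \<bar>h\<bar> \<le> e * \<bar>h\<bar>"
          by (rule mult_right_mono) simp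
        then show "norm ((\<Sum>i<n. h *\<^sub>R f' i x) - h *\<^sub>R (\<Sum>n. f' n x)) \<le> e * norm h"
          by (simp add: scaleR_sum_right[symmetric] scaleR_diff_right[symmetric] mult.commute)
      qed
    qed
  qed simp_all
  then obtain g where g: "\<And>x. (\<lambda>n. f n x) sums g x" "\<And>x. (g has_derivative (\<lambda>h. h *\<^sub>R (\<Sum>n. f' n x))) (at x)"
    by auto
  have "g = (\<lambda>x. \<Sum>n. f n x)"
    using sums_unique[OF g(1)] by auto
  then show ?thesis
    using g(2)[of x] by (simp add: has_vector_derivative_def)
qed

definition sobolev_smooth :: "real \<Rightarrow> (real \<Rightarrow> complex) set" where
  "sobolev_smooth r = {f \<in> smooth. \<forall>k. (Dx ^^ k) f \<in> sobolev r}"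

lemma sobolev_smooth_cont:
  assumes "f \<in> sobolev_smooth r"
  shows "(Dx ^^ k) f \<in> sobolev_cont r"
  using assms smooth_has_vector_derivative[of f k]
  by (auto simp: sobolev_smooth_def sobolev_cont_def
      intro!: continuous_at_imp_continuous_on has_vector_derivative_continuous)

lemma sobolev_smooth_smooth: "f \<in> sobolev_smooth r \<Longrightarrow> f \<in> smooth"
  by (simp add: sobolev_smooth_def)

lemma sobolev_smoothI:
  assumes "f \<in> smooth" "\<And>k. (Dx ^^ k) f \<in> sobolev_cont r"
  shows "f \<in> sobolev_smooth r"
  using assms by (auto simp: sobolev_smooth_def sobolev_cont_def)

lemma analytic_space_smooth: "f \<in> analytic_space \<delta> r \<Longrightarrow> f \<in> sobolev_smooth r"
  by (simp add: analytic_space_def sobolev_smooth_def)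

context
  fixes r :: real
  assumes r1: "r \<ge> 1"
begin

lemma sobolev_smooth_add:
  assumes f: "f \<in> sobolev_smooth r" and g: "g \<in> sobolev_smooth r"
  shows "(\<lambda>x. f x + g x) \<in> sobolev_smooth r"
  using smooth_add[OF f[THEN sobolev_smooth_smooth] g[THEN sobolev_smooth_smooth]]
    sobolev_cont_add(1)[OF sobolev_smooth_cont[OF f] sobolev_smooth_cont[OF g] r1]
  by (intro sobolev_smoothI) auto

lemma sobolev_smooth_cmult:
  assumes f: "f \<in> sobolev_smooth r"
  shows "(\<lambda>x. c * f x) \<in> sobolev_smooth r"
  using smooth_cmult[OF f[THEN sobolev_smooth_smooth]]
    sobolev_cont_cmult(1)[OF sobolev_smooth_cont[OF f] r1]
  by (intro sobolev_smoothI) auto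

lemma sobolev_smooth_diff:
  assumes f: "f \<in> sobolev_smooth r" and g: "g \<in> sobolev_smooth r"
  shows "(\<lambda>x. f x - g x) \<in> sobolev_smooth r"
  using sobolev_smooth_add[OF f sobolev_smooth_cmult[OF g, of "-1"]] by simp

lemma sobolev_smooth_Dx:
  assumes f: "f \<in> sobolev_smooth r"
  shows "Dx f \<in> sobolev_smooth r"
  using smooth_Dx[OF f[THEN sobolev_smooth_smooth]] sobolev_smooth_cont[OF f]
  by (intro sobolev_smoothI) (auto simp only: Dx_funpow_Dx)

lemma sobolev_cont_zero: "(\<lambda>x. 0) \<in> sobolev_cont r" "sobolev_norm r (\<lambda>x. 0) = 0"
proof -
  have w: "weighted r (\<lambda>x. 0) = (\<lambda>x. 0)"
    by (auto simp: weighted_def)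
  then have "(\<lambda>x. 0) \<in> sobolev_spectra r"
    by (simp add: sobolev_spectra_def L2_zero)
  moreover have "IFT (\<lambda>x. 0) = (\<lambda>x. 0)"
    by (auto simp: IFT_def)
  ultimately show "(\<lambda>x. 0) \<in> sobolev_cont r" "sobolev_norm r (\<lambda>x. 0) = 0"
    using IFT_sobolev[of "\<lambda>x. 0" r] r1 L2_zero w by auto
qed

lemma sobolev_cont_sum:
  assumes "\<And>i. i \<in> A \<Longrightarrow> f i \<in> sobolev_cont r"
  shows "(\<lambda>x. \<Sum>i\<in>A. f i x) \<in> sobolev_cont r \<and>
    sobolev_norm r (\<lambda>x. \<Sum>i\<in>A. f i x) \<le> (\<Sum>i\<in>A. sobolev_norm r (f i))"
  using assms
proof (induction A rule: infinite_finite_induct)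
  case (insert a A)
  then show ?case
    using sobolev_cont_add[of "f a" r "\<lambda>x. \<Sum>i\<in>A. f i x"] r1 by (auto intro: order_trans)
qed (auto simp: sobolev_cont_zero)

lemma sobolev_smooth_zero: "(\<lambda>x. 0) \<in> sobolev_smooth r" "(Dx ^^ k) (\<lambda>x. 0) = (\<lambda>x. 0)"
proof -
  have t: "((\<lambda>x. 0::complex) has_vector_derivative 0) (at x)" for x :: real by simp
  note d = derivative_tower[of "\<lambda>k x. 0", OF t]
  show "(Dx ^^ k) (\<lambda>x. 0) = (\<lambda>x. 0)" for k by (rule d(1))
  then show "(\<lambda>x. 0) \<in> sobolev_smooth r"
    using d(2) by (intro sobolev_smoothI) (auto simp: sobolev_cont_zero)
qed

lemma sobolev_smooth_mult:
  assumes f: "f \<in> sobolev_smooth r" and g: "g \<in> sobolev_smooth r"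
  shows "(\<lambda>x. f x * g x) \<in> sobolev_smooth r"
    and "sobolev_norm r ((Dx ^^ k) (\<lambda>x. f x * g x)) \<le> algebra_const r *
      (\<Sum>i\<le>k. of_nat (k choose i) * (sobolev_norm r ((Dx ^^ i) f) * sobolev_norm r ((Dx ^^ (k - i)) g)))"
proof -
  note L = smooth_mult[OF f[THEN sobolev_smooth_smooth] g[THEN sobolev_smooth_smooth]]
  let ?t = "\<lambda>k i x. of_nat (k choose i) * ((Dx ^^ i) f x * (Dx ^^ (k - i)) g x)"
  have m: "(\<lambda>x. (Dx ^^ i) f x * (Dx ^^ j) g x) \<in> sobolev_cont r"
    "sobolev_norm r (\<lambda>x. (Dx ^^ i) f x * (Dx ^^ j) g x) \<le> algebra_const r * sobolev_norm r ((Dx ^^ i) f) * sobolev_norm r ((Dx ^^ j) g)"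
    for i j
    using sobolev_cont_mult[OF sobolev_smooth_cont[OF f] sobolev_smooth_cont[OF g] r1] by auto
  have t: "?t k i \<in> sobolev_cont r" "sobolev_norm r (?t k i) \<le> algebra_const r * (of_nat (k choose i) * (sobolev_norm r ((Dx ^^ i) f) * sobolev_norm r ((Dx ^^ (k - i)) g)))" for k i
    using sobolev_cont_cmult[OF m(1)[of i "k - i"] r1, of "of_nat (k choose i)"]
      mult_left_mono[OF m(2)[of i "k - i"], of "of_nat (k choose i)"] by (auto simp: mult_ac)
  show "(\<lambda>x. f x * g x) \<in> sobolev_smooth r"
    using L(1) sobolev_cont_sum[of _ "?t _"] t(1) by (intro sobolev_smoothI) (auto simp: L(2))
  have "sobolev_norm r ((Dx ^^ k) (\<lambda>x. f x * g x)) \<le> (\<Sum>i\<le>k. sobolev_norm r (?t k i))"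
    unfolding L(2) using sobolev_cont_sum[of "{..k}" "?t k"] t(1) by auto
  also have "\<dots> \<le> (\<Sum>i\<le>k. algebra_const r * (of_nat (k choose i) * (sobolev_norm r ((Dx ^^ i) f) * sobolev_norm r ((Dx ^^ (k - i)) g))))"
    by (intro sum_mono t(2))
  finally show "sobolev_norm r ((Dx ^^ k) (\<lambda>x. f x * g x)) \<le> algebra_const r *
      (\<Sum>i\<le>k. of_nat (k choose i) * (sobolev_norm r ((Dx ^^ i) f) * sobolev_norm r ((Dx ^^ (k - i)) g)))"
    by (simp add: sum_distrib_left)
qed

lemma sobolev_smooth_sup_bound:
  assumes "f \<in> sobolev_smooth r"
  shows "cmod ((Dx ^^ k) f x) \<le> embedding_const * sobolev_norm r ((Dx ^^ k) f)"
  by (rule sobolev_sup_bound[OF sobolev_smooth_cont[OF assms] r1])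

lemma sobolev_smooth_suminf:
  assumes f: "\<And>n. f n \<in> sobolev_smooth r" and sm: "\<And>k. summable (\<lambda>n. sobolev_norm r ((Dx ^^ k) (f n)))"
  shows "(\<lambda>x. \<Sum>n. f n x) \<in> sobolev_smooth r"
    and "(Dx ^^ k) (\<lambda>x. \<Sum>n. f n x) = (\<lambda>x. \<Sum>n. (Dx ^^ k) (f n) x)"
    and "sobolev_norm r ((Dx ^^ k) (\<lambda>x. \<Sum>n. f n x)) \<le> (\<Sum>n. sobolev_norm r ((Dx ^^ k) (f n)))"
    and "summable (\<lambda>n. cmod ((Dx ^^ k) (f n) x))"
proof -
  have s2: "summable (\<lambda>n. embedding_const * sobolev_norm r ((Dx ^^ k) (f n)))" for k
    by (intro summable_mult sm)
  show sn: "summable (\<lambda>n. cmod ((Dx ^^ k) (f n) x))" for k x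
    by (rule summable_comparison_test'[OF s2[of k], of 0]) (use sobolev_smooth_sup_bound[OF f] in auto)
  let ?F = "\<lambda>k x. \<Sum>n. (Dx ^^ k) (f n) x"
  have "(?F k has_vector_derivative ?F (Suc k) x) (at x)" for k x
    by (rule has_vector_derivative_suminf[OF smooth_has_vector_derivative[OF sobolev_smooth_smooth[OF f]]
          sobolev_smooth_sup_bound[OF f] s2 summable_norm_cancel[OF sn]])
  note d = derivative_tower[of ?F, OF this]
  show D: "(Dx ^^ k) (\<lambda>x. \<Sum>n. f n x) = ?F k" for k
    using d(1) by simp
  have S: "?F k \<in> sobolev_cont r" "sobolev_norm r (?F k) \<le> (\<Sum>n. sobolev_norm r ((Dx ^^ k) (f n)))" for k
    using sobolev_suminf[OF sobolev_smooth_cont[OF f] r1 sm] by auto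
  show "sobolev_norm r ((Dx ^^ k) (\<lambda>x. \<Sum>n. f n x)) \<le> (\<Sum>n. sobolev_norm r ((Dx ^^ k) (f n)))"
    unfolding D by (rule S(2))
  show "(\<lambda>x. \<Sum>n. f n x) \<in> sobolev_smooth r"
    using d(2) S(1) by (intro sobolev_smoothI) (auto simp: D)
qed

end

lemma sobolev_smooth_mono:
  assumes "f \<in> sobolev_smooth r" "1 \<le> q" "q \<le> r"
  shows "f \<in> sobolev_smooth q"
  using assms sobolev_cont_mono(1)[OF sobolev_smooth_cont[OF assms(1)]]
  by (intro sobolev_smoothI) (auto simp: sobolev_smooth_def)

lemma sobolev_smooth_smoothing:
  assumes f: "f \<in> sobolev_smooth r" and r: "r \<ge> 2"
  shows "(Dx ^^ k) (smoothing f) = smoothing ((Dx ^^ k) f)" "smoothing f \<in> sobolev_smooth (r + 1)"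
proof -
  have S: "smoothing ((Dx ^^ k) f) \<in> sobolev_cont (r + 1)" for k
    using smoothing_sobolev(1)[OF sobolev_smooth_cont[OF f]] r by simp
  have "(smoothing ((Dx ^^ k) f) has_vector_derivative smoothing ((Dx ^^ Suc k) f) x) (at x)" for k x
    using sobolev_cont_Dx(1)[OF S, of k x] Dx_smoothing[OF sobolev_smooth_cont[OF f] r, of k] r by simp
  note d = derivative_tower[of "\<lambda>k. smoothing ((Dx ^^ k) f)", OF this]
  show D: "(Dx ^^ k) (smoothing f) = smoothing ((Dx ^^ k) f)" for k
    using d(1) by simp
  show "smoothing f \<in> sobolev_smooth (r + 1)"
    using d(2) S by (intro sobolev_smoothI) (auto simp: D)
qed

text \<open>Bounded solutions of \<open>w - w'' = g\<close> are bounded by \<open>g\<close>: the equation factors into two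
  first order ones, and for \<open>q - q' = g\<close> the function \<open>exp (-x) q (x)\<close> vanishes at infinity
  while its derivative is at most \<open>exp (-x) sup \<bar>g\<bar>\<close>.\<close>

lemma first_order_bound:
  fixes q q' :: "real \<Rightarrow> complex"
  assumes d: "\<And>x. (q has_vector_derivative q' x) (at x)" and B: "\<And>x. cmod (q x) \<le> B"
    and M: "\<And>x. cmod (q x - q' x) \<le> M"
  shows "cmod (q x) \<le> M"
proof -
  let ?f = "\<lambda>x. of_real (exp (- x)) * q x"
  have df: "(?f has_vector_derivative of_real (exp (- x)) * (q' x - q x)) (at x)" for x
  proof -
    have "((\<lambda>x. complex_of_real (exp (- x))) has_vector_derivative of_real (- exp (- x))) (at x)"
      by (intro has_vector_derivative_of_real) (auto intro!: derivative_eq_intros)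
    from has_vector_derivative_mult[OF this d[of x]] show ?thesis
      by (simp add: algebra_simps)
  qed
  have le: "cmod (?f y - ?f x) \<le> (- M * exp (- y)) - (- M * exp (- x))" if "x < y" for y
  proof (rule differentiable_bound_general[OF that])
    show "continuous_on {x..y} (\<lambda>x. - M * exp (- x))"
      by (intro continuous_intros)
    show "continuous_on {x..y} ?f"
      using df by (intro continuous_at_imp_continuous_on ballI has_vector_derivative_continuous)
    show "((\<lambda>x. - M * exp (- x)) has_vector_derivative M * exp (- z)) (at z)" for z
      unfolding has_real_derivative_iff_has_vector_derivative[symmetric]
      by (auto intro!: derivative_eq_intros)
    show "(?f has_vector_derivative of_real (exp (- z)) * (q' z - q z)) (at z)" for z
      by (rule df)
    show "cmod (of_real (exp (- z)) * (q' z - q z)) \<le> M * exp (- z)" for z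
      using M[of z] by (simp add: norm_mult norm_minus_commute mult.commute)
  qed
  have fy: "(?f \<longlongrightarrow> 0) at_top"
  proof (rule Lim_null_comparison)
    show "\<forall>\<^sub>F y in at_top. norm (?f y) \<le> exp (- y) * B"
      using B by (intro always_eventually allI) (simp add: norm_mult)
    show "((\<lambda>y. exp (- y) * B) \<longlongrightarrow> 0) at_top"
      by (intro tendsto_mult_left_zero filterlim_compose[OF exp_at_bot filterlim_uminus_at_bot_at_top])
  qed
  have "((\<lambda>y. cmod (?f y - ?f x)) \<longlongrightarrow> cmod (0 - ?f x)) at_top"
    by (intro tendsto_intros fy)
  moreover have "((\<lambda>y. (- M * exp (- y)) - (- M * exp (- x))) \<longlongrightarrow> - M * 0 - (- M * exp (- x))) at_top"
    by (intro tendsto_intros filterlim_compose[OF exp_at_bot filterlim_uminus_at_bot_at_top])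
  moreover have "\<forall>\<^sub>F y in at_top. cmod (?f y - ?f x) \<le> (- M * exp (- y)) - (- M * exp (- x))"
    using eventually_gt_at_top[of x] by eventually_elim (rule le)
  ultimately have "cmod (0 - ?f x) \<le> - M * 0 - (- M * exp (- x))"
    by (intro tendsto_le[OF trivial_limit_at_top_linorder])
  then have "exp (- x) * cmod (q x) \<le> exp (- x) * M"
    by (simp add: norm_mult mult.commute)
  then show ?thesis by simp
qed

lemma helmholtz_bound:
  fixes w w1 w2 :: "real \<Rightarrow> complex"
  assumes d1: "\<And>x. (w has_vector_derivative w1 x) (at x)" and d2: "\<And>x. (w1 has_vector_derivative w2 x) (at x)"
    and B: "\<And>x. cmod (w x) \<le> B" "\<And>x. cmod (w1 x) \<le> B1" and M: "\<And>x. cmod (w x - w2 x) \<le> M"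
  shows "cmod (w x) \<le> M"
proof -
  have q: "cmod (w x + w1 x) \<le> M" for x
  proof (rule first_order_bound)
    show "((\<lambda>x. w x + w1 x) has_vector_derivative w1 x + w2 x) (at x)" for x
      by (intro has_vector_derivative_add d1 d2)
    show "cmod (w x + w1 x) \<le> B + B1" for x
      by (rule order_trans[OF norm_triangle_ineq add_mono[OF B]])
    show "cmod (w x + w1 x - (w1 x + w2 x)) \<le> M" for x
      using M[of x] by simp
  qed
  \<comment> \<open>the factor \<open>1 + d/dx\<close> is the reflection of \<open>1 - d/dx\<close>\<close>
  have "cmod ((\<lambda>x. w (- x)) (- x)) \<le> M"
  proof (rule first_order_bound[where q = "\<lambda>x. w (- x)" and q' = "\<lambda>x. - w1 (- x)" and B = B])
    show "((\<lambda>x. w (- x)) has_vector_derivative - w1 (- x)) (at x)" for x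
    proof -
      have "(uminus has_vector_derivative (-1::real)) (at x)"
        using has_vector_derivative_minus[OF has_vector_derivative_id] by simp
      from vector_diff_chain_at[OF this d1[of "- x"]] show ?thesis
        by (simp add: comp_def)
    qed
    show "cmod (w (- x)) \<le> B" for x by (rule B)
    show "cmod (w (- x) - - w1 (- x)) \<le> M" for x
      using q[of "- x"] by simp
  qed
  then show ?thesis by simp
qed

text \<open>The operator \<open>1 - d\<^sup>2/dx\<^sup>2\<close> is injective on the functions among which \<open>helmholtz_inv\<close> chooses, because
  such functions and their first derivatives are bounded; and \<open>smoothing f\<close> is a solution.\<close>

lemma helmholtz_inv_Dx:
  assumes f: "f \<in> sobolev_smooth r" and r: "r \<ge> 2"
  shows "helmholtz_inv (Dx f) = smoothing f"
proof -
  let ?S = "smooth \<inter> sobolev 2" and ?h = "\<lambda>w x. w x - (Dx ^^ 2) w x"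
  have D2: "(Dx ^^ 2) w = Dx (Dx w)" for w
    by (simp add: numeral_2_eq_2)
  have inj: "inj_on ?h ?S"
  proof (rule inj_onI)
    fix v w assume v: "v \<in> ?S" and w: "w \<in> ?S" and eq: "?h v = ?h w"
    have cont: "u \<in> sobolev_cont 2" if "u \<in> ?S" for u
      using that smooth_has_vector_derivative[of u 0]
      by (auto simp: sobolev_cont_def intro!: continuous_at_imp_continuous_on has_vector_derivative_continuous)
    let ?z = "\<lambda>x. v x + (-1) * w x"
    have z: "?z \<in> sobolev_cont 2"
      using sobolev_cont_add(1)[OF cont[OF v] sobolev_cont_cmult(1)[OF cont[OF w], where c = "-1"]] by simp
    have zs: "?z \<in> smooth"
      using smooth_diff(1)[of v w] v w by simp
    have z2: "?z x - (Dx ^^ 2) ?z x = 0" for x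
      using smooth_diff(2)[of v w 2] v w fun_cong[OF eq, of x] by (simp add: algebra_simps)
    have "cmod (?z x) \<le> 0" for x
    proof (rule helmholtz_bound)
      show "(?z has_vector_derivative Dx ?z x) (at x)" "(Dx ?z has_vector_derivative (Dx ^^ 2) ?z x) (at x)" for x
        using smooth_has_vector_derivative[OF zs, of 0] smooth_has_vector_derivative[OF zs, of 1]
        by (simp_all add: numeral_2_eq_2)
      show "cmod (?z x) \<le> embedding_const * sobolev_norm 2 ?z" for x
        by (rule sobolev_sup_bound[OF z]) simp
      show "cmod (Dx ?z x) \<le> embedding_const * sobolev_norm 1 (Dx ?z)" for x
        using sobolev_cont_Dx(2)[OF z] by (intro sobolev_sup_bound) simp_all
      show "cmod (?z x - (Dx ^^ 2) ?z x) \<le> 0" for x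
        unfolding z2 by simp
    qed
    then show "v = w" by (auto simp: fun_eq_iff)
  qed
  have "smoothing f \<in> sobolev_smooth 2"
    using sobolev_smooth_mono[OF sobolev_smooth_smoothing(2)[OF f r]] r by simp
  then have S: "smoothing f \<in> ?S"
    using sobolev_smooth_cont[of "smoothing f" 2 0] by (auto simp: sobolev_smooth_def sobolev_cont_def)
  have "?h (smoothing f) = Dx f"
    unfolding D2 using smoothing_helmholtz[OF sobolev_smooth_cont[OF f, of 0] r] by auto
  then show ?thesis
    unfolding helmholtz_inv_def using inv_into_f_f[OF inj S] by simp
qed

text \<open>This characterisation replaces computations with symbols wherever \<open>smoothing\<close> meets another
  operation: differences and limits of series.\<close>

lemma smoothing_unique:
  assumes w: "w \<in> sobolev_smooth q" and q: "q \<ge> 1" and f: "f \<in> sobolev_smooth r" and r: "r \<ge> 2"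
    and eq: "\<And>x. w x - Dx (Dx w) x = Dx f x"
  shows "w = smoothing f"
proof
  fix x
  note S = sobolev_smooth_smoothing(2)[OF f r]
  let ?z = "\<lambda>x. w x - smoothing f x"
  have D: "(Dx ^^ k) ?z = (\<lambda>x. (Dx ^^ k) w x - (Dx ^^ k) (smoothing f) x)" for k
    by (rule smooth_diff(2)[OF sobolev_smooth_smooth[OF w] sobolev_smooth_smooth[OF S]])
  have zs: "?z \<in> smooth"
    by (rule smooth_diff(1)[OF sobolev_smooth_smooth[OF w] sobolev_smooth_smooth[OF S]])
  have B: "\<exists>B. \<forall>x. cmod ((Dx ^^ k) ?z x) \<le> B" for k
  proof (intro exI allI)
    show "cmod ((Dx ^^ k) ?z x) \<le> embedding_const * sobolev_norm q ((Dx ^^ k) w) +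
        embedding_const * sobolev_norm (r + 1) ((Dx ^^ k) (smoothing f))" for x
      unfolding D using r
      by (intro order_trans[OF norm_triangle_ineq4] add_mono sobolev_smooth_sup_bound[OF q w] sobolev_smooth_sup_bound[OF _ S]) simp
  qed
  obtain B0 where B0: "\<And>x. cmod (?z x) \<le> B0"
    using B[of 0] by auto
  obtain B1 where B1: "\<And>x. cmod (Dx ?z x) \<le> B1"
    using B[of 1] by auto
  have "cmod (?z x) \<le> 0"
  proof (rule helmholtz_bound[OF _ _ B0 B1])
    show "(?z has_vector_derivative Dx ?z x) (at x)" "(Dx ?z has_vector_derivative (Dx ^^ 2) ?z x) (at x)" for x
      using smooth_has_vector_derivative[OF zs, of 0] smooth_has_vector_derivative[OF zs, of 1]
      by (simp_all add: numeral_2_eq_2)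
    show "cmod (?z x - (Dx ^^ 2) ?z x) \<le> 0" for x
    proof -
      have "?z x - (Dx ^^ 2) ?z x = (w x - Dx (Dx w) x) - (smoothing f x - Dx (Dx (smoothing f)) x)"
        unfolding D by (simp add: numeral_2_eq_2)
      also have "\<dots> = 0"
        using eq[of x] smoothing_helmholtz[OF sobolev_smooth_cont[OF f, of 0] r, of x] by simp
      finally show ?thesis by simp
    qed
  qed
  then show "w x = smoothing f x" by simp
qed

section \<open>Majorants for the Taylor coefficients in time\<close>

text \<open>The numbers \<open>\<phi> k\<close> are to be read as the coefficients of a power series \<open>\<Sum>k. \<phi> k * y ^ k\<close> that majorises the
  formal Taylor series \<open>\<Sum>k. (Dx ^^ k) f * y ^ k / fact k\<close> of \<open>f (x + y)\<close> coefficient by coefficient in the norm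
  of the Sobolev space of order \<open>r\<close>.\<close>

definition dominated :: "real \<Rightarrow> (real \<Rightarrow> complex) \<Rightarrow> (nat \<Rightarrow> real) \<Rightarrow> bool" where
  "dominated r f \<phi> \<longleftrightarrow> f \<in> sobolev_smooth r \<and> (\<forall>k. sobolev_norm r ((Dx ^^ k) f) / fact k \<le> \<phi> k)"

lemma dominatedD:
  assumes "dominated r f \<phi>"
  shows "f \<in> sobolev_smooth r" "sobolev_norm r ((Dx ^^ k) f) / fact k \<le> \<phi> k" "\<phi> k \<ge> 0"
proof -
  show *: "f \<in> sobolev_smooth r" "sobolev_norm r ((Dx ^^ k) f) / fact k \<le> \<phi> k"
    using assms by (auto simp: dominated_def)
  show "\<phi> k \<ge> 0"
    by (rule order_trans[OF _ *(2)]) simp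
qed

lemma dominated_mono:
  "dominated r f \<phi> \<Longrightarrow> (\<And>k. \<phi> k \<le> \<psi> k) \<Longrightarrow> dominated r f \<psi>"
  unfolding dominated_def by (meson order_trans)

lemma dominated_lower_order:
  assumes "dominated r f \<phi>" "1 \<le> q" "q \<le> r"
  shows "dominated q f \<phi>"
  unfolding dominated_def
proof (intro conjI allI)
  show "f \<in> sobolev_smooth q"
    using assms by (auto intro: sobolev_smooth_mono dominatedD)
  fix k
  have "sobolev_norm q ((Dx ^^ k) f) / fact k \<le> sobolev_norm r ((Dx ^^ k) f) / fact k"
    by (intro divide_right_mono sobolev_cont_mono(2)[OF sobolev_smooth_cont] dominatedD(1)[OF assms(1)] assms) simp
  also have "\<dots> \<le> \<phi> k" by (rule dominatedD[OF assms(1)])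
  finally show "sobolev_norm q ((Dx ^^ k) f) / fact k \<le> \<phi> k" .
qed

text \<open>The quadratic term in \<open>Dx u\<close> of the flux costs no power of \<open>y\<close>: its derivative is paid for with one
  Sobolev order, which \<open>smoothing\<close> gives back.\<close>

lemma dominated_Dx_lower_order:
  assumes "dominated r f \<phi>" "2 \<le> r"
  shows "dominated (r - 1) (Dx f) \<phi>"
  unfolding dominated_def
proof (intro conjI allI)
  note f = dominatedD(1)[OF assms(1)]
  have D: "(Dx ^^ k) (Dx f) = Dx ((Dx ^^ k) f)" for k
    by (simp add: funpow_swap1)
  note d = sobolev_cont_Dx[OF sobolev_smooth_cont[OF f] assms(2)]
  show "Dx f \<in> sobolev_smooth (r - 1)"
    by (intro sobolev_smoothI smooth_Dx sobolev_smooth_smooth[OF f]) (auto simp only: D d)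
  fix k
  have "sobolev_norm (r - 1) ((Dx ^^ k) (Dx f)) / fact k \<le> sobolev_norm r ((Dx ^^ k) f) / fact k"
    unfolding D by (intro divide_right_mono d) simp
  also have "\<dots> \<le> \<phi> k" by (rule dominatedD[OF assms(1)])
  finally show "sobolev_norm (r - 1) ((Dx ^^ k) (Dx f)) / fact k \<le> \<phi> k" .
qed

lemma dominated_smoothing:
  assumes "dominated (r - 1) f \<phi>" "3 \<le> r"
  shows "dominated r (smoothing f) \<phi>"
  unfolding dominated_def
proof (intro conjI allI)
  note f = dominatedD(1)[OF assms(1)]
  have r: "r - 1 \<ge> 2" using assms(2) by simp
  note s = sobolev_smooth_smoothing[OF f r]
  show "smoothing f \<in> sobolev_smooth r"
    using s(2) by simp
  fix k
  have "sobolev_norm r (smoothing ((Dx ^^ k) f)) \<le> sobolev_norm (r - 1) ((Dx ^^ k) f)"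
    using smoothing_sobolev(2)[OF sobolev_smooth_cont[OF f, of k]] r by simp
  then have "sobolev_norm r ((Dx ^^ k) (smoothing f)) / fact k \<le> sobolev_norm (r - 1) ((Dx ^^ k) f) / fact k"
    unfolding s(1) by (intro divide_right_mono) simp_all
  also have "\<dots> \<le> \<phi> k" by (rule dominatedD[OF assms(1)])
  finally show "sobolev_norm r ((Dx ^^ k) (smoothing f)) / fact k \<le> \<phi> k" .
qed

lemma dominated_Dx:
  assumes "dominated r f \<phi>" "1 \<le> r"
  shows "dominated r (Dx f) (\<lambda>k. real (Suc k) * \<phi> (Suc k))"
  unfolding dominated_def
proof (intro conjI allI)
  note f = dominatedD(1)[OF assms(1)]
  show "Dx f \<in> sobolev_smooth r"
    by (rule sobolev_smooth_Dx[OF assms(2) f])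
  fix k
  have "sobolev_norm r ((Dx ^^ k) (Dx f)) / fact k = real (Suc k) * (sobolev_norm r ((Dx ^^ Suc k) f) / fact (Suc k))"
    unfolding Dx_funpow_Dx by (simp del: funpow.simps of_nat_Suc)
  also have "\<dots> \<le> real (Suc k) * \<phi> (Suc k)"
    by (intro mult_left_mono dominatedD[OF assms(1)]) simp
  finally show "sobolev_norm r ((Dx ^^ k) (Dx f)) / fact k \<le> real (Suc k) * \<phi> (Suc k)" .
qed

context
  fixes r :: real
  assumes r1: "r \<ge> 1"
begin

lemma dominated_add:
  assumes f: "dominated r f \<phi>" and g: "dominated r g \<psi>"
  shows "dominated r (\<lambda>x. f x + g x) (\<lambda>k. \<phi> k + \<psi> k)"
  unfolding dominated_def
proof (intro conjI allI)
  note fg = dominatedD(1)[OF f] dominatedD(1)[OF g]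
  show "(\<lambda>x. f x + g x) \<in> sobolev_smooth r"
    by (rule sobolev_smooth_add[OF r1 fg])
  fix k
  have "sobolev_norm r ((Dx ^^ k) (\<lambda>x. f x + g x)) / fact k \<le> (sobolev_norm r ((Dx ^^ k) f) + sobolev_norm r ((Dx ^^ k) g)) / fact k"
    unfolding smooth_add(2)[OF fg[THEN sobolev_smooth_smooth]]
    by (intro divide_right_mono sobolev_cont_add(2)[OF sobolev_smooth_cont[OF fg(1)] sobolev_smooth_cont[OF fg(2)] r1]) simp
  also have "\<dots> \<le> \<phi> k + \<psi> k"
    unfolding add_divide_distrib by (intro add_mono dominatedD f g)
  finally show "sobolev_norm r ((Dx ^^ k) (\<lambda>x. f x + g x)) / fact k \<le> \<phi> k + \<psi> k" .
qed

lemma dominated_cmult: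
  assumes f: "dominated r f \<phi>"
  shows "dominated r (\<lambda>x. c * f x) (\<lambda>k. cmod c * \<phi> k)"
  unfolding dominated_def
proof (intro conjI allI)
  note f' = dominatedD(1)[OF f]
  show "(\<lambda>x. c * f x) \<in> sobolev_smooth r"
    by (rule sobolev_smooth_cmult[OF r1 f'])
  fix k
  have "sobolev_norm r ((Dx ^^ k) (\<lambda>x. c * f x)) / fact k = cmod c * (sobolev_norm r ((Dx ^^ k) f) / fact k)"
    unfolding smooth_cmult(2)[OF sobolev_smooth_smooth[OF f']] sobolev_cont_cmult(2)[OF sobolev_smooth_cont[OF f'] r1]
    by simp
  also have "\<dots> \<le> cmod c * \<phi> k"
    by (intro mult_left_mono dominatedD(2)[OF f]) simp
  finally show "sobolev_norm r ((Dx ^^ k) (\<lambda>x. c * f x)) / fact k \<le> cmod c * \<phi> k" .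
qed

lemma dominated_zero: "dominated r (\<lambda>x. 0) (\<lambda>k. 0)"
  unfolding dominated_def using sobolev_smooth_zero[OF r1] sobolev_cont_zero[OF r1] by simp

lemma dominated_sum:
  assumes "\<And>i. i \<in> A \<Longrightarrow> dominated r (f i) (\<phi> i)"
  shows "dominated r (\<lambda>x. \<Sum>i\<in>A. f i x) (\<lambda>k. \<Sum>i\<in>A. \<phi> i k)"
  using assms
proof (induction A rule: infinite_finite_induct)
  case (insert a A)
  then show ?case
    using dominated_add[of "f a" "\<phi> a" "\<lambda>x. \<Sum>i\<in>A. f i x" "\<lambda>k. \<Sum>i\<in>A. \<phi> i k"] by auto
qed (auto simp: dominated_zero)

text \<open>With the factor \<open>1 / k!\<close>, Leibniz' rule turns products into products of power series.\<close>

lemma dominated_mult: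
  assumes f: "dominated r f \<phi>" and g: "dominated r g \<psi>"
  shows "dominated r (\<lambda>x. f x * g x) (\<lambda>k. algebra_const r * (\<Sum>i\<le>k. \<phi> i * \<psi> (k - i)))"
  unfolding dominated_def
proof (intro conjI allI)
  note fg = dominatedD(1)[OF f] dominatedD(1)[OF g]
  show "(\<lambda>x. f x * g x) \<in> sobolev_smooth r"
    by (rule sobolev_smooth_mult(1)[OF r1 fg])
  fix k
  let ?F = "\<lambda>i. sobolev_norm r ((Dx ^^ i) f)" and ?G = "\<lambda>i. sobolev_norm r ((Dx ^^ i) g)"
  have "sobolev_norm r ((Dx ^^ k) (\<lambda>x. f x * g x)) / fact k \<le>
      (algebra_const r * (\<Sum>i\<le>k. real (k choose i) * (?F i * ?G (k - i)))) / fact k"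
    by (intro divide_right_mono sobolev_smooth_mult(2)[OF r1 fg]) simp
  also have "\<dots> = algebra_const r * (\<Sum>i\<le>k. (?F i / fact i) * (?G (k - i) / fact (k - i)))"
  proof -
    have "real (k choose i) * (?F i * ?G (k - i)) / fact k = (?F i / fact i) * (?G (k - i) / fact (k - i))"
      if "i \<le> k" for i
      using binomial_fact[OF that, where ?'a = real] by (simp add: field_simps)
    then show ?thesis
      unfolding times_divide_eq_right[symmetric] sum_divide_distrib by simp
  qed
  also have "\<dots> \<le> algebra_const r * (\<Sum>i\<le>k. \<phi> i * \<psi> (k - i))"
    by (intro mult_left_mono sum_mono mult_mono dominatedD[OF f] dominatedD[OF g]) simp_all
  finally show "sobolev_norm r ((Dx ^^ k) (\<lambda>x. f x * g x)) / fact k \<le> algebra_const r * (\<Sum>i\<le>k. \<phi> i * \<psi> (k - i))" .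
qed

end

definition inv_sq :: "nat \<Rightarrow> real" where
  "inv_sq m = 1 / (real m + 1)\<^sup>2"

text \<open>The coefficient of \<open>t ^ n * y ^ k\<close> in \<open>N * E (y + K * t)\<close>, where \<open>E\<close> is the power series with the
  coefficients \<open>inv_sq\<close>. A function of \<open>y + K * t\<close> solves a transport equation, as a majorant of a system
  that loses one derivative in \<open>x\<close> should.\<close>

definition majorant :: "real \<Rightarrow> real \<Rightarrow> nat \<Rightarrow> nat \<Rightarrow> real" where
  "majorant N K n k = N * K ^ n * real (n + k choose k) * inv_sq (n + k)"

lemma inv_sq_pos [simp]: "inv_sq m > 0"
  by (simp add: inv_sq_def add_nonneg_pos)

lemma inv_sq_nonneg [simp]: "inv_sq m \<ge> 0"
  by (simp add: less_imp_le)

lemma sum_inv_sq_le: "(\<Sum>m\<le>L. inv_sq m) \<le> 2"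
proof -
  have "(\<Sum>m\<le>L. inv_sq m) \<le> 2 - 1 / (real L + 1)"
  proof (induction L)
    case (Suc L)
    have "inv_sq (Suc L) \<le> 1 / (real L + 1) - 1 / (real (Suc L) + 1)"
    proof -
      have "inv_sq (Suc L) = 1 / ((real L + 2) * (real L + 2))"
        by (simp add: inv_sq_def power2_eq_square add.commute)
      also have "\<dots> \<le> 1 / ((real L + 1) * (real L + 2))"
        by (intro divide_left_mono mult_right_mono) auto
      also have "\<dots> = 1 / (real L + 1) - 1 / (real (Suc L) + 1)"
        by (simp add: field_simps)
      finally show ?thesis .
    qed
    then show ?case using Suc by simp
  qed (simp add: inv_sq_def)
  also have "\<dots> \<le> 2" by simp
  finally show ?thesis .
qed

text \<open>With \<open>a = m + 1\<close> and \<open>b = L - m + 1\<close> this is \<open>(1 / a + 1 / b)\<^sup>2 \<le> 2 / a\<^sup>2 + 2 / b\<^sup>2\<close>: the larger of the two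
  indices carries the decay in \<open>L\<close>.\<close>

lemma inv_sq_mult_le:
  assumes "m \<le> L"
  shows "inv_sq m * inv_sq (L - m) \<le> (2 * inv_sq m + 2 * inv_sq (L - m)) * inv_sq L"
proof -
  define a where "a = real m + 1"
  define b where "b = real (L - m) + 1"
  have a: "a > 0" and b: "b > 0" by (auto simp: a_def b_def)
  have L: "real L + 1 \<le> a + b" "0 < real L + 1"
    using assms by (auto simp: a_def b_def of_nat_diff)
  have "1 / a\<^sup>2 * (1 / b\<^sup>2) = (1 / a + 1 / b)\<^sup>2 * (1 / (a + b)\<^sup>2)"
  proof -
    have "1 / a + 1 / b = (a + b) / (a * b)"
      using a b by (simp add: field_simps)
    then have "(1 / a + 1 / b)\<^sup>2 = (a + b)\<^sup>2 / (a\<^sup>2 * b\<^sup>2)"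
      by (simp add: power_divide power_mult_distrib)
    moreover have "(a + b)\<^sup>2 \<noteq> 0" using a b by simp
    ultimately show ?thesis by simp
  qed
  also have "\<dots> \<le> (2 * (1 / a\<^sup>2) + 2 * (1 / b\<^sup>2)) * (1 / (real L + 1)\<^sup>2)"
  proof (rule mult_mono)
    show "(1 / a + 1 / b)\<^sup>2 \<le> 2 * (1 / a\<^sup>2) + 2 * (1 / b\<^sup>2)"
      using zero_le_power2[of "1 / a - 1 / b"] by (simp add: power2_eq_square algebra_simps)
    show "1 / (a + b)\<^sup>2 \<le> 1 / (real L + 1)\<^sup>2"
      using L by (intro divide_left_mono power_mono mult_pos_pos) auto
  qed simp_all
  finally show ?thesis
    by (simp add: inv_sq_def a_def b_def)
qed

lemma sum_inv_sq_mult_le: "(\<Sum>m\<le>L. inv_sq m * inv_sq (L - m)) \<le> 8 * inv_sq L"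
proof -
  have "(\<Sum>m\<le>L. inv_sq m * inv_sq (L - m)) \<le> (\<Sum>m\<le>L. (2 * inv_sq m + 2 * inv_sq (L - m)) * inv_sq L)"
    by (intro sum_mono inv_sq_mult_le) simp
  also have "\<dots> = (2 * (\<Sum>m\<le>L. inv_sq m) + 2 * (\<Sum>m\<le>L. inv_sq (L - m))) * inv_sq L"
    by (simp add: sum_distrib_right sum_distrib_left sum.distrib distrib_right)
  also have "(\<Sum>m\<le>L. inv_sq (L - m)) = (\<Sum>m\<le>L. inv_sq m)"
    by (rule sum.nat_diff_reindex[of inv_sq "Suc L", unfolded lessThan_Suc_atMost diff_Suc_Suc, simplified])
  also have "(2 * (\<Sum>m\<le>L. inv_sq m) + 2 * (\<Sum>m\<le>L. inv_sq m)) * inv_sq L \<le> (2 * 2 + 2 * 2) * inv_sq L"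
    by (intro mult_right_mono add_mono mult_left_mono sum_inv_sq_le) simp_all
  finally show ?thesis by simp
qed

text \<open>The majorant absorbs its own square.  Vandermonde's identity performs the
  summation over the terms of fixed total degree.\<close>

lemma majorant_convolution:
  assumes N: "N \<ge> 0" and K: "K \<ge> 0"
  shows "(\<Sum>i\<le>n. \<Sum>j\<le>k. majorant N K i j * majorant N K (n - i) (k - j)) \<le> 8 * N * majorant N K n k"
proof -
  let ?L = "n + k"
  define g where "g j m = real ((m choose j) * (?L - m choose (k - j))) * (inv_sq m * inv_sq (?L - m))" for j m
  have g0: "g j m \<ge> 0" for j m
    by (simp add: g_def)
  have t: "majorant N K i j * majorant N K (n - i) (k - j) = N\<^sup>2 * K ^ n * g j (i + j)" if "i \<le> n" "j \<le> k" for i j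
  proof -
    have "n - i + (k - j) = ?L - (i + j)" using that by simp
    moreover have "K ^ i * K ^ (n - i) = K ^ n"
      using that by (simp add: power_add[symmetric])
    moreover have "majorant N K i j * majorant N K (n - i) (k - j) =
      N\<^sup>2 * (K ^ i * K ^ (n - i)) * (real (i + j choose j) * real (n - i + (k - j) choose (k - j))) * (inv_sq (i + j) * inv_sq (n - i + (k - j)))"
      by (simp add: majorant_def power2_eq_square)
    ultimately show ?thesis
      by (simp add: g_def)
  qed
  have shift: "(\<Sum>i\<le>n. g j (i + j)) \<le> (\<Sum>m\<le>?L. g j m)" if "j \<le> k" for j
  proof -
    have "(\<Sum>i\<le>n. g j (i + j)) = (\<Sum>m\<in>(\<lambda>i. i + j) ` {..n}. g j m)"
      by (subst sum.reindex) (auto intro: inj_onI)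
    also have "\<dots> \<le> (\<Sum>m\<le>?L. g j m)"
      using that by (intro sum_mono2) (auto simp: g0)
    finally show ?thesis .
  qed
  have "(\<Sum>i\<le>n. \<Sum>j\<le>k. majorant N K i j * majorant N K (n - i) (k - j)) = (\<Sum>i\<le>n. \<Sum>j\<le>k. N\<^sup>2 * K ^ n * g j (i + j))"
    by (intro sum.cong refl t) auto
  also have "\<dots> = N\<^sup>2 * K ^ n * (\<Sum>j\<le>k. \<Sum>i\<le>n. g j (i + j))"
    by (subst sum.swap) (simp add: sum_distrib_left)
  also have "\<dots> \<le> N\<^sup>2 * K ^ n * (\<Sum>j\<le>k. \<Sum>m\<le>?L. g j m)"
    using K by (intro mult_left_mono sum_mono shift) auto
  also have "(\<Sum>j\<le>k. \<Sum>m\<le>?L. g j m) = (\<Sum>m\<le>?L. \<Sum>j\<le>k. g j m)"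
    by (rule sum.swap)
  also have "\<dots> = (\<Sum>m\<le>?L. real (?L choose k) * (inv_sq m * inv_sq (?L - m)))"
  proof (intro sum.cong refl)
    fix m assume "m \<in> {..?L}"
    then have "(\<Sum>j\<le>k. (m choose j) * (?L - m choose (k - j))) = (?L choose k)"
      using vandermonde[of m "?L - m" k] by simp
    then show "(\<Sum>j\<le>k. g j m) = real (?L choose k) * (inv_sq m * inv_sq (?L - m))"
      unfolding g_def sum_distrib_right[symmetric] of_nat_sum[symmetric] by simp
  qed
  also have "\<dots> = real (?L choose k) * (\<Sum>m\<le>?L. inv_sq m * inv_sq (?L - m))"
    by (rule sum_distrib_left[symmetric])
  also have "N\<^sup>2 * K ^ n * \<dots> \<le> N\<^sup>2 * K ^ n * (real (?L choose k) * (8 * inv_sq ?L))"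
    using K by (intro mult_left_mono sum_inv_sq_mult_le) auto
  also have "\<dots> = 8 * N * majorant N K n k"
    by (simp add: majorant_def power2_eq_square)
  finally show ?thesis .
qed

lemma majorant_nonneg: "N \<ge> 0 \<Longrightarrow> K \<ge> 0 \<Longrightarrow> majorant N K n k \<ge> 0"
  by (simp add: majorant_def)

text \<open>The two derivatives of a function of \<open>y + K t\<close> are proportional.\<close>

lemma majorant_shift: "real (Suc k) * majorant N K n (Suc k) * K = real (Suc n) * majorant N K (Suc n) k"
proof -
  have "real (Suc k) * real (n + Suc k choose Suc k) = real (Suc n) * real (Suc n + k choose k)"
  proof -
    have "Suc k * (Suc (n + k) choose Suc k) = Suc (n + k) * (n + k choose k)"
      by (rule Suc_times_binomial_eq[symmetric, of "n + k" k, unfolded mult.commute[of _ "Suc k"]])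
    moreover have "Suc n * (Suc (n + k) choose Suc n) = Suc (n + k) * (n + k choose n)"
      by (rule Suc_times_binomial_eq[symmetric, of "n + k" n, unfolded mult.commute[of _ "Suc n"]])
    moreover have "(n + k choose n) = (n + k choose k)" "(Suc (n + k) choose Suc n) = (Suc (n + k) choose k)"
      using binomial_symmetric[of n "n + k"] binomial_symmetric[of "Suc n" "Suc (n + k)"] by simp_all
    ultimately have "Suc k * (n + Suc k choose Suc k) = Suc n * (Suc n + k choose k)"
      by simp
    then show ?thesis
      unfolding of_nat_mult[symmetric] by (simp only:)
  qed
  then show ?thesis
    by (simp add: majorant_def)
qed

text \<open>Terms without a loss of derivative are absorbed as well, because \<open>inv_sq\<close> decreases slowly.\<close>

lemma majorant_Suc:
  assumes N: "N \<ge> 0" and K: "K > 0"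
  shows "majorant N K n k \<le> 4 / K * majorant N K (Suc n) k"
proof -
  have e: "inv_sq m \<le> 4 * inv_sq (Suc m)" for m
  proof -
    have "inv_sq m = 4 / (2 * (real m + 1))\<^sup>2"
      unfolding inv_sq_def power_mult_distrib by simp
    also have "\<dots> \<le> 4 / (real m + 2)\<^sup>2"
      by (intro divide_left_mono power_mono mult_pos_pos zero_less_power) auto
    finally show ?thesis
      by (simp add: inv_sq_def add.commute)
  qed
  have "(n + k choose k) \<le> (Suc n + k choose k)"
    by (cases k) simp_all
  then have "real (n + k choose k) * inv_sq (n + k) \<le> real (Suc n + k choose k) * (4 * inv_sq (Suc (n + k)))"
    by (intro mult_mono e) simp_all
  then have "N * K ^ n * (real (n + k choose k) * inv_sq (n + k)) \<le> N * K ^ n * (real (Suc n + k choose k) * (4 * inv_sq (Suc (n + k))))"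
    using N K by (intro mult_left_mono) auto
  then show ?thesis
    using K by (simp add: majorant_def field_simps)
qed

definition cauchy_product ::
    "(nat \<Rightarrow> real \<Rightarrow> complex) \<Rightarrow> (nat \<Rightarrow> real \<Rightarrow> complex) \<Rightarrow> nat \<Rightarrow> real \<Rightarrow> complex" where
  "cauchy_product a b n x = (\<Sum>i\<le>n. a i x * b (n - i) x)"

lemma dominated_cauchy_product:
  assumes r: "r \<ge> 1" and a: "\<And>i. i \<le> n \<Longrightarrow> dominated r (a i) (majorant N K i)"
    and b: "\<And>i. i \<le> n \<Longrightarrow> dominated r (b i) (majorant N K i)" and N: "N \<ge> 0" and K: "K \<ge> 0"
    and A: "algebra_const r \<le> A"
  shows "dominated r (cauchy_product a b n) (\<lambda>k. 8 * A * N * majorant N K n k)"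
proof -
  have "dominated r (cauchy_product a b n) (\<lambda>k. \<Sum>i\<le>n. algebra_const r * (\<Sum>j\<le>k. majorant N K i j * majorant N K (n - i) (k - j)))"
    unfolding cauchy_product_def[abs_def] by (intro dominated_sum dominated_mult r a b) auto
  then show ?thesis
  proof (rule dominated_mono)
    fix k
    have "(\<Sum>i\<le>n. algebra_const r * (\<Sum>j\<le>k. majorant N K i j * majorant N K (n - i) (k - j))) =
      algebra_const r * (\<Sum>i\<le>n. \<Sum>j\<le>k. majorant N K i j * majorant N K (n - i) (k - j))"
      by (rule sum_distrib_left[symmetric])
    also have "\<dots> \<le> A * (8 * N * majorant N K n k)"
      using A order_trans[OF algebra_const_nonneg A]
      by (intro mult_mono majorant_convolution N K sum_nonneg mult_nonneg_nonneg majorant_nonneg)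
    finally show "(\<Sum>i\<le>n. algebra_const r * (\<Sum>j\<le>k. majorant N K i j * majorant N K (n - i) (k - j))) \<le> 8 * A * N * majorant N K n k"
      by (simp add: mult_ac)
  qed
qed

text \<open>The coefficients of \<open>CH_flux\<close> along power series in time with the coefficients \<open>a\<close> and \<open>b\<close>.\<close>

definition flux_coeff ::
    "real \<Rightarrow> real \<Rightarrow> (nat \<Rightarrow> real \<Rightarrow> complex) \<Rightarrow> (nat \<Rightarrow> real \<Rightarrow> complex) \<Rightarrow> nat \<Rightarrow> real \<Rightarrow> complex" where
  "flux_coeff \<alpha> \<beta> a b n x =
     - of_real \<alpha> * a n x + of_real ((3 - \<beta>) / 2) * cauchy_product a a n x
     + of_real (\<beta> / 2) * cauchy_product (\<lambda>i. Dx (a i)) (\<lambda>i. Dx (a i)) n x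
     + b n x + 1 / 2 * cauchy_product b b n x"

text \<open>Comparison of the coefficients of \<open>t ^ n\<close> in the system, with \<open>\<beta> * u * Dx u\<close> written as the derivative of
  \<open>\<beta> / 2 * u\<^sup>2\<close>, so that a single derivative falls on a product.\<close>

definition next_u ::
    "real \<Rightarrow> real \<Rightarrow> (nat \<Rightarrow> real \<Rightarrow> complex) \<Rightarrow> (nat \<Rightarrow> real \<Rightarrow> complex) \<Rightarrow> nat \<Rightarrow> real \<Rightarrow> complex" where
  "next_u \<alpha> \<beta> a b n x = of_real (- 1 / real (Suc n)) *
     (of_real (\<beta> / 2) * Dx (cauchy_product a a n) x + smoothing (flux_coeff \<alpha> \<beta> a b n) x)"

definition next_v ::
    "(nat \<Rightarrow> real \<Rightarrow> complex) \<Rightarrow> (nat \<Rightarrow> real \<Rightarrow> complex) \<Rightarrow> nat \<Rightarrow> real \<Rightarrow> complex" where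
  "next_v a b n x = of_real (- 1 / real (Suc n)) * Dx (\<lambda>y. a n y + cauchy_product a b n y) x"

lemma course_of_values_recursion:
  assumes G: "\<And>c d n. (\<And>i. i \<le> n \<Longrightarrow> c i = d i) \<Longrightarrow> G c n = G d n"
  obtains c :: "nat \<Rightarrow> 'a" where "c 0 = x0" "\<And>n. c (Suc n) = G c n"
proof -
  define h where "h = rec_nat (\<lambda>_. x0) (\<lambda>n hn. hn(Suc n := G hn n))"
  have h: "h 0 = (\<lambda>_. x0)" "h (Suc n) = (h n)(Suc n := G (h n) n)" for n
    by (simp_all add: h_def)
  have stable: "h (i + d) i = h i i" for d i
    by (induction d) (auto simp: h)
  define c where "c n = h n n" for n
  have "c (Suc n) = G c n" for n
  proof -
    have "G (h n) n = G c n"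
    proof (rule G)
      fix i assume "i \<le> n"
      then show "h n i = c i"
        using stable[of i "n - i"] by (simp add: c_def)
    qed
    then show ?thesis by (simp add: c_def h)
  qed
  moreover have "c 0 = x0" by (simp add: c_def h)
  ultimately show ?thesis by (rule that[rotated])
qed

lemma CH_coefficients_exist:
  obtains a b :: "nat \<Rightarrow> real \<Rightarrow> complex"
  where "a 0 = f" "b 0 = g" "\<And>n. a (Suc n) = next_u \<alpha> \<beta> a b n" "\<And>n. b (Suc n) = next_v a b n"
proof -
  define G where "G c n = (next_u \<alpha> \<beta> (\<lambda>i. fst (c i)) (\<lambda>i. snd (c i)) n, next_v (\<lambda>i. fst (c i)) (\<lambda>i. snd (c i)) n)"
    for c :: "nat \<Rightarrow> (real \<Rightarrow> complex) \<times> (real \<Rightarrow> complex)" and n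
  have cp: "cauchy_product a b n = cauchy_product a' b' n" if "\<And>i. i \<le> n \<Longrightarrow> a i = a' i" "\<And>i. i \<le> n \<Longrightarrow> b i = b' i"
    for a b a' b' n
    using that by (auto simp: cauchy_product_def fun_eq_iff)
  have "G c n = G d n" if "\<And>i. i \<le> n \<Longrightarrow> c i = d i" for c d n
  proof -
    note cps = cp[of n "\<lambda>i. fst (c i)" "\<lambda>i. fst (d i)" "\<lambda>i. fst (c i)" "\<lambda>i. fst (d i)"]
      cp[of n "\<lambda>i. snd (c i)" "\<lambda>i. snd (d i)" "\<lambda>i. snd (c i)" "\<lambda>i. snd (d i)"]
      cp[of n "\<lambda>i. fst (c i)" "\<lambda>i. fst (d i)" "\<lambda>i. snd (c i)" "\<lambda>i. snd (d i)"]
      cp[of n "\<lambda>i. Dx (fst (c i))" "\<lambda>i. Dx (fst (d i))" "\<lambda>i. Dx (fst (c i))" "\<lambda>i. Dx (fst (d i))"]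
    have fl: "flux_coeff \<alpha> \<beta> (\<lambda>i. fst (c i)) (\<lambda>i. snd (c i)) n = flux_coeff \<alpha> \<beta> (\<lambda>i. fst (d i)) (\<lambda>i. snd (d i)) n"
      unfolding flux_coeff_def[abs_def] using cps that by simp
    show ?thesis
      unfolding G_def next_u_def[abs_def] next_v_def[abs_def] fl using cps that by simp
  qed
  from course_of_values_recursion[of G "(f, g)", OF this]
  obtain c where c: "c 0 = (f, g)" "\<And>n. c (Suc n) = G c n"
    by blast
  show ?thesis
    by (rule that[of "\<lambda>i. fst (c i)" "\<lambda>i. snd (c i)"]) (simp_all add: c G_def)
qed

text \<open>Chosen so that the sum of the bounds for all terms of the recursion, in units of
  \<open>majorant N K (Suc n) k\<close>, is at most one when \<open>K = rate_const \<alpha> \<beta> r * (1 + N)\<close>.\<close>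

definition rate_const :: "real \<Rightarrow> real \<Rightarrow> real \<Rightarrow> real" where
  "rate_const \<alpha> \<beta> r = 4 * (\<bar>\<alpha>\<bar> + 1) +
     (algebra_const r + algebra_const (r - 1)) * (16 * (\<bar>3 - \<beta>\<bar> + \<bar>\<beta>\<bar> + 1) + 4 * \<bar>\<beta>\<bar> + 8)"

lemma rate_const_pos: "rate_const \<alpha> \<beta> r > 0"
  unfolding rate_const_def by (intro add_pos_nonneg mult_nonneg_nonneg add_nonneg_nonneg) auto

lemma dominated_flux_coeff:
  assumes r: "r \<ge> 3" and N: "N \<ge> 0" and K: "K \<ge> 0" and A: "A = algebra_const r + algebra_const (r - 1)"
    and a: "\<And>i. i \<le> n \<Longrightarrow> dominated r (a i) (majorant N K i)"
    and b: "\<And>i. i \<le> n \<Longrightarrow> dominated r (b i) (majorant N K i)"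
  shows "dominated (r - 1) (flux_coeff \<alpha> \<beta> a b n)
    (\<lambda>k. (\<bar>\<alpha>\<bar> + 1 + 4 * A * N * (\<bar>3 - \<beta>\<bar> + \<bar>\<beta>\<bar> + 1)) * majorant N K n k)"
proof -
  have r': "r - 1 \<ge> 1" "r - 1 \<le> r" "r \<ge> 2" using r by auto
  have A': "algebra_const (r - 1) \<le> A" by (simp add: A)
  have a': "dominated (r - 1) (a i) (majorant N K i)" and b': "dominated (r - 1) (b i) (majorant N K i)"
    and d': "dominated (r - 1) (Dx (a i)) (majorant N K i)" if "i \<le> n" for i
    using dominated_lower_order[OF a[OF that] r'(1,2)] dominated_lower_order[OF b[OF that] r'(1,2)]
      dominated_Dx_lower_order[OF a[OF that] r'(3)] by auto
  have "dominated (r - 1) (flux_coeff \<alpha> \<beta> a b n)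
    (\<lambda>k. cmod (- of_real \<alpha>) * majorant N K n k + cmod (of_real ((3 - \<beta>) / 2)) * (8 * A * N * majorant N K n k)
      + cmod (of_real (\<beta> / 2)) * (8 * A * N * majorant N K n k) + majorant N K n k + cmod (1 / 2) * (8 * A * N * majorant N K n k))"
    unfolding flux_coeff_def[abs_def]
    by (intro dominated_add dominated_cmult dominated_cauchy_product r'(1) a' b' d' N K A' order_refl)
  then show ?thesis
  proof (rule dominated_mono)
    fix k
    have "cmod (of_real ((3 - \<beta>) / 2)) = \<bar>3 - \<beta>\<bar> / 2" "cmod (of_real (\<beta> / 2)) = \<bar>\<beta>\<bar> / 2"
      by (simp_all only: norm_of_real abs_divide abs_numeral)
    then show "cmod (- of_real \<alpha>) * majorant N K n k + cmod (of_real ((3 - \<beta>) / 2)) * (8 * A * N * majorant N K n k)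
      + cmod (of_real (\<beta> / 2)) * (8 * A * N * majorant N K n k) + majorant N K n k + cmod (1 / 2) * (8 * A * N * majorant N K n k)
      \<le> (\<bar>\<alpha>\<bar> + 1 + 4 * A * N * (\<bar>3 - \<beta>\<bar> + \<bar>\<beta>\<bar> + 1)) * majorant N K n k"
      by (simp add: algebra_simps)
  qed
qed

text \<open>The induction that carries the proof: the recursion maps the majorant for the coefficients up
  to \<open>n\<close> into that for the coefficient \<open>n + 1\<close>, provided \<open>K\<close> is a large multiple of
  \<open>1 + N\<close>.\<close>

lemma dominated_coefficients:
  assumes r: "r \<ge> 3" and N: "N \<ge> 0" and K: "K = rate_const \<alpha> \<beta> r * (1 + N)"
    and a0: "dominated r (a 0) (\<lambda>k. N * inv_sq k)" and b0: "dominated r (b 0) (\<lambda>k. N * inv_sq k)"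
    and aS: "\<And>n. a (Suc n) = next_u \<alpha> \<beta> a b n" and bS: "\<And>n. b (Suc n) = next_v a b n"
  shows "dominated r (a n) (majorant N K n) \<and> dominated r (b n) (majorant N K n)"
proof (induction n rule: less_induct)
  case (less n)
  define A where "A = algebra_const r + algebra_const (r - 1)"
  have A0: "A \<ge> 0" and Ar: "algebra_const r \<le> A" by (simp_all add: A_def)
  have K0: "K > 0"
    using N rate_const_pos[of \<alpha> \<beta> r] unfolding K by (intro mult_pos_pos) auto
  have r1: "r \<ge> 1" using r by simp
  show ?case
  proof (cases n)
    case 0
    then show ?thesis using a0 b0 by (simp add: majorant_def)
  next
    case (Suc m)
    have IH: "dominated r (a i) (majorant N K i)" "dominated r (b i) (majorant N K i)" if "i \<le> m" for i
      using less.IH[of i] that Suc by auto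
    let ?M = "majorant N K (Suc m)"
    have M0: "?M k \<ge> 0" for k
      using N K0 by (intro majorant_nonneg) auto
    have "real (Suc m) > 0" by simp
    \<comment> \<open>the constants in front of the majorant, for the two equations\<close>
    have cK: "(\<bar>\<beta>\<bar> / 2 * (8 * A * N) + 4 * (\<bar>\<alpha>\<bar> + 1 + 4 * A * N * (\<bar>3 - \<beta>\<bar> + \<bar>\<beta>\<bar> + 1))) \<le> K"
      "1 + 8 * A * N \<le> K"
    proof -
      have K': "K = (4 * (\<bar>\<alpha>\<bar> + 1) + A * (16 * (\<bar>3 - \<beta>\<bar> + \<bar>\<beta>\<bar> + 1) + 4 * \<bar>\<beta>\<bar> + 8)) * (1 + N)"
        by (simp add: K rate_const_def A_def)
      have "K = (\<bar>\<beta>\<bar> / 2 * (8 * A * N) + 4 * (\<bar>\<alpha>\<bar> + 1 + 4 * A * N * (\<bar>3 - \<beta>\<bar> + \<bar>\<beta>\<bar> + 1)))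
        + (A * (16 * (\<bar>3 - \<beta>\<bar> + \<bar>\<beta>\<bar> + 1) + 4 * \<bar>\<beta>\<bar> + 8) + 8 * (A * N) + 4 * (\<bar>\<alpha>\<bar> + 1) * N)"
        unfolding K' by (simp add: algebra_simps)
      moreover have "A * (16 * (\<bar>3 - \<beta>\<bar> + \<bar>\<beta>\<bar> + 1) + 4 * \<bar>\<beta>\<bar> + 8) + 8 * (A * N) + 4 * (\<bar>\<alpha>\<bar> + 1) * N \<ge> 0"
        using A0 N by (intro add_nonneg_nonneg mult_nonneg_nonneg) auto
      ultimately show "(\<bar>\<beta>\<bar> / 2 * (8 * A * N) + 4 * (\<bar>\<alpha>\<bar> + 1 + 4 * A * N * (\<bar>3 - \<beta>\<bar> + \<bar>\<beta>\<bar> + 1))) \<le> K"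
        by linarith
      have "K = (1 + 8 * A * N) + (3 + 4 * \<bar>\<alpha>\<bar> + 4 * (\<bar>\<alpha>\<bar> + 1) * N + A * (16 * (\<bar>3 - \<beta>\<bar> + \<bar>\<beta>\<bar> + 1) + 4 * \<bar>\<beta>\<bar>) * (1 + N) + 8 * A)"
        unfolding K' by (simp add: algebra_simps)
      moreover have "3 + 4 * \<bar>\<alpha>\<bar> + 4 * (\<bar>\<alpha>\<bar> + 1) * N + A * (16 * (\<bar>3 - \<beta>\<bar> + \<bar>\<beta>\<bar> + 1) + 4 * \<bar>\<beta>\<bar>) * (1 + N) + 8 * A \<ge> 0"
        using A0 N by (intro add_nonneg_nonneg mult_nonneg_nonneg) auto
      ultimately show "1 + 8 * A * N \<le> K"
        by linarith
    qed
    have shift: "real (Suc k) * majorant N K m (Suc k) = real (Suc m) / K * ?M k" for k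
      using majorant_shift[of k N K m] K0 by (simp add: field_simps)
    have Suc_le: "majorant N K m k \<le> real (Suc m) / K * (4 * ?M k)" for k
    proof -
      have "majorant N K m k \<le> 4 / K * ?M k"
        by (rule majorant_Suc[OF N K0])
      also have "\<dots> \<le> real (Suc m) * (4 / K * ?M k)"
        using mult_right_mono[of 1 "real (Suc m)" "4 / K * ?M k"] M0[of k] K0 by simp
      finally show ?thesis by (simp add: mult_ac)
    qed
    have "dominated r (a (Suc m)) (\<lambda>k. cmod (of_real (- 1 / real (Suc m))) *
       (cmod (of_real (\<beta> / 2)) * (real (Suc k) * (8 * A * N * majorant N K m (Suc k)))
        + (\<bar>\<alpha>\<bar> + 1 + 4 * A * N * (\<bar>3 - \<beta>\<bar> + \<bar>\<beta>\<bar> + 1)) * majorant N K m k))"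
      unfolding aS next_u_def[abs_def]
      by (intro dominated_cmult dominated_add dominated_Dx dominated_smoothing dominated_cauchy_product
          dominated_flux_coeff IH r r1 N A_def Ar order.strict_implies_order[OF K0])
    then have "dominated r (a (Suc m)) ?M"
    proof (rule dominated_mono)
      fix k
      let ?C = "\<bar>\<alpha>\<bar> + 1 + 4 * A * N * (\<bar>3 - \<beta>\<bar> + \<bar>\<beta>\<bar> + 1)"
      have C0: "?C \<ge> 0" using A0 N by (intro add_nonneg_nonneg mult_nonneg_nonneg) auto
      have n: "cmod (of_real (- 1 / real (Suc m))) = 1 / real (Suc m)" "cmod (of_real (\<beta> / 2)) = \<bar>\<beta>\<bar> / 2"
        unfolding norm_of_real by (simp_all add: abs_divide)
      have "\<bar>\<beta>\<bar> / 2 * (real (Suc k) * (8 * A * N * majorant N K m (Suc k))) + ?C * majorant N K m k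
        \<le> \<bar>\<beta>\<bar> / 2 * (8 * A * N) * (real (Suc m) / K * ?M k) + ?C * (real (Suc m) / K * (4 * ?M k))"
        using mult_left_mono[OF Suc_le C0, of k] unfolding shift[symmetric] by (simp add: mult_ac)
      also have "\<dots> = (\<bar>\<beta>\<bar> / 2 * (8 * A * N) + 4 * ?C) * (real (Suc m) / K * ?M k)"
      proof -
        have "x * z + y * (4 * z) = (x + 4 * y) * z" for x y z :: real
          by (simp add: algebra_simps)
        then show ?thesis
          unfolding mult.left_commute[of "real (Suc m) / K" 4] .
      qed
      also have "\<dots> \<le> K * (real (Suc m) / K * ?M k)"
        using K0 M0[of k] by (intro mult_right_mono cK) auto
      finally have "\<bar>\<beta>\<bar> / 2 * (real (Suc k) * (8 * A * N * majorant N K m (Suc k))) + ?C * majorant N K m k \<le> real (Suc m) * ?M k"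
        using K0 by simp
      then show "cmod (of_real (- 1 / real (Suc m))) * (cmod (of_real (\<beta> / 2)) * (real (Suc k) * (8 * A * N * majorant N K m (Suc k)))
        + ?C * majorant N K m k) \<le> ?M k"
        unfolding n using \<open>real (Suc m) > 0\<close> by (simp add: divide_le_eq mult.commute[of "real (Suc m)"] del: of_nat_Suc)
    qed
    moreover have "dominated r (b (Suc m)) (\<lambda>k. cmod (of_real (- 1 / real (Suc m))) *
       (real (Suc k) * (majorant N K m (Suc k) + 8 * A * N * majorant N K m (Suc k))))"
      unfolding bS next_v_def[abs_def]
      by (intro dominated_cmult dominated_add dominated_Dx dominated_cauchy_product
          IH r1 N Ar order.strict_implies_order[OF K0] order_refl)
    then have "dominated r (b (Suc m)) ?M"
    proof (rule dominated_mono)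
      fix k
      have n: "cmod (of_real (- 1 / real (Suc m))) = 1 / real (Suc m)"
        unfolding norm_of_real by (simp add: abs_divide)
      have "real (Suc k) * (majorant N K m (Suc k) + 8 * A * N * majorant N K m (Suc k)) = (1 + 8 * A * N) * (real (Suc m) / K * ?M k)"
        unfolding shift[symmetric] by (simp add: algebra_simps)
      also have "\<dots> \<le> K * (real (Suc m) / K * ?M k)"
        using K0 M0[of k] by (intro mult_right_mono cK) auto
      finally have "real (Suc k) * (majorant N K m (Suc k) + 8 * A * N * majorant N K m (Suc k)) \<le> real (Suc m) * ?M k"
        using K0 by simp
      then show "cmod (of_real (- 1 / real (Suc m))) * (real (Suc k) * (majorant N K m (Suc k) + 8 * A * N * majorant N K m (Suc k))) \<le> ?M k"
        unfolding n using \<open>real (Suc m) > 0\<close> by (simp add: divide_le_eq mult.commute[of "real (Suc m)"] del: of_nat_Suc)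
    qed
    ultimately show ?thesis using Suc by simp
  qed
qed

section \<open>Analytic spaces and power series in time\<close>

lemma analytic_spaceI:
  assumes "f \<in> sobolev_smooth r" "\<And>k. analytic_term \<delta> r f k \<le> C"
  shows "f \<in> analytic_space \<delta> r" "analytic_norm \<delta> r f \<le> C"
proof -
  show "f \<in> analytic_space \<delta> r"
    using assms by (auto simp: analytic_space_def sobolev_smooth_def intro!: bdd_aboveI2)
  show "analytic_norm \<delta> r f \<le> C"
    unfolding analytic_norm_def by (rule cSUP_least) (auto simp: assms)
qed

lemma analytic_term_le_norm:
  assumes "f \<in> analytic_space \<delta> r"
  shows "analytic_term \<delta> r f k \<le> analytic_norm \<delta> r f"
  unfolding analytic_norm_def using assms by (intro cSUP_upper) (auto simp: analytic_space_def)

lemma analytic_norm_nonneg: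
  assumes "f \<in> analytic_space \<delta> r"
  shows "analytic_norm \<delta> r f \<ge> 0"
  using analytic_term_le_norm[OF assms, of 0] sobolev_norm_nonneg[of r f]
  by (simp add: analytic_term_def del: sobolev_norm_nonneg)

lemma analytic_term_eq:
  "analytic_term \<delta> r f k = \<delta> ^ k * (real k + 1)\<^sup>2 * (sobolev_norm r ((Dx ^^ k) f) / fact k)"
  by (simp add: analytic_term_def)

lemma analytic_space_dominated:
  assumes f: "dominated r f \<phi>" and \<delta>: "\<delta> \<ge> 0" and C: "\<And>k. \<delta> ^ k * (real k + 1)\<^sup>2 * \<phi> k \<le> C"
  shows "f \<in> analytic_space \<delta> r" "analytic_norm \<delta> r f \<le> C"
proof -
  have "analytic_term \<delta> r f k \<le> C" for k
    unfolding analytic_term_eq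
    by (rule order_trans[OF mult_left_mono[OF dominatedD(2)[OF f]] C]) (use \<delta> in simp)
  then show "f \<in> analytic_space \<delta> r" "analytic_norm \<delta> r f \<le> C"
    using analytic_spaceI[OF dominatedD(1)[OF f]] by auto
qed

lemma analytic_space_dominated_inv_sq:
  assumes "f \<in> analytic_space 1 r" "analytic_norm 1 r f \<le> N"
  shows "dominated r f (\<lambda>k. N * inv_sq k)"
  unfolding dominated_def
proof (intro conjI allI)
  show "f \<in> sobolev_smooth r" by (rule analytic_space_smooth[OF assms(1)])
  fix k
  have "(real k + 1)\<^sup>2 * (sobolev_norm r ((Dx ^^ k) f) / fact k) \<le> N"
    using analytic_term_le_norm[OF assms(1), of k] assms(2) unfolding analytic_term_eq by simp
  then show "sobolev_norm r ((Dx ^^ k) f) / fact k \<le> N * inv_sq k"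
    by (simp add: inv_sq_def field_simps)
qed

text \<open>One term of the binomial expansion of \<open>(\<delta> + (1 - \<delta>)) ^ (n + k) = 1\<close>.\<close>

lemma majorant_analytic_bound:
  assumes N: "N \<ge> 0" and K: "K \<ge> 0" and \<delta>: "0 < \<delta>" "\<delta> < 1"
  shows "\<delta> ^ k * (real k + 1)\<^sup>2 * majorant N K n k \<le> N * (K / (1 - \<delta>)) ^ n"
proof -
  have "real (n + k choose k) * \<delta> ^ k * (1 - \<delta>) ^ (n + k - k) \<le> (\<Sum>i\<le>n + k. real (n + k choose i) * \<delta> ^ i * (1 - \<delta>) ^ (n + k - i))"
    using \<delta> by (intro member_le_sum[of k _ "\<lambda>i. real (n + k choose i) * \<delta> ^ i * (1 - \<delta>) ^ (n + k - i)"]) auto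
  also have "\<dots> = 1"
    using binomial_ring[of \<delta> "1 - \<delta>" "n + k"] by simp
  finally have b: "real (n + k choose k) * \<delta> ^ k \<le> 1 / (1 - \<delta>) ^ n"
    using \<delta> by (simp add: field_simps)
  have "(real k + 1)\<^sup>2 * inv_sq (n + k) \<le> 1"
  proof -
    have "(real k + 1)\<^sup>2 \<le> (real (n + k) + 1)\<^sup>2"
      by (intro power_mono) auto
    then show ?thesis by (simp add: inv_sq_def divide_le_eq add_nonneg_pos)
  qed
  then have "(real (n + k choose k) * \<delta> ^ k) * ((real k + 1)\<^sup>2 * inv_sq (n + k)) \<le> 1 / (1 - \<delta>) ^ n * 1"
    using b \<delta> by (intro mult_mono) auto
  then have "N * K ^ n * ((real (n + k choose k) * \<delta> ^ k) * ((real k + 1)\<^sup>2 * inv_sq (n + k))) \<le> N * K ^ n * (1 / (1 - \<delta>) ^ n * 1)"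
    using N K by (intro mult_left_mono) auto
  then show ?thesis
    by (simp add: majorant_def power_divide mult_ac)
qed

definition analytic_sup_const :: "real \<Rightarrow> nat \<Rightarrow> real" where
  "analytic_sup_const \<delta> k = embedding_const * (fact k / (\<delta> ^ k * (real k + 1)\<^sup>2))"

context
  fixes \<delta> r :: real
  assumes r1: "r \<ge> 1" and \<delta>0: "\<delta> > 0"
begin

lemma analytic_sup_const_nonneg: "analytic_sup_const \<delta> k \<ge> 0"
  using \<delta>0 by (simp add: analytic_sup_const_def)

lemma analytic_sobolev_bound:
  assumes "f \<in> analytic_space \<delta> r"
  shows "sobolev_norm r ((Dx ^^ k) f) \<le> fact k / (\<delta> ^ k * (real k + 1)\<^sup>2) * analytic_norm \<delta> r f"
proof -
  have p: "\<delta> ^ k * (real k + 1)\<^sup>2 > 0"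
    using \<delta>0 by (intro mult_pos_pos zero_less_power) auto
  have "fact k / (\<delta> ^ k * (real k + 1)\<^sup>2) * analytic_term \<delta> r f k \<le> fact k / (\<delta> ^ k * (real k + 1)\<^sup>2) * analytic_norm \<delta> r f"
    using p by (intro mult_left_mono analytic_term_le_norm assms) auto
  moreover have "fact k / (\<delta> ^ k * (real k + 1)\<^sup>2) * analytic_term \<delta> r f k = sobolev_norm r ((Dx ^^ k) f)"
    using p \<delta>0 by (simp add: analytic_term_eq)
  ultimately show ?thesis by simp
qed

text \<open>Sobolev embedding: convergence in the analytic norm is uniform convergence of every derivative.\<close>

lemma analytic_sup_bound:
  assumes "f \<in> analytic_space \<delta> r"
  shows "cmod ((Dx ^^ k) f x) \<le> analytic_sup_const \<delta> k * analytic_norm \<delta> r f"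
proof -
  have "cmod ((Dx ^^ k) f x) \<le> embedding_const * sobolev_norm r ((Dx ^^ k) f)"
    by (rule sobolev_smooth_sup_bound[OF r1 analytic_space_smooth[OF assms]])
  also have "\<dots> \<le> embedding_const * (fact k / (\<delta> ^ k * (real k + 1)\<^sup>2) * analytic_norm \<delta> r f)"
    by (intro mult_left_mono analytic_sobolev_bound assms) simp
  finally show ?thesis by (simp add: analytic_sup_const_def mult.assoc)
qed

lemma analytic_space_add:
  assumes f: "f \<in> analytic_space \<delta> r" and g: "g \<in> analytic_space \<delta> r"
  shows "(\<lambda>x. f x + g x) \<in> analytic_space \<delta> r"
    and "analytic_norm \<delta> r (\<lambda>x. f x + g x) \<le> analytic_norm \<delta> r f + analytic_norm \<delta> r g"
proof -
  note s = analytic_space_smooth[OF f] analytic_space_smooth[OF g]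
  have "analytic_term \<delta> r (\<lambda>x. f x + g x) k \<le> analytic_norm \<delta> r f + analytic_norm \<delta> r g" for k
  proof -
    have "analytic_term \<delta> r (\<lambda>x. f x + g x) k \<le> \<delta> ^ k * (real k + 1)\<^sup>2 * ((sobolev_norm r ((Dx ^^ k) f) + sobolev_norm r ((Dx ^^ k) g)) / fact k)"
      unfolding analytic_term_eq smooth_add(2)[OF s[THEN sobolev_smooth_smooth]]
      using \<delta>0 by (intro mult_left_mono divide_right_mono sobolev_cont_add(2) sobolev_smooth_cont s r1) auto
    also have "\<dots> = analytic_term \<delta> r f k + analytic_term \<delta> r g k"
      unfolding analytic_term_eq add_divide_distrib distrib_left ..
    also have "\<dots> \<le> analytic_norm \<delta> r f + analytic_norm \<delta> r g"
      by (intro add_mono analytic_term_le_norm f g)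
    finally show ?thesis .
  qed
  then show "(\<lambda>x. f x + g x) \<in> analytic_space \<delta> r"
    "analytic_norm \<delta> r (\<lambda>x. f x + g x) \<le> analytic_norm \<delta> r f + analytic_norm \<delta> r g"
    using analytic_spaceI[OF sobolev_smooth_add[OF r1 s]] by auto
qed

lemma analytic_space_cmult:
  assumes f: "f \<in> analytic_space \<delta> r"
  shows "(\<lambda>x. c * f x) \<in> analytic_space \<delta> r"
    and "analytic_norm \<delta> r (\<lambda>x. c * f x) \<le> cmod c * analytic_norm \<delta> r f"
proof -
  note s = analytic_space_smooth[OF f]
  have "analytic_term \<delta> r (\<lambda>x. c * f x) k \<le> cmod c * analytic_norm \<delta> r f" for k
  proof -
    have "analytic_term \<delta> r (\<lambda>x. c * f x) k = cmod c * analytic_term \<delta> r f k"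
      unfolding analytic_term_eq smooth_cmult(2)[OF s[THEN sobolev_smooth_smooth]]
        sobolev_cont_cmult(2)[OF sobolev_smooth_cont[OF s] r1] by simp
    also have "\<dots> \<le> cmod c * analytic_norm \<delta> r f"
      by (intro mult_left_mono analytic_term_le_norm f) simp
    finally show ?thesis .
  qed
  then show "(\<lambda>x. c * f x) \<in> analytic_space \<delta> r"
    "analytic_norm \<delta> r (\<lambda>x. c * f x) \<le> cmod c * analytic_norm \<delta> r f"
    using analytic_spaceI[OF sobolev_smooth_cmult[OF r1 s]] by auto
qed

lemma analytic_space_diff:
  assumes f: "f \<in> analytic_space \<delta> r" and g: "g \<in> analytic_space \<delta> r"
  shows "(\<lambda>x. f x - g x) \<in> analytic_space \<delta> r"
  using analytic_space_add(1)[OF f analytic_space_cmult(1)[OF g, of "-1"]] by simp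

lemma analytic_space_suminf:
  assumes f: "\<And>n. f n \<in> analytic_space \<delta> r" and sm: "summable (\<lambda>n. analytic_norm \<delta> r (f n))"
  shows "(\<lambda>x. \<Sum>n. f n x) \<in> analytic_space \<delta> r"
    and "(Dx ^^ k) (\<lambda>x. \<Sum>n. f n x) = (\<lambda>x. \<Sum>n. (Dx ^^ k) (f n) x)"
    and "analytic_norm \<delta> r (\<lambda>x. \<Sum>n. f n x) \<le> (\<Sum>n. analytic_norm \<delta> r (f n))"
    and "summable (\<lambda>n. cmod ((Dx ^^ k) (f n) x))"
proof -
  have ss: "summable (\<lambda>n. sobolev_norm r ((Dx ^^ k) (f n)))" for k
  proof (rule summable_comparison_test'[of _ 0])
    show "summable (\<lambda>n. fact k / (\<delta> ^ k * (real k + 1)\<^sup>2) * analytic_norm \<delta> r (f n))"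
      by (intro summable_mult sm)
    show "norm (sobolev_norm r ((Dx ^^ k) (f n))) \<le> fact k / (\<delta> ^ k * (real k + 1)\<^sup>2) * analytic_norm \<delta> r (f n)" for n
      using analytic_sobolev_bound[OF f] by simp
  qed
  note S = sobolev_smooth_suminf[OF r1 analytic_space_smooth[OF f] ss]
  show "(Dx ^^ k) (\<lambda>x. \<Sum>n. f n x) = (\<lambda>x. \<Sum>n. (Dx ^^ k) (f n) x)" "summable (\<lambda>n. cmod ((Dx ^^ k) (f n) x))"
    by (rule S)+
  have "analytic_term \<delta> r (\<lambda>x. \<Sum>n. f n x) k \<le> (\<Sum>n. analytic_norm \<delta> r (f n))" for k
  proof -
    have st: "summable (\<lambda>n. analytic_term \<delta> r (f n) k)"
      unfolding analytic_term_eq by (intro summable_mult summable_divide ss)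
    have "analytic_term \<delta> r (\<lambda>x. \<Sum>n. f n x) k \<le> \<delta> ^ k * (real k + 1)\<^sup>2 * ((\<Sum>n. sobolev_norm r ((Dx ^^ k) (f n))) / fact k)"
      unfolding analytic_term_eq using \<delta>0 by (intro mult_left_mono divide_right_mono S(3)) auto
    also have "\<dots> = (\<Sum>n. analytic_term \<delta> r (f n) k)"
      unfolding analytic_term_eq by (simp add: suminf_mult suminf_divide ss summable_divide)
    also have "\<dots> \<le> (\<Sum>n. analytic_norm \<delta> r (f n))"
      by (intro suminf_le analytic_term_le_norm f st sm)
    finally show ?thesis .
  qed
  from analytic_spaceI[OF S(1) this]
  show "(\<lambda>x. \<Sum>n. f n x) \<in> analytic_space \<delta> r" "analytic_norm \<delta> r (\<lambda>x. \<Sum>n. f n x) \<le> (\<Sum>n. analytic_norm \<delta> r (f n))"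
    by auto
qed

end

definition power_series :: "(nat \<Rightarrow> real \<Rightarrow> complex) \<Rightarrow> complex \<Rightarrow> real \<Rightarrow> complex" where
  "power_series a t x = (\<Sum>n. a n x * t ^ n)"

text \<open>Coefficients whose power series converges absolutely in the analytic norm for \<open>cmod t < R\<close>.\<close>

locale analytic_power_series =
  fixes \<delta> r R :: real and a :: "nat \<Rightarrow> real \<Rightarrow> complex"
  assumes r1: "r \<ge> 1" and \<delta>0: "\<delta> > 0"
    and mem: "\<And>n. a n \<in> analytic_space \<delta> r"
    and smb: "\<And>\<rho>. 0 \<le> \<rho> \<Longrightarrow> \<rho> < R \<Longrightarrow> summable (\<lambda>n. analytic_norm \<delta> r (a n) * \<rho> ^ n)"
begin

text \<open>Termwise operations for arbitrary scalar sequences \<open>c\<close>, so that they apply both to the powers of \<open>t\<close> and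
  to the remainders of their difference quotients.\<close>

lemma scaled:
  assumes "summable (\<lambda>n. analytic_norm \<delta> r (a n) * cmod (c n))"
  shows "(\<lambda>x. \<Sum>n. a n x * c n) \<in> analytic_space \<delta> r"
    and "(Dx ^^ k) (\<lambda>x. \<Sum>n. a n x * c n) = (\<lambda>x. \<Sum>n. (Dx ^^ k) (a n) x * c n)"
    and "analytic_norm \<delta> r (\<lambda>x. \<Sum>n. a n x * c n) \<le> (\<Sum>n. analytic_norm \<delta> r (a n) * cmod (c n))"
    and "summable (\<lambda>n. cmod ((Dx ^^ k) (a n) x * c n))"
proof -
  let ?f = "\<lambda>n x. c n * a n x"
  note m = analytic_space_cmult[OF r1 \<delta>0 mem]
  have n: "analytic_norm \<delta> r (?f n) \<le> analytic_norm \<delta> r (a n) * cmod (c n)" for n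
    using m(2)[of "c n" n] by (simp add: mult.commute)
  have s: "summable (\<lambda>n. analytic_norm \<delta> r (?f n))"
    by (rule summable_comparison_test'[OF assms, of 0]) (use n analytic_norm_nonneg[OF m(1)] in auto)
  note S = analytic_space_suminf[OF r1 \<delta>0 m(1) s]
  have e: "(\<lambda>x. \<Sum>n. a n x * c n) = (\<lambda>x. \<Sum>n. ?f n x)"
    by (simp add: mult.commute)
  have D: "(Dx ^^ k) (?f n) = (\<lambda>x. (Dx ^^ k) (a n) x * c n)" for n k
    using smooth_cmult(2)[OF sobolev_smooth_smooth[OF analytic_space_smooth[OF mem]], of k "c n" n] by (simp add: mult.commute)
  show "(\<lambda>x. \<Sum>n. a n x * c n) \<in> analytic_space \<delta> r"
    "(Dx ^^ k) (\<lambda>x. \<Sum>n. a n x * c n) = (\<lambda>x. \<Sum>n. (Dx ^^ k) (a n) x * c n)"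
    "summable (\<lambda>n. cmod ((Dx ^^ k) (a n) x * c n))"
    unfolding e using S(1) S(2)[of k] S(4)[of k x] by (simp_all add: D)
  have "(\<Sum>n. analytic_norm \<delta> r (?f n)) \<le> (\<Sum>n. analytic_norm \<delta> r (a n) * cmod (c n))"
    by (intro suminf_le n s assms)
  then show "analytic_norm \<delta> r (\<lambda>x. \<Sum>n. a n x * c n) \<le> (\<Sum>n. analytic_norm \<delta> r (a n) * cmod (c n))"
    unfolding e using S(3) by linarith
qed

lemma smb': "cmod t < R \<Longrightarrow> summable (\<lambda>n. analytic_norm \<delta> r (a n) * cmod (t ^ n))"
  using smb[of "cmod t"] by (simp add: norm_power)

lemma power_series_mem: "cmod t < R \<Longrightarrow> power_series a t \<in> analytic_space \<delta> r"
  unfolding power_series_def[abs_def] by (rule scaled(1)[OF smb'])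

lemma power_series_Dx: "cmod t < R \<Longrightarrow> (Dx ^^ k) (power_series a t) x = power_series (\<lambda>n. (Dx ^^ k) (a n)) t x"
  unfolding power_series_def[abs_def] using scaled(2)[OF smb', of t k] by simp

lemma power_series_abs_summable: "cmod t < R \<Longrightarrow> summable (\<lambda>n. cmod ((Dx ^^ k) (a n) x * t ^ n))"
  by (rule scaled(4)[OF smb'])

lemma power_series_sums: "cmod t < R \<Longrightarrow> (\<lambda>n. a n x * t ^ n) sums power_series a t x"
  unfolding power_series_def
  using summable_norm_cancel[OF power_series_abs_summable[of t 0 x]] by (simp add: summable_sums)

lemma power_series_Dx_sums:
  "cmod t < R \<Longrightarrow> (\<lambda>n. (Dx ^^ k) (a n) x * t ^ n) sums (Dx ^^ k) (power_series a t) x"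
  using summable_sums[OF summable_norm_cancel[OF power_series_abs_summable[of t k x]]]
  by (simp add: power_series_Dx power_series_def)

lemma summable_diffs_norm:
  assumes "\<And>n. c n \<ge> 0" "\<And>\<rho>. 0 \<le> \<rho> \<Longrightarrow> \<rho> < R \<Longrightarrow> summable (\<lambda>n. c n * \<rho> ^ n)" "0 \<le> \<rho>" "\<rho> < R"
  shows "summable (\<lambda>n. diffs c n * \<rho> ^ n)"
proof (rule termdiff_converges[of \<rho> R])
  show "norm \<rho> < R" using assms by simp
  fix x :: real assume x: "norm x < R"
  show "summable (\<lambda>n. c n * x ^ n)"
    by (rule summable_norm_cancel, rule summable_comparison_test'[OF assms(2)[of "\<bar>x\<bar>"], of 0])
      (use x assms(1) in \<open>auto simp: abs_mult power_abs\<close>)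
qed

definition time_diff :: "nat \<Rightarrow> real \<Rightarrow> complex" where
  "time_diff n x = of_nat (Suc n) * a (Suc n) x"

lemma time_diff_series: "analytic_power_series \<delta> r R time_diff"
proof
  show "r \<ge> 1" "\<delta> > 0" by (rule r1 \<delta>0)+
  note m = analytic_space_cmult[OF r1 \<delta>0 mem]
  show td: "time_diff n \<in> analytic_space \<delta> r" for n
    unfolding time_diff_def[abs_def] by (rule m(1))
  fix \<rho> :: real assume \<rho>: "0 \<le> \<rho>" "\<rho> < R"
  have "analytic_norm \<delta> r (time_diff n) \<le> diffs (\<lambda>n. analytic_norm \<delta> r (a n)) n" for n
    using m(2)[of "of_nat (Suc n)" "Suc n"] unfolding time_diff_def[abs_def] diffs_def norm_of_nat .
  then have "norm (analytic_norm \<delta> r (time_diff n) * \<rho> ^ n) \<le> diffs (\<lambda>n. analytic_norm \<delta> r (a n)) n * \<rho> ^ n" for n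
    using \<rho> analytic_norm_nonneg[OF td] by (simp add: abs_mult mult_right_mono)
  then show "summable (\<lambda>n. analytic_norm \<delta> r (time_diff n) * \<rho> ^ n)"
    by (intro summable_comparison_test'[OF summable_diffs_norm[OF analytic_norm_nonneg[OF mem] smb \<rho>], of 0])
qed

text \<open>The second order remainder of the powers of \<open>t\<close> gives complex differentiability in norm.\<close>

lemma power_series_complex_derivative:
  assumes t: "cmod t < R"
  shows "((\<lambda>h. analytic_norm \<delta> r (\<lambda>x. (power_series a (t + h) x - power_series a t x) / h - power_series time_diff t x)) \<longlongrightarrow> 0) (at 0)"
proof -
  obtain \<rho> where \<rho>: "cmod t < \<rho>" "\<rho> < R" using dense[OF t] by blast
  have \<rho>0: "\<rho> > 0" using \<rho>(1) norm_ge_zero[of t] by linarith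
  let ?A = "\<lambda>n. analytic_norm \<delta> r (a n)"
  let ?B = "\<lambda>n. ?A n * (real n * real (n - 1) * \<rho> ^ (n - 2))"
  have A0: "?A n \<ge> 0" for n by (rule analytic_norm_nonneg[OF mem])
  have sB: "summable ?B"
  proof -
    have 1: "summable (\<lambda>n. diffs ?A n * \<rho>' ^ n)" if "0 \<le> \<rho>'" "\<rho>' < R" for \<rho>'
      by (rule summable_diffs_norm[OF A0 smb that])
    have "summable (\<lambda>n. diffs (diffs ?A) n * \<rho> ^ n)"
      by (rule summable_diffs_norm[OF _ 1]) (use A0 \<rho>0 \<rho> in \<open>auto simp: diffs_def\<close>)
    then have "summable (\<lambda>n. ?B (n + 2))"
      by (simp add: diffs_def mult_ac)
    then show ?thesis by (rule summable_iff_shift[THEN iffD1])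
  qed
  let ?c = "\<lambda>h n. ((t + h) ^ n - t ^ n) / h - of_nat n * t ^ (n - Suc 0)"
  have bound: "analytic_norm \<delta> r (\<lambda>x. (power_series a (t + h) x - power_series a t x) / h - power_series time_diff t x) \<le> cmod h * (\<Sum>n. ?B n)
      \<and> 0 \<le> analytic_norm \<delta> r (\<lambda>x. (power_series a (t + h) x - power_series a t x) / h - power_series time_diff t x)"
    if h: "h \<noteq> 0" "cmod h < \<rho> - cmod t" for h
  proof -
    have th: "cmod (t + h) \<le> \<rho>" "cmod (t + h) < R"
      using norm_triangle_ineq[of t h] h \<rho> by linarith+
    have c: "cmod (?c h n) \<le> real n * real (n - 1) * \<rho> ^ (n - 2) * cmod h" for n
      using lemma_termdiff3[of h t \<rho> n] h th \<rho> by simp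
    have cA: "?A n * cmod (?c h n) \<le> cmod h * ?B n" for n
      using mult_left_mono[OF c A0[of n], of n] by (simp add: mult_ac)
    have sc: "summable (\<lambda>n. ?A n * cmod (?c h n))"
      by (rule summable_comparison_test'[OF summable_mult[OF sB, of "cmod h"], of 0]) (use cA A0 in auto)
    note S = scaled[OF sc]
    have eq: "(\<Sum>n. a n x * ?c h n) = (power_series a (t + h) x - power_series a t x) / h - power_series time_diff t x" for x
    proof -
      have "(\<lambda>n. time_diff n x * t ^ n) sums power_series time_diff t x"
        by (rule analytic_power_series.power_series_sums[OF time_diff_series t])
      then have "(\<lambda>n. a (Suc n) x * (of_nat (Suc n) * t ^ (Suc n - Suc 0))) sums power_series time_diff t x"
        by (simp add: time_diff_def mult_ac)
      then have "(\<lambda>n. a n x * (of_nat n * t ^ (n - Suc 0))) sums power_series time_diff t x"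
        by (subst (asm) sums_Suc_iff) simp
      from sums_diff[OF sums_divide[OF sums_diff[OF power_series_sums[OF th(2), of x] power_series_sums[OF t, of x]], of h] this]
      have "(\<lambda>n. (a n x * (t + h) ^ n - a n x * t ^ n) / h - a n x * (of_nat n * t ^ (n - Suc 0))) sums
        ((power_series a (t + h) x - power_series a t x) / h - power_series time_diff t x)" .
      then show ?thesis
        by (intro sums_unique[symmetric]) (simp add: right_diff_distrib diff_divide_distrib)
    qed
    have "(\<Sum>n. ?A n * cmod (?c h n)) \<le> (\<Sum>n. cmod h * ?B n)"
      by (intro suminf_le cA sc summable_mult sB)
    also have "\<dots> = cmod h * (\<Sum>n. ?B n)"
      by (rule suminf_mult[OF sB])
    finally show ?thesis
      using S(3) analytic_norm_nonneg[OF S(1)] unfolding eq by linarith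
  qed
  show ?thesis
  proof (rule Lim_null_comparison)
    show "\<forall>\<^sub>F h in at 0. norm (analytic_norm \<delta> r (\<lambda>x. (power_series a (t + h) x - power_series a t x) / h - power_series time_diff t x)) \<le> cmod h * (\<Sum>n. ?B n)"
      unfolding eventually_at using \<rho>(1) bound by (intro exI[of _ "\<rho> - cmod t"]) (auto simp: dist_norm)
    show "((\<lambda>h. cmod h * (\<Sum>n. ?B n)) \<longlongrightarrow> 0) (at 0)"
      by (intro tendsto_mult_left_zero tendsto_norm_zero tendsto_ident_at)
  qed
qed

lemma power_series_has_field_derivative:
  assumes t: "cmod t < R"
  shows "((\<lambda>\<tau>. power_series a \<tau> x) has_field_derivative power_series time_diff t x) (at t)"
proof -
  obtain \<rho> where \<rho>: "cmod t < \<rho>" "\<rho> < R" using dense[OF t] by blast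
  have \<rho>0: "\<rho> > 0" using \<rho>(1) norm_ge_zero[of t] by linarith
  have "summable (\<lambda>n. a n x * of_real \<rho> ^ n)"
    using sums_summable[OF power_series_sums[of "of_real \<rho>" x]] \<rho> \<rho>0 by simp
  from termdiffs_strong[OF this, of t]
  show ?thesis
    using \<rho> \<rho>0 by (simp add: power_series_def[abs_def] time_diff_def diffs_def mult.assoc)
qed

end

lemma analytic_power_series_geometric:
  assumes r: "r \<ge> 1" and N: "N \<ge> 0" and K: "K > 0" and \<delta>: "0 < \<delta>" "\<delta> < 1"
    and a: "\<And>n. dominated r (a n) (\<lambda>k. c * majorant N K n k)" and c: "c \<ge> 0"
  shows "analytic_power_series \<delta> r ((1 - \<delta>) / K) a"
proof
  show "r \<ge> 1" "\<delta> > 0" by fact+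
  have b: "\<delta> ^ k * (real k + 1)\<^sup>2 * (c * majorant N K n k) \<le> c * (N * (K / (1 - \<delta>)) ^ n)" for n k
    using mult_left_mono[OF majorant_analytic_bound[OF N _ \<delta>, of K k n] c] K by (simp add: mult_ac)
  note E = analytic_space_dominated[OF a _ b]
  show m: "a n \<in> analytic_space \<delta> r" for n
    by (rule E(1)) (use \<delta> in simp)
  fix \<rho> :: real assume \<rho>: "0 \<le> \<rho>" "\<rho> < (1 - \<delta>) / K"
  let ?q = "K / (1 - \<delta>) * \<rho>"
  have q: "0 \<le> ?q" "?q < 1"
    using \<rho> K \<delta> by (auto simp: field_simps)
  have "summable (\<lambda>n. c * N * ?q ^ n)"
    by (intro summable_mult summable_geometric) (use q in \<open>simp only: real_norm_def abs_of_nonneg\<close>)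
  then show "summable (\<lambda>n. analytic_norm \<delta> r (a n) * \<rho> ^ n)"
  proof (rule summable_comparison_test'[of _ 0])
    fix n
    have "analytic_norm \<delta> r (a n) * \<rho> ^ n \<le> c * (N * (K / (1 - \<delta>)) ^ n) * \<rho> ^ n"
      using \<rho> \<delta> by (intro mult_right_mono E(2)) auto
    also have "\<dots> = c * N * ?q ^ n"
      by (simp only: power_mult_distrib mult_ac)
    finally show "norm (analytic_norm \<delta> r (a n) * \<rho> ^ n) \<le> c * N * ?q ^ n"
      using analytic_norm_nonneg[OF m] \<rho> by simp
  qed
qed

lemma cauchy_product_sums:
  assumes "summable (\<lambda>n. cmod (a n x * t ^ n))" "summable (\<lambda>n. cmod (b n x * t ^ n))"
    "(\<lambda>n. a n x * t ^ n) sums p" "(\<lambda>n. b n x * t ^ n) sums q"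
  shows "(\<lambda>n. cauchy_product a b n x * t ^ n) sums (p * q)"
proof -
  have "(\<lambda>n. \<Sum>i\<le>n. a i x * t ^ i * (b (n - i) x * t ^ (n - i))) sums ((\<Sum>n. a n x * t ^ n) * (\<Sum>n. b n x * t ^ n))"
    by (rule Cauchy_product_sums[OF assms(1,2)])
  moreover have "(\<Sum>i\<le>n. a i x * t ^ i * (b (n - i) x * t ^ (n - i))) = cauchy_product a b n x * t ^ n" for n
    unfolding cauchy_product_def sum_distrib_right
  proof (intro sum.cong refl)
    fix i assume "i \<in> {..n}"
    then have "t ^ n = t ^ i * t ^ (n - i)" by (simp add: power_add[symmetric])
    then show "a i x * t ^ i * (b (n - i) x * t ^ (n - i)) = a i x * b (n - i) x * t ^ n"
      by simp
  qed
  ultimately show ?thesis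
    using sums_unique[OF assms(3)] sums_unique[OF assms(4)] by simp
qed

section \<open>Existence of solutions\<close>

lemma Dx_cnj:
  assumes "f \<in> smooth" "\<And>x. cnj (f x) = f x"
  shows "cnj (Dx f x) = Dx f x"
proof -
  have d: "(f has_vector_derivative Dx f x) (at x)"
    using smooth_has_vector_derivative[OF assms(1), of 0] by simp
  have "((\<lambda>x. cnj (f x)) has_vector_derivative cnj (Dx f x)) (at x)"
    by (rule bounded_linear.has_vector_derivative[OF bounded_linear_cnj d])
  then show ?thesis
    using d vector_derivative_unique_at assms(2) by fastforce
qed

text \<open>The conjugate of a bounded solution of \<open>w - w'' = f'\<close> is again one.\<close>

lemma smoothing_cnj:
  assumes f: "f \<in> sobolev_smooth r" and r: "r \<ge> 2" and re: "\<And>x. cnj (f x) = f x"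
  shows "cnj (smoothing f x) = smoothing f x"
proof -
  let ?w = "smoothing f"
  note S = sobolev_smooth_smoothing(2)[OF f r]
  have r1: "r + 1 \<ge> 1" using r by simp
  note d = smooth_has_vector_derivative[OF sobolev_smooth_smooth[OF S]]
  have c: "((\<lambda>x. cnj ((Dx ^^ k) ?w x)) has_vector_derivative cnj ((Dx ^^ Suc k) ?w x)) (at x)" for k x
    by (rule bounded_linear.has_vector_derivative[OF bounded_linear_cnj d])
  have B: "cmod ((Dx ^^ k) ?w x - cnj ((Dx ^^ k) ?w x)) \<le> 2 * (embedding_const * sobolev_norm (r + 1) ((Dx ^^ k) ?w))" for k x
    using norm_triangle_ineq4[of "(Dx ^^ k) ?w x" "cnj ((Dx ^^ k) ?w x)"] sobolev_smooth_sup_bound[OF r1 S, of k x] by simp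
  have "cmod ((Dx ^^ 0) ?w x - cnj ((Dx ^^ 0) ?w x)) \<le> 0"
  proof (rule helmholtz_bound[OF has_vector_derivative_diff[OF d c] has_vector_derivative_diff[OF d c] B B])
    fix x
    have e: "?w x - (Dx ^^ 2) ?w x = Dx f x"
      using smoothing_helmholtz[OF sobolev_smooth_cont[OF f, of 0] r, of x] by (simp add: numeral_2_eq_2)
    have "(?w x - cnj (?w x)) - ((Dx ^^ 2) ?w x - cnj ((Dx ^^ 2) ?w x)) = (?w x - (Dx ^^ 2) ?w x) - cnj (?w x - (Dx ^^ 2) ?w x)"
      by simp
    also have "\<dots> = 0"
      unfolding e using Dx_cnj[OF sobolev_smooth_smooth[OF f] re] by simp
    finally show "cmod ((Dx ^^ 0) ?w x - cnj ((Dx ^^ 0) ?w x) - ((Dx ^^ Suc (Suc 0)) ?w x - cnj ((Dx ^^ Suc (Suc 0)) ?w x))) \<le> 0"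
      by (simp add: numeral_2_eq_2)
  qed
  then show ?thesis by simp
qed

lemma CH_coefficients_real:
  assumes r: "r \<ge> 3" and dom: "\<And>n. dominated r (a n) (majorant N K n)" "\<And>n. dominated r (b n) (majorant N K n)"
    and N: "N \<ge> 0" and K: "K > 0"
    and a0: "\<And>x. cnj (a 0 x) = a 0 x" and b0: "\<And>x. cnj (b 0 x) = b 0 x"
    and aS: "\<And>n. a (Suc n) = next_u \<alpha> \<beta> a b n" and bS: "\<And>n. b (Suc n) = next_v a b n"
  shows "cnj (a n x) = a n x \<and> cnj (b n x) = b n x"
proof (induction n arbitrary: x rule: less_induct)
  case (less n)
  show ?case
  proof (cases n)
    case 0
    then show ?thesis using a0 b0 by simp
  next
    case (Suc m)
    have IH: "cnj (a i x) = a i x" "cnj (b i x) = b i x" if "i \<le> m" for i x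
      using less.IH[of i] that Suc by auto
    have r1: "r \<ge> 1" "r - 1 \<ge> 2" using r by auto
    note K' = order.strict_implies_order[OF K]
    have s: "a i \<in> smooth" for i
      using dominatedD(1)[OF dom(1)] by (rule sobolev_smooth_smooth)
    have da: "cnj (Dx (a i) x) = Dx (a i) x" if "i \<le> m" for i x
      by (rule Dx_cnj[OF s IH(1)[OF that]])
    have caa: "cnj (cauchy_product a a m x) = cauchy_product a a m x"
      and cbb: "cnj (cauchy_product b b m x) = cauchy_product b b m x"
      and cab: "cnj (cauchy_product a b m x) = cauchy_product a b m x"
      and cdd: "cnj (cauchy_product (\<lambda>i. Dx (a i)) (\<lambda>i. Dx (a i)) m x) = cauchy_product (\<lambda>i. Dx (a i)) (\<lambda>i. Dx (a i)) m x" for x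
      unfolding cauchy_product_def by (simp_all add: IH da)
    have fl: "cnj (flux_coeff \<alpha> \<beta> a b m x) = flux_coeff \<alpha> \<beta> a b m x" for x
      unfolding flux_coeff_def by (simp add: IH caa cbb cdd)
    have sfl: "flux_coeff \<alpha> \<beta> a b m \<in> sobolev_smooth (r - 1)"
      by (rule dominatedD(1)[OF dominated_flux_coeff[OF r N K' refl dom]])
    have scc: "cauchy_product a a m \<in> smooth" "cauchy_product a b m \<in> smooth"
      using dominated_cauchy_product[OF r1(1) dom(1) dom(1) N K' order_refl]
        dominated_cauchy_product[OF r1(1) dom(1) dom(2) N K' order_refl]
      by (auto intro: sobolev_smooth_smooth dominatedD(1))
    have 1: "cnj (Dx (cauchy_product a a m) x) = Dx (cauchy_product a a m) x"
      by (rule Dx_cnj[OF scc(1) caa])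
    have 2: "cnj (smoothing (flux_coeff \<alpha> \<beta> a b m) x) = smoothing (flux_coeff \<alpha> \<beta> a b m) x"
      by (rule smoothing_cnj[OF sfl r1(2) fl])
    have 3: "cnj (Dx (\<lambda>y. a m y + cauchy_product a b m y) x) = Dx (\<lambda>y. a m y + cauchy_product a b m y) x"
      by (rule Dx_cnj[OF smooth_add(1)[OF s scc(2)]]) (simp add: IH cab)
    show ?thesis
      unfolding Suc aS bS next_u_def next_v_def using 1 2 3 by simp
  qed
qed

text \<open>By the majorants the power series with the coefficients of the recursion converges in the disk. Sums,
  products and derivatives in \<open>x\<close> act on it coefficientwise; the nonlocal term is summed to a
  bounded solution of \<open>w - w'' = F'\<close> for the flux \<open>F\<close>, which determines it.\<close>

lemma CH_solution_exists:
  fixes u0 v0 :: "real \<Rightarrow> real"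
  assumes r: "r \<ge> 3" and u0: "u0 \<in> analytic_space_real 1 r" and v0: "v0 \<in> analytic_space_real 1 r"
    and K: "K = rate_const \<alpha> \<beta> r * (1 + pair_norm_real 1 r (u0, v0))"
    and \<delta>: "0 < \<delta>" "\<delta> < 1"
  obtains u v where "analytic_solution \<alpha> \<beta> \<delta> r (ball 0 ((1 - \<delta>) / K)) u0 v0 u v"
    and "\<And>t x. t \<in> ball 0 ((1 - \<delta>) / K) \<Longrightarrow> t \<in> \<real> \<Longrightarrow> u t x \<in> \<real> \<and> v t x \<in> \<real>"
proof -
  define f where "f = (\<lambda>x. complex_of_real (u0 x))"
  define g where "g = (\<lambda>x. complex_of_real (v0 x))"
  have fg: "f \<in> analytic_space 1 r" "g \<in> analytic_space 1 r"
    using u0 v0 by (auto simp: f_def g_def analytic_space_real_def)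
  define N where "N = pair_norm_real 1 r (u0, v0)"
  have N_eq: "N = analytic_norm 1 r f + analytic_norm 1 r g"
    by (simp add: N_def pair_norm_real_def pair_norm_def f_def g_def)
  have N: "N \<ge> 0" "analytic_norm 1 r f \<le> N" "analytic_norm 1 r g \<le> N"
    using analytic_norm_nonneg[OF fg(1)] analytic_norm_nonneg[OF fg(2)] by (auto simp: N_eq)
  have K_eq: "K = rate_const \<alpha> \<beta> r * (1 + N)"
    by (simp add: K N_def)
  have K0: "K > 0"
    using N(1) rate_const_pos[of \<alpha> \<beta> r] unfolding K_eq by (intro mult_pos_pos) auto
  obtain a b where a0: "a 0 = f" and b0: "b 0 = g"
    and aS: "\<And>n. a (Suc n) = next_u \<alpha> \<beta> a b n" and bS: "\<And>n. b (Suc n) = next_v a b n"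
    using CH_coefficients_exist[of f g \<alpha> \<beta>] by blast
  have dom: "dominated r (a n) (majorant N K n)" "dominated r (b n) (majorant N K n)" for n
    using dominated_coefficients[where a = a and b = b, OF r N(1) K_eq _ _ aS bS]
      analytic_space_dominated_inv_sq[OF fg(1) N(2)] analytic_space_dominated_inv_sq[OF fg(2) N(3)]
    by (auto simp: a0 b0)
  define R where "R = (1 - \<delta>) / K"
  define A where "A = algebra_const r + algebra_const (r - 1)"
  have A0: "A \<ge> 0" and Ar: "algebra_const r \<le> A" by (simp_all add: A_def)
  have r1: "r \<ge> 1" "r - 1 \<ge> 1" "r - 1 \<ge> 2" using r by auto
  note K' = order.strict_implies_order[OF K0]
  note geo = analytic_power_series_geometric[OF _ N(1) K0 \<delta>, folded R_def]
  have c0: "0 \<le> 8 * A * N" "0 \<le> \<bar>\<alpha>\<bar> + 1 + 4 * A * N * (\<bar>3 - \<beta>\<bar> + \<bar>\<beta>\<bar> + 1)"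
    using A0 N(1) by (auto intro!: add_nonneg_nonneg mult_nonneg_nonneg)
  have domfl: "dominated (r - 1) (flux_coeff \<alpha> \<beta> a b n)
    (\<lambda>k. (\<bar>\<alpha>\<bar> + 1 + 4 * A * N * (\<bar>3 - \<beta>\<bar> + \<bar>\<beta>\<bar> + 1)) * majorant N K n k)" for n
    by (rule dominated_flux_coeff[OF r N(1) K' A_def dom])
  interpret a: analytic_power_series \<delta> r R a
    by (rule geo[where c = 1]) (use dom r1 in auto)
  interpret b: analytic_power_series \<delta> r R b
    by (rule geo[where c = 1]) (use dom r1 in auto)
  interpret aa: analytic_power_series \<delta> r R "cauchy_product a a"
    by (rule geo[OF r1(1) dominated_cauchy_product[OF r1(1) dom(1) dom(1) N(1) K' Ar] c0(1)])
  interpret ab: analytic_power_series \<delta> r R "cauchy_product a b"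
    by (rule geo[OF r1(1) dominated_cauchy_product[OF r1(1) dom(1) dom(2) N(1) K' Ar] c0(1)])
  interpret fl: analytic_power_series \<delta> "r - 1" R "flux_coeff \<alpha> \<beta> a b"
    by (rule geo[OF r1(2) domfl c0(2)])
  interpret sm: analytic_power_series \<delta> r R "\<lambda>n. smoothing (flux_coeff \<alpha> \<beta> a b n)"
    by (rule geo[OF r1(1) dominated_smoothing[OF domfl r] c0(2)])
  define u where "u = power_series a"
  define v where "v = power_series b"
  have ball: "t \<in> ball 0 R \<longleftrightarrow> cmod t < R" for t :: complex
    by simp
  have hol: "holomorphic_pair \<delta> r (ball 0 R) u v"
    unfolding holomorphic_pair_def
  proof (intro conjI ballI)
    fix t :: complex assume t: "t \<in> ball 0 R"
    then have t: "cmod t < R" by simp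
    show "u t \<in> analytic_space \<delta> r" "v t \<in> analytic_space \<delta> r"
      using a.power_series_mem[OF t] b.power_series_mem[OF t] by (simp_all add: u_def v_def)
    show "\<exists>p\<in>analytic_space \<delta> r. \<exists>q\<in>analytic_space \<delta> r.
        ((\<lambda>h. pair_norm \<delta> r (\<lambda>x. (u (t + h) x - u t x) / h - p x) (\<lambda>x. (v (t + h) x - v t x) / h - q x)) \<longlongrightarrow> 0) (at 0)"
    proof (rule bexI[of _ "power_series a.time_diff t"], rule bexI[of _ "power_series b.time_diff t"])
      show "power_series a.time_diff t \<in> analytic_space \<delta> r" "power_series b.time_diff t \<in> analytic_space \<delta> r"
        using analytic_power_series.power_series_mem[OF a.time_diff_series t]
          analytic_power_series.power_series_mem[OF b.time_diff_series t] by auto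
      show "((\<lambda>h. pair_norm \<delta> r (\<lambda>x. (u (t + h) x - u t x) / h - power_series a.time_diff t x)
          (\<lambda>x. (v (t + h) x - v t x) / h - power_series b.time_diff t x)) \<longlongrightarrow> 0) (at 0)"
        using tendsto_add[OF a.power_series_complex_derivative[OF t] b.power_series_complex_derivative[OF t]]
        by (simp add: pair_norm_def u_def v_def)
    qed
  qed
  have zero: "power_series c 0 x = c 0 x" for c x
    unfolding power_series_def using powser_zero[of "\<lambda>n. c n x"] by simp
  have sol: "solves_CH \<alpha> \<beta> (ball 0 R) u0 v0 u v"
    unfolding solves_CH_def
  proof (intro conjI allI ballI)
    show "u 0 x = of_real (u0 x)" "v 0 x = of_real (v0 x)" for x
      by (simp_all add: u_def v_def zero a0 b0 f_def g_def)
    fix t :: complex and x :: real assume "t \<in> ball 0 R"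
    then have t: "cmod t < R" by simp
    have su: "(\<lambda>n. a n x * t ^ n) sums u t x" and sv: "(\<lambda>n. b n x * t ^ n) sums v t x" for x
      using a.power_series_sums[OF t] b.power_series_sums[OF t] by (simp_all add: u_def v_def)
    have au: "summable (\<lambda>n. cmod (a n x * t ^ n))" and av: "summable (\<lambda>n. cmod (b n x * t ^ n))" for x
      using a.power_series_abs_summable[OF t, of 0] b.power_series_abs_summable[OF t, of 0] by simp_all
    have sDu: "(\<lambda>n. Dx (a n) x * t ^ n) sums Dx (u t) x" for x
      using a.power_series_Dx_sums[OF t, of 1 x] by (simp add: u_def)
    have aDu: "summable (\<lambda>n. cmod (Dx (a n) x * t ^ n))" for x
      using a.power_series_abs_summable[OF t, of 1 x] by simp
    have uu: "power_series (cauchy_product a a) t = (\<lambda>y. u t y * u t y)"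
      using sums_unique2[OF aa.power_series_sums[OF t] cauchy_product_sums[OF au au su su]] by auto
    have uv: "power_series (cauchy_product a b) t = (\<lambda>y. u t y * v t y)"
      using sums_unique2[OF ab.power_series_sums[OF t] cauchy_product_sums[OF au av su sv]] by auto
    have flux: "power_series (flux_coeff \<alpha> \<beta> a b) t = CH_flux \<alpha> \<beta> (u t) (v t)"
    proof
      fix y
      have "(\<lambda>n. - of_real \<alpha> * (a n y * t ^ n) + of_real ((3 - \<beta>) / 2) * (cauchy_product a a n y * t ^ n)
         + of_real (\<beta> / 2) * (cauchy_product (\<lambda>i. Dx (a i)) (\<lambda>i. Dx (a i)) n y * t ^ n)
         + b n y * t ^ n + 1 / 2 * (cauchy_product b b n y * t ^ n)) sums
         (- of_real \<alpha> * u t y + of_real ((3 - \<beta>) / 2) * (u t y * u t y)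
         + of_real (\<beta> / 2) * (Dx (u t) y * Dx (u t) y) + v t y + 1 / 2 * (v t y * v t y))"
        by (intro sums_add sums_mult su sv cauchy_product_sums au av aDu sDu)
      then have "(\<lambda>n. flux_coeff \<alpha> \<beta> a b n y * t ^ n) sums CH_flux \<alpha> \<beta> (u t) (v t) y"
        unfolding flux_coeff_def CH_flux_def power2_eq_square distrib_right mult.assoc by simp
      then show "power_series (flux_coeff \<alpha> \<beta> a b) t y = CH_flux \<alpha> \<beta> (u t) (v t) y"
        using sums_unique2[OF fl.power_series_sums[OF t]] by blast
    qed
    have F: "CH_flux \<alpha> \<beta> (u t) (v t) \<in> sobolev_smooth (r - 1)"
      using analytic_space_smooth[OF fl.power_series_mem[OF t]] by (simp add: flux)
    \<comment> \<open>the nonlocal term, summed coefficient by coefficient\<close>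
    let ?W = "power_series (\<lambda>n. smoothing (flux_coeff \<alpha> \<beta> a b n)) t"
    have W: "?W = smoothing (CH_flux \<alpha> \<beta> (u t) (v t))"
    proof (rule smoothing_unique[OF analytic_space_smooth[OF sm.power_series_mem[OF t]] r1(1) F r1(3)])
      fix y
      have "(\<lambda>n. smoothing (flux_coeff \<alpha> \<beta> a b n) y * t ^ n - (Dx ^^ 2) (smoothing (flux_coeff \<alpha> \<beta> a b n)) y * t ^ n) sums
          (?W y - (Dx ^^ 2) ?W y)"
        by (intro sums_diff sm.power_series_sums sm.power_series_Dx_sums t)
      moreover have "smoothing (flux_coeff \<alpha> \<beta> a b n) y * t ^ n - (Dx ^^ 2) (smoothing (flux_coeff \<alpha> \<beta> a b n)) y * t ^ n
          = Dx (flux_coeff \<alpha> \<beta> a b n) y * t ^ n" for n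
        using smoothing_helmholtz[OF sobolev_smooth_cont[OF dominatedD(1)[OF domfl], of 0] r1(3), of n y]
        by (simp add: numeral_2_eq_2 left_diff_distrib[symmetric])
      ultimately have "(\<lambda>n. Dx (flux_coeff \<alpha> \<beta> a b n) y * t ^ n) sums (?W y - (Dx ^^ 2) ?W y)"
        by simp
      moreover have "(\<lambda>n. Dx (flux_coeff \<alpha> \<beta> a b n) y * t ^ n) sums Dx (CH_flux \<alpha> \<beta> (u t) (v t)) y"
        using fl.power_series_Dx_sums[OF t, of 1 y] by (simp add: flux)
      ultimately show "?W y - Dx (Dx ?W) y = Dx (CH_flux \<alpha> \<beta> (u t) (v t)) y"
        using sums_unique2 by (fastforce simp: numeral_2_eq_2)
    qed
    have H: "helmholtz_inv (Dx (CH_flux \<alpha> \<beta> (u t) (v t))) x = ?W x"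
      unfolding W using helmholtz_inv_Dx[OF F r1(3)] by simp
    have sDuu: "(\<lambda>n. Dx (cauchy_product a a n) x * t ^ n) sums Dx (\<lambda>y. u t y * u t y) x"
      using aa.power_series_Dx_sums[OF t, of 1 x] by (simp add: uu)
    have sDuv: "(\<lambda>n. Dx (cauchy_product a b n) x * t ^ n) sums Dx (\<lambda>y. u t y * v t y) x"
      using ab.power_series_Dx_sums[OF t, of 1 x] by (simp add: uv)
    have us: "u t \<in> smooth"
      using analytic_space_smooth[OF a.power_series_mem[OF t]] by (simp add: u_def sobolev_smooth_def)
    have Duu: "Dx (\<lambda>y. u t y * u t y) x = 2 * (u t x * Dx (u t) x)"
      using smooth_mult(2)[OF us us, of 1] by simp
    have ut: "power_series a.time_diff t x = - (of_real \<beta> * u t x * Dx (u t) x + helmholtz_inv (Dx (CH_flux \<alpha> \<beta> (u t) (v t))) x)"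
    proof -
      have "(\<lambda>n. - 1 * (of_real (\<beta> / 2) * (Dx (cauchy_product a a n) x * t ^ n) + smoothing (flux_coeff \<alpha> \<beta> a b n) x * t ^ n)) sums
          (- 1 * (of_real (\<beta> / 2) * Dx (\<lambda>y. u t y * u t y) x + ?W x))"
        by (intro sums_add sums_mult sDuu sm.power_series_sums t)
      moreover have "- 1 * (of_real (\<beta> / 2) * (Dx (cauchy_product a a n) x * t ^ n) + smoothing (flux_coeff \<alpha> \<beta> a b n) x * t ^ n)
         = a.time_diff n x * t ^ n" for n
      proof -
        have "of_nat (Suc n) * complex_of_real (- 1 / real (Suc n)) = - 1"
          by (simp del: of_nat_Suc)
        then have td: "a.time_diff n x = - 1 * (of_real (\<beta> / 2) * Dx (cauchy_product a a n) x + smoothing (flux_coeff \<alpha> \<beta> a b n) x)"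
          unfolding a.time_diff_def aS next_u_def mult.assoc[symmetric] by (simp only:)
        show ?thesis unfolding td by (simp only: distrib_right distrib_left mult.assoc)
      qed
      ultimately have "(\<lambda>n. a.time_diff n x * t ^ n) sums (- 1 * (of_real (\<beta> / 2) * Dx (\<lambda>y. u t y * u t y) x + ?W x))"
        by simp
      then show ?thesis
        using sums_unique2[OF analytic_power_series.power_series_sums[OF a.time_diff_series t, of x]]
        unfolding H Duu by fastforce
    qed
    have vt: "power_series b.time_diff t x = - (Dx (u t) x + Dx (\<lambda>y. u t y * v t y) x)"
    proof -
      have "(\<lambda>n. - 1 * (Dx (a n) x * t ^ n + Dx (cauchy_product a b n) x * t ^ n)) sums (- 1 * (Dx (u t) x + Dx (\<lambda>y. u t y * v t y) x))"
        by (intro sums_add sums_mult sDu sDuv)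
      moreover have "- 1 * (Dx (a n) x * t ^ n + Dx (cauchy_product a b n) x * t ^ n) = b.time_diff n x * t ^ n" for n
      proof -
        have "of_nat (Suc n) * complex_of_real (- 1 / real (Suc n)) = - 1"
          by (simp del: of_nat_Suc)
        moreover have "Dx (\<lambda>y. a n y + cauchy_product a b n y) x = Dx (a n) x + Dx (cauchy_product a b n) x"
          using smooth_add(2)[OF sobolev_smooth_smooth[OF analytic_space_smooth[OF a.mem]] sobolev_smooth_smooth[OF analytic_space_smooth[OF ab.mem]], of 1 n n]
          by simp
        ultimately have td: "b.time_diff n x = - 1 * (Dx (a n) x + Dx (cauchy_product a b n) x)"
          unfolding b.time_diff_def bS next_v_def mult.assoc[symmetric] by (simp only:)
        show ?thesis unfolding td by (simp only: distrib_right distrib_left mult.assoc)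
      qed
      ultimately show ?thesis
        using sums_unique2[OF analytic_power_series.power_series_sums[OF b.time_diff_series t, of x]] by fastforce
    qed
    show "\<exists>ut vt. ((\<lambda>\<tau>. u \<tau> x) has_field_derivative ut) (at t) \<and> ((\<lambda>\<tau>. v \<tau> x) has_field_derivative vt) (at t) \<and>
        ut + of_real \<beta> * u t x * Dx (u t) x + helmholtz_inv (Dx (CH_flux \<alpha> \<beta> (u t) (v t))) x = 0 \<and>
        vt + Dx (u t) x + Dx (\<lambda>y. u t y * v t y) x = 0"
    proof (intro exI conjI)
      show "((\<lambda>\<tau>. u \<tau> x) has_field_derivative power_series a.time_diff t x) (at t)"
        "((\<lambda>\<tau>. v \<tau> x) has_field_derivative power_series b.time_diff t x) (at t)"
        using a.power_series_has_field_derivative[OF t] b.power_series_has_field_derivative[OF t]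
        by (simp_all add: u_def v_def)
    qed (simp_all add: ut vt)
  qed
  have real: "u t x \<in> \<real> \<and> v t x \<in> \<real>" if t: "t \<in> ball 0 R" "t \<in> \<real>" for t x
  proof -
    have re: "cnj (a n x) = a n x \<and> cnj (b n x) = b n x" for n x
      by (rule CH_coefficients_real[OF r dom N(1) K0 _ _ aS bS]) (simp_all add: a0 b0 f_def g_def)
    have ct: "cnj t = t" using t(2) by (simp add: Reals_cnj_iff)
    have "cnj (power_series c t x) = power_series c t x"
      if "(\<lambda>n. c n x * t ^ n) sums power_series c t x" "\<And>n. cnj (c n x) = c n x" for c
    proof -
      have "(\<lambda>n. cnj (c n x * t ^ n)) sums cnj (power_series c t x)"
        using that(1) by (simp only: sums_cnj)
      then have "(\<lambda>n. c n x * t ^ n) sums cnj (power_series c t x)"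
        by (simp add: that(2) ct)
      with that(1) show ?thesis by (rule sums_unique2[symmetric])
    qed
    then show ?thesis
      using a.power_series_sums[of t x] b.power_series_sums[of t x] t re
      by (auto simp: u_def v_def Reals_cnj_iff)
  qed
  show ?thesis
    by (rule that[of u v]) (use hol sol real in \<open>auto simp: analytic_solution_def R_def\<close>)
qed

section \<open>Uniqueness of solutions\<close>

text \<open>The functions \<open>f t\<close> vanish to order \<open>n\<close> at time zero, with every derivative in \<open>x\<close> and uniformly in \<open>x\<close>; for
  \<open>n = 0\<close> this is boundedness. The constants may depend on the derivative in an
  arbitrary way, so losing a derivative costs nothing.\<close>

definition uniform_order :: "real \<Rightarrow> nat \<Rightarrow> (complex \<Rightarrow> real \<Rightarrow> complex) \<Rightarrow> bool" where
  "uniform_order \<rho> n f \<longleftrightarrow> (\<forall>t. cmod t < \<rho> \<longrightarrow> f t \<in> smooth) \<and>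
     (\<forall>k. \<exists>C. \<forall>t x. cmod t < \<rho> \<longrightarrow> cmod ((Dx ^^ k) (f t) x) \<le> C * cmod t ^ n)"

lemma uniform_orderI:
  assumes "\<And>t. cmod t < \<rho> \<Longrightarrow> f t \<in> smooth"
    and "\<And>k. \<exists>C. \<forall>t x. cmod t < \<rho> \<longrightarrow> cmod ((Dx ^^ k) (f t) x) \<le> C * cmod t ^ n"
  shows "uniform_order \<rho> n f"
  using assms by (auto simp: uniform_order_def)

lemma uniform_order_smooth: "uniform_order \<rho> n f \<Longrightarrow> cmod t < \<rho> \<Longrightarrow> f t \<in> smooth"
  by (simp add: uniform_order_def)

lemma uniform_order_bound:
  assumes "uniform_order \<rho> n f"
  shows "\<exists>C\<ge>0. \<forall>t x. cmod t < \<rho> \<longrightarrow> cmod ((Dx ^^ k) (f t) x) \<le> C * cmod t ^ n"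
proof -
  have "\<exists>C. \<forall>t x. cmod t < \<rho> \<longrightarrow> cmod ((Dx ^^ k) (f t) x) \<le> C * cmod t ^ n"
    using assms unfolding uniform_order_def by blast
  then obtain C where C: "\<And>t x. cmod t < \<rho> \<Longrightarrow> cmod ((Dx ^^ k) (f t) x) \<le> C * cmod t ^ n"
    by blast
  show ?thesis
  proof (intro exI[of _ "\<bar>C\<bar>"] conjI allI impI)
    fix t x assume t: "cmod t < \<rho>"
    have "C * cmod t ^ n \<le> \<bar>C\<bar> * cmod t ^ n" by (intro mult_right_mono) auto
    with C[OF t, of x] show "cmod ((Dx ^^ k) (f t) x) \<le> \<bar>C\<bar> * cmod t ^ n" by linarith
  qed simp
qed

lemma uniform_order_cong:
  assumes "uniform_order \<rho> n f" "\<And>t. cmod t < \<rho> \<Longrightarrow> f t = g t"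
  shows "uniform_order \<rho> n g"
  using assms by (auto simp: uniform_order_def)

lemma uniform_order_add:
  assumes f: "uniform_order \<rho> n f" and g: "uniform_order \<rho> n g"
  shows "uniform_order \<rho> n (\<lambda>t x. f t x + g t x)"
proof (rule uniform_orderI)
  note s = uniform_order_smooth[OF f] uniform_order_smooth[OF g]
  show "(\<lambda>x. f t x + g t x) \<in> smooth" if "cmod t < \<rho>" for t
    by (rule smooth_add(1)[OF s(1)[OF that] s(2)[OF that]])
  fix k
  obtain C where C: "\<And>t x. cmod t < \<rho> \<Longrightarrow> cmod ((Dx ^^ k) (f t) x) \<le> C * cmod t ^ n"
    using uniform_order_bound[OF f, of "k"] by blast
  obtain D where D: "\<And>t x. cmod t < \<rho> \<Longrightarrow> cmod ((Dx ^^ k) (g t) x) \<le> D * cmod t ^ n"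
    using uniform_order_bound[OF g, of "k"] by blast
  have "cmod ((Dx ^^ k) (\<lambda>x. f t x + g t x) x) \<le> (C + D) * cmod t ^ n" if t: "cmod t < \<rho>" for t x
    unfolding smooth_add(2)[OF s(1)[OF t] s(2)[OF t]] distrib_right
    by (rule order_trans[OF norm_triangle_ineq add_mono[OF C[OF t] D[OF t]]])
  then show "\<exists>C. \<forall>t x. cmod t < \<rho> \<longrightarrow> cmod ((Dx ^^ k) (\<lambda>x. f t x + g t x) x) \<le> C * cmod t ^ n"
    by blast
qed

lemma uniform_order_cmult:
  assumes f: "uniform_order \<rho> n f"
  shows "uniform_order \<rho> n (\<lambda>t x. c * f t x)"
proof (rule uniform_orderI)
  note s = uniform_order_smooth[OF f]
  show "(\<lambda>x. c * f t x) \<in> smooth" if "cmod t < \<rho>" for t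
    by (rule smooth_cmult(1)[OF s[OF that]])
  fix k
  obtain C where C: "\<And>t x. cmod t < \<rho> \<Longrightarrow> cmod ((Dx ^^ k) (f t) x) \<le> C * cmod t ^ n"
    using uniform_order_bound[OF f, of "k"] by blast
  have "cmod ((Dx ^^ k) (\<lambda>x. c * f t x) x) \<le> cmod c * C * cmod t ^ n" if t: "cmod t < \<rho>" for t x
    unfolding smooth_cmult(2)[OF s[OF t]] norm_mult mult.assoc
    by (rule mult_left_mono[OF C[OF t]]) simp
  then show "\<exists>C. \<forall>t x. cmod t < \<rho> \<longrightarrow> cmod ((Dx ^^ k) (\<lambda>x. c * f t x) x) \<le> C * cmod t ^ n"
    by blast
qed

lemma uniform_order_diff:
  assumes "uniform_order \<rho> n f" "uniform_order \<rho> n g"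
  shows "uniform_order \<rho> n (\<lambda>t x. f t x - g t x)"
  using uniform_order_add[OF assms(1) uniform_order_cmult[OF assms(2), of "-1"]] by simp

lemma uniform_order_mult:
  assumes f: "uniform_order \<rho> n f" and g: "uniform_order \<rho> 0 g"
  shows "uniform_order \<rho> n (\<lambda>t x. f t x * g t x)"
proof (rule uniform_orderI)
  note s = uniform_order_smooth[OF f] uniform_order_smooth[OF g]
  show "(\<lambda>x. f t x * g t x) \<in> smooth" if "cmod t < \<rho>" for t
    by (rule smooth_mult(1)[OF s(1)[OF that] s(2)[OF that]])
  fix k
  have "\<forall>i. \<exists>C. C \<ge> 0 \<and> (\<forall>t x. cmod t < \<rho> \<longrightarrow> cmod ((Dx ^^ i) (f t) x) \<le> C * cmod t ^ n)"
    by (rule allI) (rule uniform_order_bound[OF f])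
  from choice[OF this] obtain C
    where C: "C i \<ge> 0 \<and> (\<forall>t x. cmod t < \<rho> \<longrightarrow> cmod ((Dx ^^ i) (f t) x) \<le> C i * cmod t ^ n)" for i
    by (elim exE) (rule that, rule spec)
  have "\<forall>i. \<exists>C. C \<ge> 0 \<and> (\<forall>t x. cmod t < \<rho> \<longrightarrow> cmod ((Dx ^^ i) (g t) x) \<le> C * cmod t ^ 0)"
    by (rule allI) (rule uniform_order_bound[OF g])
  from choice[OF this] obtain D
    where D: "D i \<ge> 0 \<and> (\<forall>t x. cmod t < \<rho> \<longrightarrow> cmod ((Dx ^^ i) (g t) x) \<le> D i * cmod t ^ 0)" for i
    by (elim exE) (rule that, rule spec)
  have nn: "C i \<ge> 0" "D i \<ge> 0" for i
    using C[of i] D[of i] by auto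
  have Cb: "cmod ((Dx ^^ i) (f t) x) \<le> C i * cmod t ^ n" and Db: "cmod ((Dx ^^ i) (g t) x) \<le> D i * cmod t ^ 0"
    if "cmod t < \<rho>" for i t x
    using C[of i] D[of i] that by auto
  have "cmod ((Dx ^^ k) (\<lambda>x. f t x * g t x) x) \<le> (\<Sum>i\<le>k. real (k choose i) * (C i * D (k - i))) * cmod t ^ n"
    if t: "cmod t < \<rho>" for t x
  proof -
    have "cmod ((Dx ^^ k) (\<lambda>x. f t x * g t x) x) \<le> (\<Sum>i\<le>k. cmod (of_nat (k choose i) * ((Dx ^^ i) (f t) x * (Dx ^^ (k - i)) (g t) x)))"
      unfolding smooth_mult(2)[OF s(1)[OF t] s(2)[OF t]] by (rule norm_sum)
    also have "\<dots> \<le> (\<Sum>i\<le>k. real (k choose i) * ((C i * cmod t ^ n) * (D (k - i) * cmod t ^ 0)))"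
      unfolding norm_mult norm_of_nat
      by (intro sum_mono mult_left_mono mult_mono Cb Db nn t mult_nonneg_nonneg) simp_all
    finally show ?thesis
      unfolding sum_distrib_right by (simp add: mult_ac)
  qed
  then show "\<exists>C. \<forall>t x. cmod t < \<rho> \<longrightarrow> cmod ((Dx ^^ k) (\<lambda>x. f t x * g t x) x) \<le> C * cmod t ^ n"
    by blast
qed

lemma uniform_order_Dx:
  assumes f: "uniform_order \<rho> n f"
  shows "uniform_order \<rho> n (\<lambda>t. Dx (f t))"
proof (rule uniform_orderI)
  show "Dx (f t) \<in> smooth" if "cmod t < \<rho>" for t
    by (rule smooth_Dx[OF uniform_order_smooth[OF f that]])
  fix k
  obtain C where C: "\<And>t x. cmod t < \<rho> \<Longrightarrow> cmod ((Dx ^^ Suc k) (f t) x) \<le> C * cmod t ^ n"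
    using uniform_order_bound[OF f, of "Suc k"] by blast
  show "\<exists>C. \<forall>t x. cmod t < \<rho> \<longrightarrow> cmod ((Dx ^^ k) (Dx (f t)) x) \<le> C * cmod t ^ n"
    unfolding Dx_funpow_Dx using C by blast
qed

text \<open>The bound for bounded solutions of \<open>w - w'' = g\<close>, applied to each derivative.\<close>

lemma uniform_order_smoothing:
  assumes f: "uniform_order \<rho> n f" and S: "\<And>t. cmod t < \<rho> \<Longrightarrow> f t \<in> sobolev_smooth r" and r: "r \<ge> 2"
  shows "uniform_order \<rho> n (\<lambda>t. smoothing (f t))"
proof (rule uniform_orderI)
  note w = sobolev_smooth_smoothing[OF S r]
  show "smoothing (f t) \<in> smooth" if "cmod t < \<rho>" for t
    by (rule sobolev_smooth_smooth[OF w(2)[OF that]])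
  fix k
  obtain C where C: "\<And>t x. cmod t < \<rho> \<Longrightarrow> cmod ((Dx ^^ Suc k) (f t) x) \<le> C * cmod t ^ n"
    using uniform_order_bound[OF f, of "Suc k"] by blast
  have r1: "r + 1 \<ge> 1" using r by simp
  have "cmod ((Dx ^^ k) (smoothing (f t)) x) \<le> C * cmod t ^ n" if t: "cmod t < \<rho>" for t x
  proof (rule helmholtz_bound)
    note d = smooth_has_vector_derivative[OF sobolev_smooth_smooth[OF w(2)[OF t]]]
    show "((Dx ^^ k) (smoothing (f t)) has_vector_derivative (Dx ^^ Suc k) (smoothing (f t)) x) (at x)"
      "((Dx ^^ Suc k) (smoothing (f t)) has_vector_derivative (Dx ^^ Suc (Suc k)) (smoothing (f t)) x) (at x)" for x
      by (rule d)+
    show "cmod ((Dx ^^ k) (smoothing (f t)) x) \<le> embedding_const * sobolev_norm (r + 1) ((Dx ^^ k) (smoothing (f t)))"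
      "cmod ((Dx ^^ Suc k) (smoothing (f t)) x) \<le> embedding_const * sobolev_norm (r + 1) ((Dx ^^ Suc k) (smoothing (f t)))" for x
      by (rule sobolev_smooth_sup_bound[OF r1 w(2)[OF t]])+
    show "cmod ((Dx ^^ k) (smoothing (f t)) x - (Dx ^^ Suc (Suc k)) (smoothing (f t)) x) \<le> C * cmod t ^ n" for x
      using smoothing_helmholtz[OF sobolev_smooth_cont[OF S[OF t], of k] r, of x] C[OF t, of x]
      by (simp add: w(1)[OF t, symmetric])
  qed
  then show "\<exists>C. \<forall>t x. cmod t < \<rho> \<longrightarrow> cmod ((Dx ^^ k) (smoothing (f t)) x) \<le> C * cmod t ^ n"
    by blast
qed

text \<open>Integration in time raises the order by one.\<close>

lemma uniform_order_integrate:
  assumes s: "\<And>t. cmod t < \<rho> \<Longrightarrow> w t \<in> smooth" and G: "uniform_order \<rho> n G"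
    and d: "\<And>t k x. cmod t < \<rho> \<Longrightarrow> ((\<lambda>\<tau>. (Dx ^^ k) (w \<tau>) x) has_field_derivative (Dx ^^ k) (G t) x) (at t)"
    and w0: "\<And>k x. (Dx ^^ k) (w 0) x = 0"
  shows "uniform_order \<rho> (Suc n) w"
proof (rule uniform_orderI)
  fix k
  obtain C where C: "C \<ge> 0" "\<And>t x. cmod t < \<rho> \<Longrightarrow> cmod ((Dx ^^ k) (G t) x) \<le> C * cmod t ^ n"
    using uniform_order_bound[OF G, of "k"] by blast
  have "cmod ((Dx ^^ k) (w t) x) \<le> C * cmod t ^ Suc n" if t: "cmod t < \<rho>" for t x
  proof -
    have "cmod ((Dx ^^ k) (w t) x - (Dx ^^ k) (w 0) x) \<le> (C * cmod t ^ n) * cmod (t - 0)"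
    proof (rule field_differentiable_bound[of "cball 0 (cmod t)"])
      fix \<tau> :: complex assume "\<tau> \<in> cball 0 (cmod t)"
      then have \<tau>: "cmod \<tau> \<le> cmod t" by simp
      then show "((\<lambda>\<tau>. (Dx ^^ k) (w \<tau>) x) has_field_derivative (Dx ^^ k) (G \<tau>) x) (at \<tau> within cball 0 (cmod t))"
        using t by (auto intro!: has_field_derivative_at_within[OF d])
      have "cmod ((Dx ^^ k) (G \<tau>) x) \<le> C * cmod \<tau> ^ n"
        using \<tau> t by (intro C(2)) simp
      also have "\<dots> \<le> C * cmod t ^ n"
        using \<tau> C(1) by (intro mult_left_mono power_mono) auto
      finally show "cmod ((Dx ^^ k) (G \<tau>) x) \<le> C * cmod t ^ n" .
    qed simp_all
    then show ?thesis
      by (simp add: w0 mult_ac)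
  qed
  then show "\<exists>C. \<forall>t x. cmod t < \<rho> \<longrightarrow> cmod ((Dx ^^ k) (w t) x) \<le> C * cmod t ^ Suc n"
    by blast
qed (rule s)

text \<open>Cauchy's inequality on small circles shows that all Taylor coefficients at the origin vanish.\<close>

lemma holomorphic_zero_of_infinite_order:
  assumes g: "g holomorphic_on ball 0 R" and \<rho>: "0 < \<rho>" "\<rho> \<le> R"
    and z: "\<And>n. \<exists>C. \<forall>t. cmod t < \<rho> \<longrightarrow> cmod (g t) \<le> C * cmod t ^ n" and t: "t \<in> ball 0 R"
  shows "g t = 0"
proof (rule holomorphic_fun_eq_0_on_connected[OF g _ _ _ _ t])
  show "0 \<in> ball (0::complex) R" using \<rho> by simp
  fix n
  obtain C where C: "\<And>t. cmod t < \<rho> \<Longrightarrow> cmod (g t) \<le> C * cmod t ^ Suc n"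
    using z by blast
  have le: "cmod ((deriv ^^ n) g 0) \<le> fact n * C * e" if e: "0 < e" "e < \<rho>" for e
  proof -
    have "cmod ((deriv ^^ n) g 0) \<le> fact n * (C * e ^ Suc n) / e ^ n"
    proof (rule Cauchy_inequality)
      show "g holomorphic_on ball 0 e" "continuous_on (cball 0 e) g"
        using e \<rho> by (auto intro!: holomorphic_on_subset[OF g] holomorphic_on_imp_continuous_on)
      show "cmod (g x) \<le> C * e ^ Suc n" if "cmod (0 - x) = e" for x
        using C[of x] that e by simp
    qed (use e in simp)
    also have "\<dots> = fact n * C * e" using e by simp
    finally show ?thesis .
  qed
  have "((\<lambda>e. fact n * C * e) \<longlongrightarrow> fact n * C * 0) (at_right 0)"
    by (intro tendsto_intros)
  then have "cmod ((deriv ^^ n) g 0) \<le> fact n * C * 0"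
    by (rule tendsto_lowerbound) (use \<rho> le in \<open>auto intro!: eventually_at_rightI[of 0 \<rho>]\<close>)
  then show "(deriv ^^ n) g 0 = 0" by simp
qed simp_all

context
  fixes \<delta> r :: real
  assumes r1: "r \<ge> 1" and \<delta>0: "\<delta> > 0"
begin

lemma analytic_quotient:
  assumes "f \<in> analytic_space \<delta> r" "g \<in> analytic_space \<delta> r" "p \<in> analytic_space \<delta> r"
  shows "(\<lambda>x. (f x - g x) / h - p x) \<in> analytic_space \<delta> r"
    and "(Dx ^^ k) (\<lambda>x. (f x - g x) / h - p x) x = ((Dx ^^ k) f x - (Dx ^^ k) g x) / h - (Dx ^^ k) p x"
proof -
  have e: "(\<lambda>x. (f x - g x) / h - p x) = (\<lambda>x. (1 / h) * (f x - g x) - p x)" by simp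
  note S = sobolev_smooth_smooth[OF analytic_space_smooth]
  note s = S[OF assms(1)] S[OF assms(2)] S[OF assms(3)]
  show "(\<lambda>x. (f x - g x) / h - p x) \<in> analytic_space \<delta> r"
    unfolding e by (intro analytic_space_diff[OF r1 \<delta>0] analytic_space_cmult[OF r1 \<delta>0] assms)
  show "(Dx ^^ k) (\<lambda>x. (f x - g x) / h - p x) x = ((Dx ^^ k) f x - (Dx ^^ k) g x) / h - (Dx ^^ k) p x"
    unfolding e smooth_diff(2)[OF smooth_cmult(1)[OF smooth_diff(1)[OF s(1,2)]] s(3)]
      smooth_cmult(2)[OF smooth_diff(1)[OF s(1,2)]] smooth_diff(2)[OF s(1,2)]
    by simp
qed

text \<open>The analytic norm bounds every derivative in \<open>x\<close>, so the difference quotients of all of them converge,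
  and near the point they are bounded on a common disk.\<close>

lemma analytic_derivative:
  assumes D: "open D" "t \<in> D" and u: "\<And>\<tau>. \<tau> \<in> D \<Longrightarrow> u \<tau> \<in> analytic_space \<delta> r" and p: "p \<in> analytic_space \<delta> r"
    and lim: "((\<lambda>h. analytic_norm \<delta> r (\<lambda>x. (u (t + h) x - u t x) / h - p x)) \<longlongrightarrow> 0) (at 0)"
  shows "((\<lambda>\<tau>. (Dx ^^ k) (u \<tau>) x) has_field_derivative (Dx ^^ k) p x) (at t)"
    and "\<exists>\<rho>>0. \<forall>k. \<exists>C. \<forall>h x. cmod h < \<rho> \<longrightarrow> cmod ((Dx ^^ k) (u (t + h)) x) \<le> C"
proof -
  let ?q = "\<lambda>h x. (u (t + h) x - u t x) / h - p x"
  obtain e where e: "e > 0" "ball t e \<subseteq> D"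
    using D by (auto simp: open_contains_ball)
  have inD: "t + h \<in> D" if "cmod h < e" for h
    using e that by (auto simp: dist_norm)
  have q: "?q h \<in> analytic_space \<delta> r" if "cmod h < e" for h
    by (intro analytic_quotient(1) u inD that D p)
  have b: "cmod (((Dx ^^ k) (u (t + h)) x - (Dx ^^ k) (u t) x) / h - (Dx ^^ k) p x) \<le> analytic_sup_const \<delta> k * analytic_norm \<delta> r (?q h)"
    if "cmod h < e" for h k x
    using analytic_sup_bound[OF r1 \<delta>0 q[OF that], of k x]
    unfolding analytic_quotient(2)[OF u[OF inD[OF that]] u[OF D(2)] p] .
  show "((\<lambda>\<tau>. (Dx ^^ k) (u \<tau>) x) has_field_derivative (Dx ^^ k) p x) (at t)"
    unfolding DERIV_def
  proof (rule LIM_zero_cancel, rule Lim_null_comparison)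
    show "\<forall>\<^sub>F h in at 0. norm (((Dx ^^ k) (u (t + h)) x - (Dx ^^ k) (u t) x) / h - (Dx ^^ k) p x) \<le> analytic_sup_const \<delta> k * analytic_norm \<delta> r (?q h)"
      unfolding eventually_at using e b by (intro exI[of _ e]) auto
    show "((\<lambda>h. analytic_sup_const \<delta> k * analytic_norm \<delta> r (?q h)) \<longlongrightarrow> 0) (at 0)"
      by (rule tendsto_mult_right_zero[OF lim])
  qed
  have "\<forall>\<^sub>F h in at 0. analytic_norm \<delta> r (?q h) < 1"
    using order_tendstoD(2)[OF lim, of 1] by simp
  then obtain d where d: "d > 0" "\<And>h. h \<noteq> 0 \<Longrightarrow> cmod h < d \<Longrightarrow> analytic_norm \<delta> r (?q h) < 1"
    by (auto simp: eventually_at)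
  define \<rho> where "\<rho> = min d e"
  have "cmod ((Dx ^^ k) (u (t + h)) x) \<le> analytic_sup_const \<delta> k * (analytic_norm \<delta> r (u t) + \<rho> * (analytic_norm \<delta> r p + 1))"
    if h: "cmod h < \<rho>" for h k x
  proof -
    let ?c = "analytic_sup_const \<delta> k"
    have c0: "?c \<ge> 0" by (rule analytic_sup_const_nonneg[OF r1 \<delta>0])
    have np: "analytic_norm \<delta> r p \<ge> 0" by (rule analytic_norm_nonneg[OF p])
    have ut: "cmod ((Dx ^^ k) (u t) x) \<le> ?c * analytic_norm \<delta> r (u t)"
      by (rule analytic_sup_bound[OF r1 \<delta>0 u[OF D(2)]])
    show ?thesis
    proof (cases "h = 0")
      case True
      have "0 \<le> ?c * (\<rho> * (analytic_norm \<delta> r p + 1))"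
        using c0 np order_trans[OF norm_ge_zero less_imp_le[OF h]] by (intro mult_nonneg_nonneg) auto
      then show ?thesis using ut True by (simp add: distrib_left)
    next
      case False
      define Q where "Q = ((Dx ^^ k) (u (t + h)) x - (Dx ^^ k) (u t) x) / h - (Dx ^^ k) p x"
      have "analytic_norm \<delta> r (?q h) \<le> 1"
        using d(2)[OF False] h by (simp add: \<rho>_def less_imp_le)
      then have "?c * analytic_norm \<delta> r (?q h) \<le> ?c * 1"
        using c0 by (rule mult_left_mono)
      then have "cmod Q \<le> ?c * 1"
        using b[of h k x] h unfolding Q_def \<rho>_def by simp
      moreover have "cmod ((Dx ^^ k) p x) \<le> ?c * analytic_norm \<delta> r p"
        by (rule analytic_sup_bound[OF r1 \<delta>0 p])
      ultimately have "cmod (Q + (Dx ^^ k) p x) \<le> ?c * (analytic_norm \<delta> r p + 1)"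
        using norm_triangle_ineq[of Q "(Dx ^^ k) p x"] by (simp add: distrib_left)
      then have hQ: "cmod h * cmod (Q + (Dx ^^ k) p x) \<le> \<rho> * (?c * (analytic_norm \<delta> r p + 1))"
        using h order_trans[OF norm_ge_zero less_imp_le[OF h]] by (intro mult_mono) auto
      have "(Dx ^^ k) (u (t + h)) x = (Dx ^^ k) (u t) x + h * (Q + (Dx ^^ k) p x)"
        using False by (simp add: Q_def)
      then have "cmod ((Dx ^^ k) (u (t + h)) x) \<le> cmod ((Dx ^^ k) (u t) x) + cmod h * cmod (Q + (Dx ^^ k) p x)"
        using norm_triangle_ineq[of "(Dx ^^ k) (u t) x" "h * (Q + (Dx ^^ k) p x)"] by (simp add: norm_mult)
      also have "\<dots> \<le> ?c * analytic_norm \<delta> r (u t) + \<rho> * (?c * (analytic_norm \<delta> r p + 1))"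
        by (rule add_mono[OF ut hQ])
      also have "\<dots> = ?c * (analytic_norm \<delta> r (u t) + \<rho> * (analytic_norm \<delta> r p + 1))"
        by (simp only: distrib_left mult.left_commute)
      finally show ?thesis .
    qed
  qed
  then show "\<exists>\<rho>>0. \<forall>k. \<exists>C. \<forall>h x. cmod h < \<rho> \<longrightarrow> cmod ((Dx ^^ k) (u (t + h)) x) \<le> C"
    using d(1) e(1) by (intro exI[of _ \<rho>]) (auto simp: \<rho>_def)
qed

end

lemma smoothing_diff:
  assumes f: "f \<in> sobolev_smooth r" and g: "g \<in> sobolev_smooth r" and r: "r \<ge> 2"
  shows "(\<lambda>x. smoothing f x - smoothing g x) = smoothing (\<lambda>x. f x - g x)"
proof (rule smoothing_unique)
  have r1: "r \<ge> 1" "r + 1 \<ge> 1" using r by auto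
  note S = sobolev_smooth_smoothing(2)[OF f r] sobolev_smooth_smoothing(2)[OF g r]
  note s = S[THEN sobolev_smooth_smooth]
  show "(\<lambda>x. smoothing f x - smoothing g x) \<in> sobolev_smooth (r + 1)"
    by (rule sobolev_smooth_diff[OF r1(2) S])
  show "r + 1 \<ge> 1" "r \<ge> 2" by fact+
  show "(\<lambda>x. f x - g x) \<in> sobolev_smooth r"
    by (rule sobolev_smooth_diff[OF r1(1) f g])
  fix x
  have "Dx (\<lambda>x. f x - g x) x = Dx f x - Dx g x"
    using smooth_diff(2)[OF f[THEN sobolev_smooth_smooth] g[THEN sobolev_smooth_smooth], of 1] by simp
  moreover have "Dx (Dx (\<lambda>x. smoothing f x - smoothing g x)) x = Dx (Dx (smoothing f)) x - Dx (Dx (smoothing g)) x"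
    using smooth_diff(2)[OF s, of 2] by (simp add: numeral_2_eq_2)
  ultimately show "(smoothing f x - smoothing g x) - Dx (Dx (\<lambda>x. smoothing f x - smoothing g x)) x = Dx (\<lambda>x. f x - g x) x"
    using smoothing_helmholtz[OF sobolev_smooth_cont[OF f, of 0] r, of x] smoothing_helmholtz[OF sobolev_smooth_cont[OF g, of 0] r, of x]
    by (simp add: algebra_simps)
qed

text \<open>The right hand sides of the system, with \<open>\<beta> * f * Dx f\<close> and the nonlocal term in the form used by the
  recursion.\<close>

definition CH_rhs_u :: "real \<Rightarrow> real \<Rightarrow> (real \<Rightarrow> complex) \<Rightarrow> (real \<Rightarrow> complex) \<Rightarrow> real \<Rightarrow> complex" where
  "CH_rhs_u \<alpha> \<beta> f g x = - 1 * (of_real (\<beta> / 2) * Dx (\<lambda>y. f y * f y) x + smoothing (CH_flux \<alpha> \<beta> f g) x)"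

definition CH_rhs_v :: "(real \<Rightarrow> complex) \<Rightarrow> (real \<Rightarrow> complex) \<Rightarrow> real \<Rightarrow> complex" where
  "CH_rhs_v f g x = - 1 * (Dx f x + Dx (\<lambda>y. f y * g y) x)"

lemma CH_flux_sobolev_smooth:
  assumes r: "r \<ge> 3" and f: "f \<in> sobolev_smooth r" and g: "g \<in> sobolev_smooth r"
  shows "CH_flux \<alpha> \<beta> f g \<in> sobolev_smooth (r - 1)"
proof -
  have r1: "r - 1 \<ge> 1" "r - 1 \<le> r" "r \<ge> 1" using r by auto
  have m: "h \<in> sobolev_smooth r \<Longrightarrow> h \<in> sobolev_smooth (r - 1)" for h
    by (rule sobolev_smooth_mono[OF _ r1(1,2)])
  note f' = m[OF f] and g' = m[OF g] and d' = m[OF sobolev_smooth_Dx[OF r1(3) f]]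
  have "(\<lambda>x. (- of_real \<alpha>) * f x + of_real ((3 - \<beta>) / 2) * (f x * f x) + of_real (\<beta> / 2) * (Dx f x * Dx f x)
     + g x + (1 / 2) * (g x * g x)) \<in> sobolev_smooth (r - 1)"
    by (intro sobolev_smooth_add[OF r1(1)] sobolev_smooth_cmult[OF r1(1)] sobolev_smooth_mult(1)[OF r1(1)] f' g' d')
  also have "(\<lambda>x. (- of_real \<alpha>) * f x + of_real ((3 - \<beta>) / 2) * (f x * f x) + of_real (\<beta> / 2) * (Dx f x * Dx f x)
     + g x + (1 / 2) * (g x * g x)) = CH_flux \<alpha> \<beta> f g"
    by (auto simp: CH_flux_def power2_eq_square)
  finally show ?thesis .
qed

lemma CH_rhs_smooth:
  assumes r: "r \<ge> 3" and f: "f \<in> sobolev_smooth r" and g: "g \<in> sobolev_smooth r"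
  shows "CH_rhs_u \<alpha> \<beta> f g \<in> smooth" "CH_rhs_v f g \<in> smooth"
proof -
  have r2: "r - 1 \<ge> 2" using r by simp
  note s = f[THEN sobolev_smooth_smooth] g[THEN sobolev_smooth_smooth]
  note w = sobolev_smooth_smooth[OF sobolev_smooth_smoothing(2)[OF CH_flux_sobolev_smooth[OF r f g] r2]]
  show "CH_rhs_u \<alpha> \<beta> f g \<in> smooth" "CH_rhs_v f g \<in> smooth"
    unfolding CH_rhs_u_def[abs_def] CH_rhs_v_def[abs_def]
    by (intro smooth_cmult smooth_add smooth_Dx smooth_mult s w)+
qed

lemma analytic_solution_derivative:
  assumes r: "r \<ge> 3" and \<delta>: "\<delta> > 0" and sol: "analytic_solution \<alpha> \<beta> \<delta> r D u0 v0 u v" and D: "open D" "t \<in> D"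
  shows "((\<lambda>\<tau>. (Dx ^^ k) (u \<tau>) x) has_field_derivative (Dx ^^ k) (CH_rhs_u \<alpha> \<beta> (u t) (v t)) x) (at t)"
    and "((\<lambda>\<tau>. (Dx ^^ k) (v \<tau>) x) has_field_derivative (Dx ^^ k) (CH_rhs_v (u t) (v t)) x) (at t)"
    and "\<exists>\<rho>>0. \<forall>k. \<exists>C. \<forall>h x. cmod h < \<rho> \<longrightarrow> cmod ((Dx ^^ k) (u (t + h)) x) \<le> C \<and> cmod ((Dx ^^ k) (v (t + h)) x) \<le> C"
proof -
  have r1: "r \<ge> 1" "r - 1 \<ge> 2" using r by auto
  have mem: "\<And>\<tau>. \<tau> \<in> D \<Longrightarrow> u \<tau> \<in> analytic_space \<delta> r" "\<And>\<tau>. \<tau> \<in> D \<Longrightarrow> v \<tau> \<in> analytic_space \<delta> r"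
    using sol by (auto simp: analytic_solution_def holomorphic_pair_def)
  obtain p q where p: "p \<in> analytic_space \<delta> r" and q: "q \<in> analytic_space \<delta> r"
    and lim: "((\<lambda>h. pair_norm \<delta> r (\<lambda>x. (u (t + h) x - u t x) / h - p x) (\<lambda>x. (v (t + h) x - v t x) / h - q x)) \<longlongrightarrow> 0) (at 0)"
    using sol D by (fastforce simp: analytic_solution_def holomorphic_pair_def)
  obtain e where e: "e > 0" "ball t e \<subseteq> D"
    using D by (auto simp: open_contains_ball)
  have inD: "t + h \<in> D" if "cmod h < e" for h
    using e that by (auto simp: dist_norm)
  have nn: "0 \<le> analytic_norm \<delta> r (\<lambda>x. (u (t + h) x - u t x) / h - p x)"
    "0 \<le> analytic_norm \<delta> r (\<lambda>x. (v (t + h) x - v t x) / h - q x)" if "cmod h < e" for h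
    by (intro analytic_norm_nonneg analytic_quotient(1)[OF r1(1) \<delta>] mem p q inD that D)+
  have lu: "((\<lambda>h. analytic_norm \<delta> r (\<lambda>x. (u (t + h) x - u t x) / h - p x)) \<longlongrightarrow> 0) (at 0)"
    by (rule Lim_null_comparison[OF _ lim], unfold eventually_at, rule exI[of _ e])
      (use nn e in \<open>auto simp: pair_norm_def\<close>)
  have lv: "((\<lambda>h. analytic_norm \<delta> r (\<lambda>x. (v (t + h) x - v t x) / h - q x)) \<longlongrightarrow> 0) (at 0)"
    by (rule Lim_null_comparison[OF _ lim], unfold eventually_at, rule exI[of _ e])
      (use nn e in \<open>auto simp: pair_norm_def\<close>)
  note du = analytic_derivative[OF r1(1) \<delta> D mem(1) p lu] and dv = analytic_derivative[OF r1(1) \<delta> D mem(2) q lv]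
  note S = analytic_space_smooth[OF mem(1)[OF D(2)]] analytic_space_smooth[OF mem(2)[OF D(2)]]
  note F = CH_flux_sobolev_smooth[OF r S]
  have "p x = CH_rhs_u \<alpha> \<beta> (u t) (v t) x \<and> q x = CH_rhs_v (u t) (v t) x" for x
  proof -
    obtain ut vt where d: "((\<lambda>\<tau>. u \<tau> x) has_field_derivative ut) (at t)" "((\<lambda>\<tau>. v \<tau> x) has_field_derivative vt) (at t)"
      and eq: "ut + of_real \<beta> * u t x * Dx (u t) x + helmholtz_inv (Dx (CH_flux \<alpha> \<beta> (u t) (v t))) x = 0"
        "vt + Dx (u t) x + Dx (\<lambda>y. u t y * v t y) x = 0"
      using sol D by (force simp: analytic_solution_def solves_CH_def)
    have pq: "p x = ut" "q x = vt"
      using DERIV_unique[OF du(1)[of 0 x, simplified] d(1)] DERIV_unique[OF dv(1)[of 0 x, simplified] d(2)] by auto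
    have us: "u t \<in> smooth" by (rule sobolev_smooth_smooth[OF S(1)])
    have Duu: "Dx (\<lambda>y. u t y * u t y) x = 2 * (u t x * Dx (u t) x)"
      using smooth_mult(2)[OF us us, of 1] by simp
    have "ut = - (of_real \<beta> * u t x * Dx (u t) x + smoothing (CH_flux \<alpha> \<beta> (u t) (v t)) x)"
      using eq(1) unfolding helmholtz_inv_Dx[OF F r1(2)] by (simp only: add.assoc eq_neg_iff_add_eq_0)
    moreover have "vt = - (Dx (u t) x + Dx (\<lambda>y. u t y * v t y) x)"
      using eq(2) by (simp only: add.assoc eq_neg_iff_add_eq_0)
    ultimately show ?thesis
      unfolding pq CH_rhs_u_def CH_rhs_v_def Duu by simp
  qed
  then have "p = CH_rhs_u \<alpha> \<beta> (u t) (v t)" "q = CH_rhs_v (u t) (v t)"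
    by auto
  then show "((\<lambda>\<tau>. (Dx ^^ k) (u \<tau>) x) has_field_derivative (Dx ^^ k) (CH_rhs_u \<alpha> \<beta> (u t) (v t)) x) (at t)"
    "((\<lambda>\<tau>. (Dx ^^ k) (v \<tau>) x) has_field_derivative (Dx ^^ k) (CH_rhs_v (u t) (v t)) x) (at t)"
    using du(1) dv(1) by auto
  obtain \<rho>1 where \<rho>1: "\<rho>1 > 0" "\<And>k. \<exists>C. \<forall>h x. cmod h < \<rho>1 \<longrightarrow> cmod ((Dx ^^ k) (u (t + h)) x) \<le> C"
    using du(2) by blast
  obtain \<rho>2 where \<rho>2: "\<rho>2 > 0" "\<And>k. \<exists>C. \<forall>h x. cmod h < \<rho>2 \<longrightarrow> cmod ((Dx ^^ k) (v (t + h)) x) \<le> C"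
    using dv(2) by blast
  show "\<exists>\<rho>>0. \<forall>k. \<exists>C. \<forall>h x. cmod h < \<rho> \<longrightarrow> cmod ((Dx ^^ k) (u (t + h)) x) \<le> C \<and> cmod ((Dx ^^ k) (v (t + h)) x) \<le> C"
  proof (rule exI[of _ "min \<rho>1 \<rho>2"], intro conjI allI)
    show "min \<rho>1 \<rho>2 > 0" using \<rho>1(1) \<rho>2(1) by simp
    fix k
    obtain C1 where C1: "\<And>h x. cmod h < \<rho>1 \<Longrightarrow> cmod ((Dx ^^ k) (u (t + h)) x) \<le> C1" using \<rho>1(2) by blast
    obtain C2 where C2: "\<And>h x. cmod h < \<rho>2 \<Longrightarrow> cmod ((Dx ^^ k) (v (t + h)) x) \<le> C2" using \<rho>2(2) by blast
    show "\<exists>C. \<forall>h x. cmod h < min \<rho>1 \<rho>2 \<longrightarrow> cmod ((Dx ^^ k) (u (t + h)) x) \<le> C \<and> cmod ((Dx ^^ k) (v (t + h)) x) \<le> C"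
      by (intro exI[of _ "max C1 C2"]) (use C1 C2 in \<open>auto simp: le_max_iff_disj\<close>)
  qed
qed

lemma flux_difference:
  fixes a c d :: complex
  shows "- a * (p - q) + c * ((p - q) * (p + q)) + d * ((p' - q') * (p' + q')) + (y - z) + (1 / 2) * ((y - z) * (y + z))
    = (- a * p + c * p\<^sup>2 + d * p'\<^sup>2 + y + y\<^sup>2 / 2) - (- a * q + c * q\<^sup>2 + d * q'\<^sup>2 + z + z\<^sup>2 / 2)"
  by (simp add: power2_eq_square algebra_simps)

text \<open>The difference of two solutions vanishes to every order at time zero: the right hand sides of
  the system depend on the solution in a way that preserves the order of vanishing, and integration
  in time raises it.\<close>

lemma CH_solution_unique:
  assumes r: "r \<ge> 3" and \<delta>: "\<delta> > 0" and R: "R > 0"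
    and sol1: "analytic_solution \<alpha> \<beta> \<delta> r (ball 0 R) u0 v0 u1 v1"
    and sol2: "analytic_solution \<alpha> \<beta> \<delta> r (ball 0 R) u0 v0 u2 v2"
    and t: "t \<in> ball 0 R"
  shows "u1 t = u2 t \<and> v1 t = v2 t"
proof -
  have r1: "r \<ge> 1" "r - 1 \<ge> 2" "r - 1 \<ge> 1" using r by auto
  have mem: "u \<tau> \<in> sobolev_smooth r" "v \<tau> \<in> sobolev_smooth r"
    if "analytic_solution \<alpha> \<beta> \<delta> r (ball 0 R) u0 v0 u v" "cmod \<tau> < R" for u v \<tau>
    using that by (auto simp: analytic_solution_def holomorphic_pair_def intro!: analytic_space_smooth)
  have z: "(0::complex) \<in> ball 0 R" using R by simp
  obtain \<rho>1 where \<rho>1: "\<rho>1 > 0" "\<And>k. \<exists>C. \<forall>h x. cmod h < \<rho>1 \<longrightarrow> cmod ((Dx ^^ k) (u1 h) x) \<le> C \<and> cmod ((Dx ^^ k) (v1 h) x) \<le> C"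
    using analytic_solution_derivative(3)[OF r \<delta> sol1 open_ball z] by auto
  obtain \<rho>2 where \<rho>2: "\<rho>2 > 0" "\<And>k. \<exists>C. \<forall>h x. cmod h < \<rho>2 \<longrightarrow> cmod ((Dx ^^ k) (u2 h) x) \<le> C \<and> cmod ((Dx ^^ k) (v2 h) x) \<le> C"
    using analytic_solution_derivative(3)[OF r \<delta> sol2 open_ball z] by auto
  define \<rho> where "\<rho> = min R (min \<rho>1 \<rho>2)"
  have \<rho>: "\<rho> > 0" "\<rho> \<le> R" using R \<rho>1(1) \<rho>2(1) by (auto simp: \<rho>_def)
  have M1: "u1 \<tau> \<in> sobolev_smooth r" "v1 \<tau> \<in> sobolev_smooth r" "u2 \<tau> \<in> sobolev_smooth r" "v2 \<tau> \<in> sobolev_smooth r"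
    if "cmod \<tau> < \<rho>" for \<tau>
    using mem[OF sol1] mem[OF sol2] that \<rho>(2) by auto
  have bounded: "uniform_order \<rho> 0 f"
    if bd: "\<And>k. \<exists>C. \<forall>h x. cmod h < \<rho>' \<longrightarrow> cmod ((Dx ^^ k) (f h) x) \<le> C" and le: "\<rho> \<le> \<rho>'"
      and S: "\<And>\<tau>. cmod \<tau> < \<rho> \<Longrightarrow> f \<tau> \<in> sobolev_smooth r" for f \<rho>'
  proof (rule uniform_orderI)
    show "f t \<in> smooth" if "cmod t < \<rho>" for t
      by (rule sobolev_smooth_smooth[OF S[OF that]])
    fix k
    obtain C where C: "\<And>h x. cmod h < \<rho>' \<Longrightarrow> cmod ((Dx ^^ k) (f h) x) \<le> C"
      using bd[of k] by blast
    show "\<exists>C. \<forall>t x. cmod t < \<rho> \<longrightarrow> cmod ((Dx ^^ k) (f t) x) \<le> C * cmod t ^ 0"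
      using C le by (intro exI[of _ C]) auto
  qed
  have \<rho>12: "\<rho> \<le> \<rho>1" "\<rho> \<le> \<rho>2" by (simp_all add: \<rho>_def)
  have O1: "uniform_order \<rho> 0 u1" "uniform_order \<rho> 0 v1"
    by (rule bounded[OF _ \<rho>12(1) M1(1)], use \<rho>1(2) in blast, assumption)
      (rule bounded[OF _ \<rho>12(1) M1(2)], use \<rho>1(2) in blast, assumption)
  have O2: "uniform_order \<rho> 0 u2" "uniform_order \<rho> 0 v2"
    by (rule bounded[OF _ \<rho>12(2) M1(3)], use \<rho>2(2) in blast, assumption)
      (rule bounded[OF _ \<rho>12(2) M1(4)], use \<rho>2(2) in blast, assumption)
  let ?w = "\<lambda>\<tau> x. u1 \<tau> x - u2 \<tau> x" and ?z = "\<lambda>\<tau> x. v1 \<tau> x - v2 \<tau> x"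
  have smooth_wz: "?w \<tau> \<in> smooth" "?z \<tau> \<in> smooth" if "cmod \<tau> < R" for \<tau>
    using mem[OF sol1 that] mem[OF sol2 that]
    by (simp_all add: smooth_diff(1) sobolev_smooth_smooth)
  have Dw: "(Dx ^^ k) (?w \<tau>) x = (Dx ^^ k) (u1 \<tau>) x - (Dx ^^ k) (u2 \<tau>) x"
    "(Dx ^^ k) (?z \<tau>) x = (Dx ^^ k) (v1 \<tau>) x - (Dx ^^ k) (v2 \<tau>) x" if "cmod \<tau> < R" for \<tau> k x
    using mem[OF sol1 that] mem[OF sol2 that] by (simp_all add: smooth_diff(2) sobolev_smooth_smooth)
  let ?G = "\<lambda>\<tau> x. CH_rhs_u \<alpha> \<beta> (u1 \<tau>) (v1 \<tau>) x - CH_rhs_u \<alpha> \<beta> (u2 \<tau>) (v2 \<tau>) x"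
  let ?H = "\<lambda>\<tau> x. CH_rhs_v (u1 \<tau>) (v1 \<tau>) x - CH_rhs_v (u2 \<tau>) (v2 \<tau>) x"
  have dw: "((\<lambda>\<tau>. (Dx ^^ k) (?w \<tau>) x) has_field_derivative (Dx ^^ k) (?G \<tau>) x) (at \<tau>)"
    and dz: "((\<lambda>\<tau>. (Dx ^^ k) (?z \<tau>) x) has_field_derivative (Dx ^^ k) (?H \<tau>) x) (at \<tau>)"
    if \<tau>: "cmod \<tau> < R" for \<tau> k x
  proof -
    have \<tau>': "\<tau> \<in> ball 0 R" using \<tau> by simp
    note m1 = mem[OF sol1 \<tau>] and m2 = mem[OF sol2 \<tau>]
    have e: "(Dx ^^ k) (?G \<tau>) x = (Dx ^^ k) (CH_rhs_u \<alpha> \<beta> (u1 \<tau>) (v1 \<tau>)) x - (Dx ^^ k) (CH_rhs_u \<alpha> \<beta> (u2 \<tau>) (v2 \<tau>)) x"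
      "(Dx ^^ k) (?H \<tau>) x = (Dx ^^ k) (CH_rhs_v (u1 \<tau>) (v1 \<tau>)) x - (Dx ^^ k) (CH_rhs_v (u2 \<tau>) (v2 \<tau>)) x"
      by (simp_all only: smooth_diff(2)[OF CH_rhs_smooth(1)[OF r m1] CH_rhs_smooth(1)[OF r m2]]
          smooth_diff(2)[OF CH_rhs_smooth(2)[OF r m1] CH_rhs_smooth(2)[OF r m2]])
    note d1 = analytic_solution_derivative(1,2)[OF r \<delta> sol1 open_ball \<tau>', of k x]
    note d2 = analytic_solution_derivative(1,2)[OF r \<delta> sol2 open_ball \<tau>', of k x]
    show "((\<lambda>\<tau>. (Dx ^^ k) (?w \<tau>) x) has_field_derivative (Dx ^^ k) (?G \<tau>) x) (at \<tau>)"
      unfolding e(1) by (rule has_field_derivative_transform_within_open[OF DERIV_diff[OF d1(1) d2(1)] open_ball \<tau>']) (simp add: Dw)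
    show "((\<lambda>\<tau>. (Dx ^^ k) (?z \<tau>) x) has_field_derivative (Dx ^^ k) (?H \<tau>) x) (at \<tau>)"
      unfolding e(2) by (rule has_field_derivative_transform_within_open[OF DERIV_diff[OF d1(2) d2(2)] open_ball \<tau>']) (simp add: Dw)
  qed
  have step: "uniform_order \<rho> n ?G \<and> uniform_order \<rho> n ?H" if w: "uniform_order \<rho> n ?w" and z: "uniform_order \<rho> n ?z" for n
  proof
    let ?F1 = "\<lambda>\<tau>. CH_flux \<alpha> \<beta> (u1 \<tau>) (v1 \<tau>)" and ?F2 = "\<lambda>\<tau>. CH_flux \<alpha> \<beta> (u2 \<tau>) (v2 \<tau>)"
    let ?F = "\<lambda>\<tau> x. ?F1 \<tau> x - ?F2 \<tau> x"
    have SF: "?F1 \<tau> \<in> sobolev_smooth (r - 1)" "?F2 \<tau> \<in> sobolev_smooth (r - 1)" if "cmod \<tau> < \<rho>" for \<tau>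
      by (intro CH_flux_sobolev_smooth r M1 that)+
    have oF: "uniform_order \<rho> n ?F"
    proof (rule uniform_order_cong)
      show "uniform_order \<rho> n (\<lambda>\<tau> x. (- of_real \<alpha>) * ?w \<tau> x + of_real ((3 - \<beta>) / 2) * (?w \<tau> x * (u1 \<tau> x + u2 \<tau> x))
          + of_real (\<beta> / 2) * (Dx (?w \<tau>) x * (Dx (u1 \<tau>) x + Dx (u2 \<tau>) x)) + ?z \<tau> x + (1 / 2) * (?z \<tau> x * (v1 \<tau> x + v2 \<tau> x)))"
        by (intro uniform_order_add uniform_order_cmult uniform_order_mult uniform_order_Dx w z O1 O2)
      fix \<tau> assume "cmod \<tau> < \<rho>"
      then have "Dx (?w \<tau>) x = Dx (u1 \<tau>) x - Dx (u2 \<tau>) x" for x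
        using Dw(1)[of \<tau> 1 x] \<rho>(2) by simp
      then show "(\<lambda>x. (- of_real \<alpha>) * ?w \<tau> x + of_real ((3 - \<beta>) / 2) * (?w \<tau> x * (u1 \<tau> x + u2 \<tau> x))
          + of_real (\<beta> / 2) * (Dx (?w \<tau>) x * (Dx (u1 \<tau>) x + Dx (u2 \<tau>) x)) + ?z \<tau> x + (1 / 2) * (?z \<tau> x * (v1 \<tau> x + v2 \<tau> x))) = ?F \<tau>"
        by (intro ext) (simp only: CH_flux_def flux_difference)
    qed
    show "uniform_order \<rho> n ?G"
    proof (rule uniform_order_cong)
      show "uniform_order \<rho> n (\<lambda>\<tau> x. (- 1) * (of_real (\<beta> / 2) * Dx (\<lambda>y. ?w \<tau> y * (u1 \<tau> y + u2 \<tau> y)) x + smoothing (?F \<tau>) x))"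
        by (intro uniform_order_add uniform_order_cmult uniform_order_mult uniform_order_Dx uniform_order_smoothing[OF oF _ r1(2)]
            w O1 O2 sobolev_smooth_diff[OF r1(3)] SF)
      fix \<tau> assume \<tau>: "cmod \<tau> < \<rho>"
      note s = M1[OF \<tau>, THEN sobolev_smooth_smooth]
      have "Dx (\<lambda>y. ?w \<tau> y * (u1 \<tau> y + u2 \<tau> y)) x = Dx (\<lambda>y. u1 \<tau> y * u1 \<tau> y) x - Dx (\<lambda>y. u2 \<tau> y * u2 \<tau> y) x" for x
        using fun_cong[OF smooth_diff(2)[OF smooth_mult(1)[OF s(1) s(1)] smooth_mult(1)[OF s(3) s(3)], of 1], of x]
        by (simp add: algebra_simps)
      then show "(\<lambda>x. (- 1) * (of_real (\<beta> / 2) * Dx (\<lambda>y. ?w \<tau> y * (u1 \<tau> y + u2 \<tau> y)) x + smoothing (?F \<tau>) x)) = ?G \<tau>"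
        unfolding smoothing_diff[OF SF[OF \<tau>] r1(2), symmetric] CH_rhs_u_def
        by (intro ext) (simp only:, simp add: right_diff_distrib)
    qed
    show "uniform_order \<rho> n ?H"
    proof (rule uniform_order_cong)
      show "uniform_order \<rho> n (\<lambda>\<tau> x. (- 1) * (Dx (?w \<tau>) x + Dx (\<lambda>y. ?w \<tau> y * v1 \<tau> y + ?z \<tau> y * u2 \<tau> y) x))"
        by (intro uniform_order_add uniform_order_cmult uniform_order_mult uniform_order_Dx w z O1 O2)
      fix \<tau> assume \<tau>: "cmod \<tau> < \<rho>"
      note s = M1[OF \<tau>, THEN sobolev_smooth_smooth]
      have "Dx (\<lambda>y. ?w \<tau> y * v1 \<tau> y + ?z \<tau> y * u2 \<tau> y) x = Dx (\<lambda>y. u1 \<tau> y * v1 \<tau> y) x - Dx (\<lambda>y. u2 \<tau> y * v2 \<tau> y) x" for x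
        using fun_cong[OF smooth_diff(2)[OF smooth_mult(1)[OF s(1) s(2)] smooth_mult(1)[OF s(3) s(4)], of 1], of x]
        by (simp add: algebra_simps)
      moreover have "Dx (?w \<tau>) x = Dx (u1 \<tau>) x - Dx (u2 \<tau>) x" for x
        using Dw(1)[of \<tau> 1 x] \<tau> \<rho>(2) by simp
      ultimately show "(\<lambda>x. (- 1) * (Dx (?w \<tau>) x + Dx (\<lambda>y. ?w \<tau> y * v1 \<tau> y + ?z \<tau> y * u2 \<tau> y) x)) = ?H \<tau>"
        unfolding CH_rhs_v_def by (auto simp: algebra_simps)
    qed
  qed
  have init: "u1 0 = u2 0" "v1 0 = v2 0"
    using sol1 sol2 by (auto simp: analytic_solution_def solves_CH_def fun_eq_iff)
  have "uniform_order \<rho> n ?w \<and> uniform_order \<rho> n ?z" for n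
  proof (induction n)
    case 0
    then show ?case by (intro conjI uniform_order_diff O1 O2)
  next
    case (Suc n)
    note G = step[OF conjunct1[OF Suc] conjunct2[OF Suc]]
    have z0: "cmod 0 < R" using R by simp
    show ?case
    proof
      show "uniform_order \<rho> (Suc n) ?w"
        by (rule uniform_order_integrate[OF _ conjunct1[OF G]]) (use \<rho>(2) smooth_wz dw Dw(1)[OF z0] init in auto)
      show "uniform_order \<rho> (Suc n) ?z"
        by (rule uniform_order_integrate[OF _ conjunct2[OF G]]) (use \<rho>(2) smooth_wz dz Dw(2)[OF z0] init in auto)
    qed
  qed
  then have o: "uniform_order \<rho> n ?w" "uniform_order \<rho> n ?z" for n
    by auto
  have ow: "\<exists>C. \<forall>\<tau>. cmod \<tau> < \<rho> \<longrightarrow> cmod (?w \<tau> x) \<le> C * cmod \<tau> ^ n" for n x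
    using uniform_order_bound[OF o(1), of 0 n] unfolding funpow_0 by blast
  have oz: "\<exists>C. \<forall>\<tau>. cmod \<tau> < \<rho> \<longrightarrow> cmod (?z \<tau> x) \<le> C * cmod \<tau> ^ n" for n x
    using uniform_order_bound[OF o(2), of 0 n] unfolding funpow_0 by blast
  have hol: "(\<lambda>\<tau>. ?w \<tau> x) holomorphic_on ball 0 R" "(\<lambda>\<tau>. ?z \<tau> x) holomorphic_on ball 0 R" for x
    unfolding holomorphic_on_open[OF open_ball]
  proof (safe intro!: exI)
    fix \<tau> :: complex assume "\<tau> \<in> ball 0 R"
    then have \<tau>: "cmod \<tau> < R" by simp
    show "((\<lambda>\<tau>. ?w \<tau> x) has_field_derivative (Dx ^^ 0) (?G \<tau>) x) (at \<tau>)"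
      "((\<lambda>\<tau>. ?z \<tau> x) has_field_derivative (Dx ^^ 0) (?H \<tau>) x) (at \<tau>)"
      using dw[OF \<tau>, of 0 x] dz[OF \<tau>, of 0 x] by simp_all
  qed
  have "?w t x = 0" "?z t x = 0" for x
    by (rule holomorphic_zero_of_infinite_order[OF hol(1) \<rho> ow t], rule holomorphic_zero_of_infinite_order[OF hol(2) \<rho> oz t])
  then show ?thesis by (auto simp: fun_eq_iff)
qed

section \<open>The lifespan\<close>

theorem theorem8:
  fixes \<alpha> \<beta> s :: real
  assumes "s \<ge> 2"
  shows "\<exists>T :: (real \<Rightarrow> real) \<times> (real \<Rightarrow> real) \<Rightarrow> real.
    (\<forall>u0 v0. u0 \<in> analytic_space_real 1 (s + 1) \<longrightarrow> v0 \<in> analytic_space_real 1 (s + 1) \<longrightarrow>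
       T (u0, v0) > 0 \<and>
       (\<forall>\<delta>\<in>{0<..<1}. \<exists>u v.
          analytic_solution \<alpha> \<beta> \<delta> (s + 1) (ball 0 (T (u0, v0) * (1 - \<delta>))) u0 v0 u v \<and>
          (\<forall>t \<in> ball 0 (T (u0, v0) * (1 - \<delta>)). t \<in> \<real> \<longrightarrow> (\<forall>x. u t x \<in> \<real> \<and> v t x \<in> \<real>)) \<and>
          (\<forall>u' v'.
             analytic_solution \<alpha> \<beta> \<delta> (s + 1) (ball 0 (T (u0, v0) * (1 - \<delta>))) u0 v0 u' v' \<longrightarrow>
             (\<forall>t \<in> ball 0 (T (u0, v0) * (1 - \<delta>)). u' t = u t \<and> v' t = v t)))) \<and>
    (\<exists>C>0. T \<sim>[large_data (s + 1)] (\<lambda>w. C / pair_norm_real 1 (s + 1) w)) \<and>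
    (\<exists>C>0. T \<sim>[small_data (s + 1)] (\<lambda>w. C))"
proof -
  define r where "r = s + 1"
  have r: "r \<ge> 3" using assms by (simp add: r_def)
  define c where "c = rate_const \<alpha> \<beta> r"
  have c: "c > 0" unfolding c_def by (rule rate_const_pos)
  let ?N = "pair_norm_real 1 r"
  \<comment> \<open>the reciprocal of the rate \<open>K\<close> of the majorant; both asymptotic regimes are visible in the formula\<close>
  define T where "T w = 1 / (c * (1 + ?N w))" for w
  have main: "T (u0, v0) > 0 \<and>
       (\<forall>\<delta>\<in>{0<..<1}. \<exists>u v.
          analytic_solution \<alpha> \<beta> \<delta> r (ball 0 (T (u0, v0) * (1 - \<delta>))) u0 v0 u v \<and>
          (\<forall>t \<in> ball 0 (T (u0, v0) * (1 - \<delta>)). t \<in> \<real> \<longrightarrow> (\<forall>x. u t x \<in> \<real> \<and> v t x \<in> \<real>)) \<and>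
          (\<forall>u' v'.
             analytic_solution \<alpha> \<beta> \<delta> r (ball 0 (T (u0, v0) * (1 - \<delta>))) u0 v0 u' v' \<longrightarrow>
             (\<forall>t \<in> ball 0 (T (u0, v0) * (1 - \<delta>)). u' t = u t \<and> v' t = v t)))"
    if u0: "u0 \<in> analytic_space_real 1 r" and v0: "v0 \<in> analytic_space_real 1 r" for u0 v0
  proof
    have "?N (u0, v0) \<ge> 0"
      using u0 v0 by (auto simp: pair_norm_real_def pair_norm_def analytic_space_real_def intro!: add_nonneg_nonneg analytic_norm_nonneg)
    then show T0: "T (u0, v0) > 0"
      using c by (simp add: T_def)
    show "\<forall>\<delta>\<in>{0<..<1}. \<exists>u v.
          analytic_solution \<alpha> \<beta> \<delta> r (ball 0 (T (u0, v0) * (1 - \<delta>))) u0 v0 u v \<and>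
          (\<forall>t \<in> ball 0 (T (u0, v0) * (1 - \<delta>)). t \<in> \<real> \<longrightarrow> (\<forall>x. u t x \<in> \<real> \<and> v t x \<in> \<real>)) \<and>
          (\<forall>u' v'.
             analytic_solution \<alpha> \<beta> \<delta> r (ball 0 (T (u0, v0) * (1 - \<delta>))) u0 v0 u' v' \<longrightarrow>
             (\<forall>t \<in> ball 0 (T (u0, v0) * (1 - \<delta>)). u' t = u t \<and> v' t = v t))"
    proof
      fix \<delta> :: real assume "\<delta> \<in> {0<..<1}"
      then have \<delta>: "0 < \<delta>" "\<delta> < 1" by auto
      define R where "R = T (u0, v0) * (1 - \<delta>)"
      have R_eq: "(1 - \<delta>) / (rate_const \<alpha> \<beta> r * (1 + ?N (u0, v0))) = R"
        by (simp add: R_def T_def c_def)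
      have R: "R > 0" using T0 \<delta> by (simp add: R_def)
      obtain u v where uv: "analytic_solution \<alpha> \<beta> \<delta> r (ball 0 R) u0 v0 u v"
        "\<And>t x. t \<in> ball 0 R \<Longrightarrow> t \<in> \<real> \<Longrightarrow> u t x \<in> \<real> \<and> v t x \<in> \<real>"
        using CH_solution_exists[OF r u0 v0 refl \<delta>, of \<alpha> \<beta>] unfolding R_eq by blast
      show "\<exists>u v. analytic_solution \<alpha> \<beta> \<delta> r (ball 0 (T (u0, v0) * (1 - \<delta>))) u0 v0 u v \<and>
          (\<forall>t \<in> ball 0 (T (u0, v0) * (1 - \<delta>)). t \<in> \<real> \<longrightarrow> (\<forall>x. u t x \<in> \<real> \<and> v t x \<in> \<real>)) \<and>
          (\<forall>u' v'.
             analytic_solution \<alpha> \<beta> \<delta> r (ball 0 (T (u0, v0) * (1 - \<delta>))) u0 v0 u' v' \<longrightarrow>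
             (\<forall>t \<in> ball 0 (T (u0, v0) * (1 - \<delta>)). u' t = u t \<and> v' t = v t))"
        unfolding R_def[symmetric]
        using uv CH_solution_unique[OF r \<delta>(1) R _ uv(1)] by blast
    qed
  qed
  have large: "T \<sim>[large_data r] (\<lambda>w. (1 / c) / ?N w)"
  proof (rule asymp_equivI')
    have N: "filterlim ?N at_top (large_data r)"
      unfolding large_data_def by (rule filterlim_mono[OF filterlim_filtercomap order_refl inf_le1])
    have "((\<lambda>w. 1 / (1 + inverse (?N w))) \<longlongrightarrow> 1 / (1 + 0)) (large_data r)"
      by (intro tendsto_divide tendsto_add tendsto_const filterlim_compose[OF tendsto_inverse_0_at_top[OF filterlim_ident] N]) simp
    moreover have "\<forall>\<^sub>F w in large_data r. 1 / (1 + inverse (?N w)) = T w / ((1 / c) / ?N w)"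
      using filterlim_at_top_dense[THEN iffD1, OF N, rule_format, of 0]
    proof eventually_elim
      case (elim w)
      then have "1 + inverse (?N w) = (1 + ?N w) / ?N w" by (simp add: field_simps)
      then show ?case using c elim by (simp add: T_def)
    qed
    ultimately show "((\<lambda>w. T w / ((1 / c) / ?N w)) \<longlongrightarrow> 1) (large_data r)"
      using Lim_transform_eventually by fastforce
  qed
  have small: "T \<sim>[small_data r] (\<lambda>w. 1 / c)"
  proof (rule asymp_equivI')
    have N: "(?N \<longlongrightarrow> 0) (small_data r)"
      unfolding small_data_def by (rule filterlim_mono[OF filterlim_filtercomap order_refl inf_le1])
    have "((\<lambda>w. 1 / (1 + ?N w)) \<longlongrightarrow> 1 / (1 + 0)) (small_data r)"
      by (intro tendsto_intros N) simp
    moreover have "T w / (1 / c) = 1 / (1 + ?N w)" for w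
      using c by (simp add: T_def)
    ultimately show "((\<lambda>w. T w / (1 / c)) \<longlongrightarrow> 1) (small_data r)"
      by simp
  qed
  show ?thesis
    unfolding r_def[symmetric]
  proof (intro exI[of _ T] conjI allI impI)
    show "\<exists>C>0. T \<sim>[large_data r] (\<lambda>w. C / ?N w)" "\<exists>C>0. T \<sim>[small_data r] (\<lambda>w. C)"
      using large small c by (intro exI[of _ "1 / c"], simp)+
  qed (use main in blast)+
qed

end
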